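(* For $t>0$ and $z\in[0,\pi)$, $$p_t(0,z)=\frac{\pi^2e^t}{4t^2}\,e^{-\frac{2\pi z-z^2}{4t}}\sum_{k\in\mathbb Z}e^{-\frac{k(k+1)\pi^2}{t}}\,\frac{(2k+1)+2k\,e^{-\frac{\pi}{2t}(z+2k\pi)}}{\left(1+e^{-\frac{\pi}{2t}(z+2k\pi)}\right)^2};$$ therefore, when $t\to0$, $$p_t(0,z)=\frac{\pi^2e^t}{4t^2}\,e^{-\frac{2\pi z-z^2}{4t}}\left(1+O(e^{-\frac{C}{t}})\right).$$
   Context: Here $C$ denotes a positive constant. $\mathbf{SU}(2)$ is the group of $2\times2$ complex unitary matrices of determinant $1$. Let $X,Y,Z$ be the left-invariant vector fields on $\mathbf{SU}(2)$ corresponding to the elements $\begin{pmatrix}0&1\\-1&0\end{pmatrix}$, $\begin{pmatrix}0&i\\i&0\end{pmatrix}$, $\begin{pmatrix}i&0\\0&-i\end{pmatrix}$ of its Lie algebra; they satisfy $[Z,X]=2Y$, $[X,Y]=2Z$, $[Y,Z]=2X$. Put $\mathcal L=X^2+Y^2$ (a subelliptic operator). Cylindric coordinates $(r,\theta,z)$, $0\le r<\pi/2$, $\theta\in[0,2\pi]$, $z\in[-\pi,\pi]$, are given by $$(r,\theta,z)\mapsto \exp(r\cos\theta\,X+r\sin\theta\,Y)\exp(zZ).$$ The bi-invariant normalized Haar measure is $d\mu=\frac{1}{4\pi^2}\sin 2r\,dr\,d\theta\,dz$. The semigroup $P_t=e^{t\mathcal L}$ has a smooth kernel with respect to $\mu$;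 the heat kernel issued from the identity depends only on $(r,z)$ and is written $p_t(r,z)$.
   Formalization: The asymptotic as t→0 is proved for each fixed z in (0,π), with C and the implied constant depending on z; z=0 is excluded because there the series tends to 1/4, not 1, and no C uniform in z∈(0,π) exists. The exact formula is proved for all z in [0,π). *)

theory Defs
  imports "HOL-Analysis.Analysis" "HOL-Library.Landau_Symbols"
begin

type_synonym cmat2 = "complex^2^2"

definition cadjoint :: "cmat2 \<Rightarrow> cmat2"
  where "cadjoint A = (\<chi> i j. cnj (A $ j $ i))"

definition SU2 :: "cmat2 set"
  where "SU2 = {A. A ** cadjoint A = mat 1 \<and> cadjoint A ** A = mat 1 \<and> det A = 1}"

definition mX :: cmat2 where "mX = vector [vector [0, 1], vector [-1, 0]]"
definition mY :: cmat2 where "mY = vector [vector [0, \<i>], vector [\<i>, 0]]"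
definition mZ :: cmat2 where "mZ = vector [vector [\<i>, 0], vector [0, -\<i>]]"

text \<open>The type of matrices carries the componentwise product, so the library's power and
  exponential functions are not the matrix ones.\<close>

primrec matpow :: "cmat2 \<Rightarrow> nat \<Rightarrow> cmat2" where
  "matpow A 0 = mat 1"
| "matpow A (Suc n) = A ** matpow A n"

definition mexp :: "cmat2 \<Rightarrow> cmat2"
  where "mexp A = (\<Sum>n. matpow A n /\<^sub>R fact n)"

text \<open>For open \<open>U\<close>: all iterated directional derivatives up to order \<open>n\<close> exist and are
  continuous.\<close>

primrec Ck_on :: "nat \<Rightarrow> ('a::euclidean_space \<Rightarrow> real) \<Rightarrow> 'a set \<Rightarrow> bool" where
  "Ck_on 0 f U \<longleftrightarrow> continuous_on U f"
| "Ck_on (Suc n) f U \<longleftrightarrow>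
     (\<forall>x\<in>U. f differentiable (at x)) \<and> (\<forall>v. Ck_on n (\<lambda>x. frechet_derivative f (at x) v) U)"

text \<open>Smoothness of a function on an embedded submanifold \<open>S\<close>, as the existence of a smooth
  extension to an open neighbourhood; values of \<open>f\<close> outside \<open>S\<close> are irrelevant.\<close>

definition smooth_on :: "'a::euclidean_space set \<Rightarrow> ('a \<Rightarrow> real) \<Rightarrow> bool"
  where "smooth_on S f \<longleftrightarrow>
    (\<exists>U F. open U \<and> S \<subseteq> U \<and> (\<forall>n. Ck_on n F U) \<and> (\<forall>x\<in>S. F x = f x))"

definition left_inv_field :: "cmat2 \<Rightarrow> (cmat2 \<Rightarrow> real) \<Rightarrow> cmat2 \<Rightarrow> real"
  where "left_inv_field A f g = deriv (\<lambda>s. f (g ** mexp (s *\<^sub>R A))) 0"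

definition subLaplacian :: "(cmat2 \<Rightarrow> real) \<Rightarrow> cmat2 \<Rightarrow> real"
  where "subLaplacian f g =
    left_inv_field mX (left_inv_field mX f) g + left_inv_field mY (left_inv_field mY f) g"

definition cyl :: "real \<times> real \<times> real \<Rightarrow> cmat2"
  where "cyl = (\<lambda>(r, \<theta>, z).
    mexp ((r * cos \<theta>) *\<^sub>R mX + (r * sin \<theta>) *\<^sub>R mY) ** mexp (z *\<^sub>R mZ))"

text \<open>The measure $\frac{1}{4\pi^2}\sin 2r\,dr\,d\theta\,dz$ transported to \<open>SU2\<close>, which is its
  space, so that measurability and integrals ignore values at other matrices.\<close>

definition haar :: "cmat2 measure"
  where "haar =
    distr
      (density lborel (\<lambda>(r, \<theta>, z). ennreal (
         indicator ({0..<pi/2} \<times> {0..2*pi} \<times> {-pi..pi}) (r, \<theta>, z) * (sin (2*r) / (4 * pi^2)))))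
      (restrict_space borel SU2)
      cyl"

text \<open>Elements of $L^2(\mu)$ are represented by functions; equalities between them hold almost
  everywhere. Since integrals of non-integrable functions are 0, \<open>L2norm\<close> is only meaningful
  on \<open>L2\<close>.\<close>

definition L2 :: "(cmat2 \<Rightarrow> real) set"
  where "L2 = {f \<in> borel_measurable haar. integrable haar (\<lambda>x. (f x)^2)}"

definition L2norm :: "(cmat2 \<Rightarrow> real) \<Rightarrow> real"
  where "L2norm f = sqrt (\<integral>x. (f x)^2 \<partial>haar)"

definition L2_tendsto :: "('i \<Rightarrow> cmat2 \<Rightarrow> real) \<Rightarrow> (cmat2 \<Rightarrow> real) \<Rightarrow> 'i filter \<Rightarrow> bool"
  where "L2_tendsto f g F \<longleftrightarrow> ((\<lambda>i. L2norm (\<lambda>x. f i x - g x)) \<longlongrightarrow> 0) F"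

definition C0_semigroup :: "(real \<Rightarrow> (cmat2 \<Rightarrow> real) \<Rightarrow> cmat2 \<Rightarrow> real) \<Rightarrow> bool"
  where "C0_semigroup P \<longleftrightarrow>
    (\<forall>t\<ge>0. \<forall>f\<in>L2. P t f \<in> L2) \<and>
    (\<forall>t\<ge>0. \<forall>f\<in>L2. \<forall>g\<in>L2. \<forall>a b.
       AE x in haar. P t (\<lambda>y. a * f y + b * g y) x = a * P t f x + b * P t g x) \<and>
    (\<forall>t\<ge>0. \<exists>M. \<forall>f\<in>L2. L2norm (P t f) \<le> M * L2norm f) \<and>
    (\<forall>f\<in>L2. AE x in haar. P 0 f x = f x) \<and>
    (\<forall>s\<ge>0. \<forall>t\<ge>0. \<forall>f\<in>L2. AE x in haar. P (s + t) f x = P s (P t f) x) \<and>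
    (\<forall>f\<in>L2. L2_tendsto (\<lambda>t. P t f) f (at_right 0))"

text \<open>\<open>f\<close> lies in the domain of the generator of \<open>P\<close>, which maps it to \<open>g\<close>.\<close>

definition generator :: "(real \<Rightarrow> (cmat2 \<Rightarrow> real) \<Rightarrow> cmat2 \<Rightarrow> real) \<Rightarrow>
    (cmat2 \<Rightarrow> real) \<Rightarrow> (cmat2 \<Rightarrow> real) \<Rightarrow> bool"
  where "generator P f g \<longleftrightarrow> f \<in> L2 \<and> g \<in> L2 \<and>
    L2_tendsto (\<lambda>t x. (P t f x - f x) / t) g (at_right 0)"

text \<open>The graph of the closure in $L^2(\mu)$ of the operator $X^2+Y^2$ with domain
  $C^\infty(SU(2))$; this closure is self-adjoint.\<close>

definition closed_subLaplacian :: "(cmat2 \<Rightarrow> real) \<Rightarrow> (cmat2 \<Rightarrow> real) \<Rightarrow> bool"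
  where "closed_subLaplacian f g \<longleftrightarrow> f \<in> L2 \<and> g \<in> L2 \<and>
    (\<exists>\<phi> :: nat \<Rightarrow> cmat2 \<Rightarrow> real. (\<forall>n. smooth_on SU2 (\<phi> n)) \<and>
       L2_tendsto \<phi> f sequentially \<and> L2_tendsto (\<lambda>n. subLaplacian (\<phi> n)) g sequentially)"

text \<open>\<open>P\<close> is the semigroup $e^{t\mathcal L}$ on $L^2(\mu)$.\<close>

definition heat_semigroup :: "(real \<Rightarrow> (cmat2 \<Rightarrow> real) \<Rightarrow> cmat2 \<Rightarrow> real) \<Rightarrow> bool"
  where "heat_semigroup P \<longleftrightarrow>
    C0_semigroup P \<and> (\<forall>f g. generator P f g \<longleftrightarrow> closed_subLaplacian f g)"

text \<open>\<open>p t x y\<close> is the density at \<open>y\<close> of the heat kernel issued from \<open>x\<close>; thus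
  \<open>p t (mat 1)\<close> is the heat kernel issued from the identity.\<close>

definition smooth_kernel :: "(real \<Rightarrow> (cmat2 \<Rightarrow> real) \<Rightarrow> cmat2 \<Rightarrow> real) \<Rightarrow>
    (real \<Rightarrow> cmat2 \<Rightarrow> cmat2 \<Rightarrow> real) \<Rightarrow> bool"
  where "smooth_kernel P p \<longleftrightarrow>
    smooth_on ({0<..} \<times> SU2 \<times> SU2) (\<lambda>(t, x, y). p t x y) \<and>
    (\<forall>t>0. \<forall>f\<in>L2. AE x in haar. P t f x = (\<integral>y. p t x y * f y \<partial>haar))"

end

theory Submission
  imports Defs "HOL-Complex_Analysis.Complex_Analysis" "HOL-Real_Asymp.Real_Asymp"
begin

text \<open>
  Write \<open>a = cos r * cis z\<close> for the upper left entry of a group element with coordinates \<open>(r, \<theta>, z)\<close>. The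
  point \<open>exp (z Z)\<close> is the only element of the group with \<open>a = cis z\<close>. The value of the kernel there is read
  off from its integrals against the monomials \<open>a^p * cnj a^q\<close>. This gives a spectral series, which a
  residue computation turns into the short-time series.

  Spectral series. The sub-Laplacian maps \<open>a^p * cnj a^q\<close> to a multiple of itself plus a multiple of
  \<open>a^(p-1) * cnj a^(q-1)\<close> (\<open>sub_lap_disk_monomial\<close>). This triangular action is diagonalised by the Zernike
  polynomials of the unit disk: every monomial is an explicit combination of eigenfunctions that take the
  value 1 at the identity (\<open>disk_monomial_expansion\<close>, \<open>sub_lap_zernike\<close>). The semigroup multiplies an
  eigenfunction of eigenvalue \<open>-l\<close> by \<open>exp (- l * t)\<close>, and by continuity of the kernel this holds at
  the identity matrix itself (\<open>kernel_eigenfunction\<close>). So the integrals of the kernel against monomials are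
  known. The Fejer kernel \<open>\<bar>\<Sum>p<M. (a * cis (- z))^p\<bar>^2\<close> is a finite combination of monomials and
  concentrates at \<open>a = cis z\<close> as \<open>M\<close> grows (\<open>fejer_concentration\<close>). Integrating against it and letting
  \<open>M\<close> tend to infinity gives the value of the kernel at \<open>exp (z Z)\<close> (\<open>kernel_spectral_expansion\<close>):
  the sum over \<open>i, j \<ge> 0\<close> of \<open>(i + j + 1) * exp (- (4 i j + 2 i + 2 j) * t) * cos ((i - j) * z)\<close>.

  Short-time series. Since \<open>4 i j + 2 i + 2 j + 1 = (2 i + 1) * (2 j + 1)\<close>, summing over \<open>j\<close> leaves a sum
  over the odd integers \<open>m\<close> of \<open>m * exp (\<i> * m * z / 2) / sinh (t * m + \<i> * z / 2)\<close>. The residue theorem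
  on growing rectangles exchanges it for the residues at the zeros of \<open>sinh\<close>, which lie on the imaginary axis
  (\<open>residue_sum_tendsto_0\<close>). With \<open>x = exp (- pi * z / (2 * t))\<close> and \<open>x * y = exp (- pi^2 / t)\<close> those
  residues are the row and column sums of one double series, with general term
  \<open>(-1)^(k + j) * x^(j + 1) * y^k * (x * y)^(k * j)\<close> weighted by \<open>k + j + 1\<close>. Summing the same series along
  hooks, that is for fixed \<open>k\<close> over \<open>j \<ge> k\<close> and for fixed \<open>j\<close> over \<open>k > j\<close>, gives the claimed formula term by
  term (\<open>lattice_duality\<close>, \<open>hook_sum_theta_term\<close>). The point \<open>z = 0\<close> follows by continuity. For the
  asymptotics, the term \<open>k = 0\<close> differs from 1, and all the others together differ from 0, by at most a
  constant times \<open>exp (- pi * z / (2 * t))\<close>.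
\<close>

section \<open>Matrix exponentials in SU(2) and cylindric coordinates\<close>

(* For vectors the infix dollar selects a component, not the coefficient of a power series. *)
no_notation fps_nth (infixl "$" 75)

lemma mat2_eq_iff: "(A::cmat2) = B \<longleftrightarrow> A$1$1 = B$1$1 \<and> A$1$2 = B$1$2 \<and> A$2$1 = B$2$1 \<and> A$2$2 = B$2$2"
  unfolding vec_eq_iff forall_2 by blast

lemma mat2_mult_entry: "((A::cmat2) ** B)$i$j = A$i$1 * B$1$j + A$i$2 * B$2$j"
  by (simp add: matrix_matrix_mult_def sum_2)

lemma mat2_one: "(mat 1 :: cmat2)$1$1 = 1" "(mat 1 :: cmat2)$1$2 = 0"
  "(mat 1 :: cmat2)$2$1 = 0" "(mat 1 :: cmat2)$2$2 = 1"
  by (simp_all add: mat_def)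

lemma matpow_square_neg_one:
  fixes J :: cmat2
  assumes "J ** J = - mat 1"
  shows "matpow (s *\<^sub>R J) n /\<^sub>R fact n = (cos_coeff n * s ^ n) *\<^sub>R mat 1 + (sin_coeff n * s ^ n) *\<^sub>R J"
proof -
  have sc: "(c *\<^sub>R A) ** B = c *\<^sub>R (A ** B)" "A ** (c *\<^sub>R B) = c *\<^sub>R (A ** B)" for c :: real and A B :: cmat2
    by (simp_all add: mat2_eq_iff mat2_mult_entry algebra_simps)
  have ad: "A ** (B + C) = A ** B + A ** C" for A B C :: cmat2
    by (simp add: mat2_eq_iff mat2_mult_entry algebra_simps)
  have "matpow (s *\<^sub>R J) n = (fact n * cos_coeff n * s ^ n) *\<^sub>R mat 1 + (fact n * sin_coeff n * s ^ n) *\<^sub>R J"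
  proof (induction n)
    case 0
    show ?case by (simp add: cos_coeff_def sin_coeff_def)
  next
    case (Suc n)
    have "matpow (s *\<^sub>R J) (Suc n) = (fact n * cos_coeff n * s ^ Suc n) *\<^sub>R J
        - (fact n * sin_coeff n * s ^ Suc n) *\<^sub>R mat 1"
      by (simp add: Suc.IH sc ad assms algebra_simps)
    moreover have "fact (Suc n) * cos_coeff (Suc n) = - (fact n * sin_coeff n)"
      "fact (Suc n) * sin_coeff (Suc n) = fact n * cos_coeff n"
      by (simp_all add: cos_coeff_Suc sin_coeff_Suc del: of_nat_Suc)
    ultimately show ?case by simp
  qed
  then show ?thesis by (simp add: scaleR_right_distrib field_simps)
qed

text \<open>
  A square root of \<open>-1\<close> exponentiates like the imaginary unit: the even powers collect into the cosine series
  and the odd powers into the sine series. Every exponential in the definition of \<open>cyl\<close> is of this kind.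
\<close>

lemma mexp_square_neg_one:
  fixes J :: cmat2
  assumes "J ** J = - mat 1"
  shows "mexp (s *\<^sub>R J) = cos s *\<^sub>R mat 1 + sin s *\<^sub>R J"
proof -
  have "(\<lambda>n. (cos_coeff n * s ^ n) *\<^sub>R mat 1 + (sin_coeff n * s ^ n) *\<^sub>R J) sums
      (cos s *\<^sub>R mat 1 + sin s *\<^sub>R J)"
    using cos_converges[of s] sin_converges[of s]
    by (intro sums_add sums_scaleR_left) auto
  then show ?thesis
    unfolding mexp_def matpow_square_neg_one[OF assms] by (simp add: sums_iff)
qed

text \<open>
  The parametrisation of the group by the unit sphere of \<open>\<complex>^2\<close>; \<open>(a, b)\<close> is the first row.
\<close>

definition su2_mat :: "complex \<Rightarrow> complex \<Rightarrow> cmat2"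
  where "su2_mat a b = vector [vector [a, b], vector [- cnj b, cnj a]]"

lemma su2_mat_entry [simp]:
  "su2_mat a b $ 1 $ 1 = a" "su2_mat a b $ 1 $ 2 = b"
  "su2_mat a b $ 2 $ 1 = - cnj b" "su2_mat a b $ 2 $ 2 = cnj a"
  by (simp_all add: su2_mat_def)

lemma cmod_sq_complex: "complex_of_real ((cmod a)\<^sup>2) = a * cnj a"
  by (metis complex_norm_square)

lemma su2_mat_in_SU2:
  assumes "(cmod a)\<^sup>2 + (cmod b)\<^sup>2 = 1"
  shows "su2_mat a b \<in> SU2"
proof -
  have *: "a * cnj a + b * cnj b = 1"
    using arg_cong[OF assms, of complex_of_real] by (simp only: of_real_add cmod_sq_complex of_real_1)
  then show ?thesis
    by (simp add: SU2_def mat2_eq_iff mat2_mult_entry cadjoint_def mat2_one det_2 algebra_simps)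
qed

text \<open>
  Solving the unitarity relations for the second row, with the determinant relation to eliminate the first.
\<close>

lemma SU2_E:
  assumes "g \<in> SU2"
  shows "g = su2_mat (g$1$1) (g$1$2)" and "(cmod (g$1$1))\<^sup>2 + (cmod (g$1$2))\<^sup>2 = 1"
proof -
  define a b c d where abcd: "a = g$1$1" "b = g$1$2" "c = g$2$1" "d = g$2$2"
  have h: "a * cnj a + b * cnj b = 1" "c * cnj a + d * cnj b = 0" "a * d - b * c = 1"
    using assms by (simp_all add: SU2_def mat2_eq_iff mat2_mult_entry cadjoint_def mat2_one det_2 abcd)
  have "cnj a = cnj a * (a * d - b * c)" using h(3) by simp
  also have "\<dots> = d * (a * cnj a + b * cnj b) - b * (c * cnj a + d * cnj b)" by (simp add: algebra_simps)
  finally have d: "d = cnj a" using h by simp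
  have "cnj b = cnj b * (a * d - b * c)" using h(3) by simp
  also have "\<dots> = a * (c * cnj a + d * cnj b) - c * (a * cnj a + b * cnj b)" by (simp add: algebra_simps)
  finally have c: "c = - cnj b" using h by simp
  show "g = su2_mat (g$1$1) (g$1$2)" using c d by (simp add: mat2_eq_iff abcd)
  have "complex_of_real ((cmod a)\<^sup>2 + (cmod b)\<^sup>2) = 1"
    using h(1) by (simp only: of_real_add cmod_sq_complex)
  then show "(cmod (g$1$1))\<^sup>2 + (cmod (g$1$2))\<^sup>2 = 1" unfolding abcd of_real_eq_1_iff .
qed

lemma mexp_XY: "mexp ((r * cos \<theta>) *\<^sub>R mX + (r * sin \<theta>) *\<^sub>R mY) = su2_mat (of_real (cos r)) (of_real (sin r) * cis \<theta>)"
proof -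
  let ?J = "cos \<theta> *\<^sub>R mX + sin \<theta> *\<^sub>R mY"
  have sq: "complex_of_real (cos \<theta>) * cos \<theta> + sin \<theta> * sin \<theta> = 1"
    by (metis of_real_1 of_real_add of_real_mult power2_eq_square sin_cos_squared_add2)
  have J: "?J = su2_mat 0 (cis \<theta>)"
    by (simp add: mat2_eq_iff mX_def mY_def complex_eq_iff)
  have "?J ** ?J = - mat 1"
    unfolding J by (simp add: mat2_eq_iff mat2_mult_entry mat2_one cis_mult cis_cnj)
  from mexp_square_neg_one[OF this, of r] show ?thesis unfolding J[symmetric]
    by (simp add: scaleR_right_distrib mat2_eq_iff mat2_one mX_def mY_def complex_eq_iff)
qed

lemma mexp_X: "mexp (s *\<^sub>R mX) = su2_mat (of_real (cos s)) (of_real (sin s))"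
  using mexp_XY[of s 0] by simp

lemma mexp_Y: "mexp (s *\<^sub>R mY) = su2_mat (of_real (cos s)) (\<i> * of_real (sin s))"
  using mexp_XY[of s "pi/2"] by (simp add: mult.commute)

lemma mexp_Z: "mexp (s *\<^sub>R mZ) = su2_mat (cis s) 0"
proof -
  have "mZ ** mZ = - mat 1"
    by (simp add: mat2_eq_iff mat2_mult_entry mat2_one mZ_def)
  from mexp_square_neg_one[OF this, of s] show ?thesis
    by (simp add: mat2_eq_iff mat2_one mZ_def complex_eq_iff)
qed

text \<open>
  The upper left entry carries the coordinates \<open>(r, z)\<close>, the upper right one the angle \<open>\<theta> - z\<close>.
\<close>

lemma cyl_eq: "cyl (r, \<theta>, z) = su2_mat (of_real (cos r) * cis z) (of_real (sin r) * cis (\<theta> - z))"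
proof -
  have "cyl (r, \<theta>, z) = su2_mat (of_real (cos r)) (of_real (sin r) * cis \<theta>) ** su2_mat (cis z) 0"
    by (simp add: cyl_def mexp_XY mexp_Z)
  also have "\<dots> = su2_mat (of_real (cos r) * cis z) (of_real (sin r) * cis (\<theta> - z))"
    by (simp add: mat2_eq_iff mat2_mult_entry cis_cnj cis_mult)
  finally show ?thesis .
qed

lemma cyl_in_SU2: "cyl x \<in> SU2"
proof (cases x)
  case (fields r \<theta> z)
  show ?thesis unfolding fields cyl_eq by (rule su2_mat_in_SU2) (simp add: norm_mult)
qed

section \<open>The sub-Laplacian on functions of the upper left entry\<close>

lemma has_vector_derivative_power:
  fixes f :: "real \<Rightarrow> 'a::real_normed_field"
  assumes "(f has_vector_derivative f') (at x)"
  shows "((\<lambda>s. f s ^ n) has_vector_derivative (of_nat n * f x ^ (n - 1) * f')) (at x)"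
  using has_derivative_power[OF assms[unfolded has_vector_derivative_def], of n]
  by (simp add: has_vector_derivative_def mult_ac)

text \<open>
  The counterpart of \<open>left_inv_field\<close> for complex functions, as a relation: the derivative is required to
  exist, which the operator \<open>deriv\<close> leaves open.
\<close>

definition dir_deriv :: "cmat2 \<Rightarrow> (cmat2 \<Rightarrow> complex) \<Rightarrow> (cmat2 \<Rightarrow> complex) \<Rightarrow> bool"
  where "dir_deriv A \<Phi> \<Phi>' \<longleftrightarrow>
    (\<forall>g. ((\<lambda>s. \<Phi> (g ** mexp (s *\<^sub>R A))) has_vector_derivative \<Phi>' g) (at 0))"

lemma left_inv_field_Re:
  assumes "dir_deriv A \<Phi> \<Phi>'"
  shows "left_inv_field A (\<lambda>g. Re (c * \<Phi> g)) = (\<lambda>g. Re (c * \<Phi>' g))"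
proof
  fix g
  have "((\<lambda>s. \<Phi> (g ** mexp (s *\<^sub>R A))) has_vector_derivative \<Phi>' g) (at 0)"
    using assms by (simp add: dir_deriv_def)
  then have "((\<lambda>s. Re (c * \<Phi> (g ** mexp (s *\<^sub>R A)))) has_vector_derivative Re (c * \<Phi>' g)) (at 0)"
    by (intro bounded_linear.has_vector_derivative[OF bounded_linear_Re] has_vector_derivative_mult_right)
  then have "((\<lambda>s. Re (c * \<Phi> (g ** mexp (s *\<^sub>R A)))) has_field_derivative Re (c * \<Phi>' g)) (at 0)"
    by (simp add: has_real_derivative_iff_has_vector_derivative)
  then show "left_inv_field A (\<lambda>g. Re (c * \<Phi> g)) g = Re (c * \<Phi>' g)"
    unfolding left_inv_field_def by (rule DERIV_imp_deriv)
qed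

lemma dir_deriv_lincomb:
  assumes "dir_deriv A \<Phi> \<Phi>'" "dir_deriv A \<Xi> \<Xi>'"
  shows "dir_deriv A (\<lambda>g. \<Phi> g - c * \<Xi> g) (\<lambda>g. \<Phi>' g - c * \<Xi>' g)"
  using assms unfolding dir_deriv_def
  by (intro allI has_vector_derivative_diff has_vector_derivative_mult_right) auto

text \<open>
  \<open>\<Psi>\<close> is the value of \<open>X^2 + Y^2\<close> on \<open>\<Phi>\<close>. The formula is asked for on the group only, so that
  \<open>\<bar>a\<bar>^2 + \<bar>b\<bar>^2 = 1\<close> may be used to simplify it.
\<close>

definition sub_lap :: "(cmat2 \<Rightarrow> complex) \<Rightarrow> (cmat2 \<Rightarrow> complex) \<Rightarrow> bool"
  where "sub_lap \<Phi> \<Psi> \<longleftrightarrow>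
    (\<exists>\<Phi>x \<Phi>y \<Phi>xx \<Phi>yy. dir_deriv mX \<Phi> \<Phi>x \<and> dir_deriv mX \<Phi>x \<Phi>xx \<and>
       dir_deriv mY \<Phi> \<Phi>y \<and> dir_deriv mY \<Phi>y \<Phi>yy \<and> (\<forall>g\<in>SU2. \<Psi> g = \<Phi>xx g + \<Phi>yy g))"

lemma subLaplacian_Re:
  assumes "sub_lap \<Phi> \<Psi>" "g \<in> SU2"
  shows "subLaplacian (\<lambda>g. Re (c * \<Phi> g)) g = Re (c * \<Psi> g)"
proof -
  obtain \<Phi>x \<Phi>y \<Phi>xx \<Phi>yy where 1: "dir_deriv mX \<Phi> \<Phi>x" "dir_deriv mX \<Phi>x \<Phi>xx"
     "dir_deriv mY \<Phi> \<Phi>y" "dir_deriv mY \<Phi>y \<Phi>yy" "\<Psi> g = \<Phi>xx g + \<Phi>yy g"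
    using assms unfolding sub_lap_def by blast
  show ?thesis
    unfolding subLaplacian_def 1(5) 1(1-4)[THEN left_inv_field_Re] by (simp add: algebra_simps)
qed

lemma sub_lap_lincomb:
  assumes "sub_lap \<Phi> \<Psi>" "sub_lap \<Xi> \<Upsilon>"
  shows "sub_lap (\<lambda>g. \<Phi> g - c * \<Xi> g) (\<lambda>g. \<Psi> g - c * \<Upsilon> g)"
proof -
  obtain \<Phi>x \<Phi>y \<Phi>xx \<Phi>yy where 1: "dir_deriv mX \<Phi> \<Phi>x" "dir_deriv mX \<Phi>x \<Phi>xx"
     "dir_deriv mY \<Phi> \<Phi>y" "dir_deriv mY \<Phi>y \<Phi>yy" "\<And>g. g\<in>SU2 \<Longrightarrow> \<Psi> g = \<Phi>xx g + \<Phi>yy g"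
    using assms(1) unfolding sub_lap_def by blast
  obtain \<Xi>x \<Xi>y \<Xi>xx \<Xi>yy where 2: "dir_deriv mX \<Xi> \<Xi>x" "dir_deriv mX \<Xi>x \<Xi>xx"
     "dir_deriv mY \<Xi> \<Xi>y" "dir_deriv mY \<Xi>y \<Xi>yy" "\<And>g. g\<in>SU2 \<Longrightarrow> \<Upsilon> g = \<Xi>xx g + \<Xi>yy g"
    using assms(2) unfolding sub_lap_def by blast
  have "dir_deriv mX (\<lambda>g. \<Phi> g - c * \<Xi> g) (\<lambda>g. \<Phi>x g - c * \<Xi>x g)"
    "dir_deriv mX (\<lambda>g. \<Phi>x g - c * \<Xi>x g) (\<lambda>g. \<Phi>xx g - c * \<Xi>xx g)"
    "dir_deriv mY (\<lambda>g. \<Phi> g - c * \<Xi> g) (\<lambda>g. \<Phi>y g - c * \<Xi>y g)"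
    "dir_deriv mY (\<lambda>g. \<Phi>y g - c * \<Xi>y g) (\<lambda>g. \<Phi>yy g - c * \<Xi>yy g)"
    using 1 2 by (auto intro: dir_deriv_lincomb)
  moreover have "\<forall>g\<in>SU2. \<Psi> g - c * \<Upsilon> g = (\<Phi>xx g - c * \<Xi>xx g) + (\<Phi>yy g - c * \<Xi>yy g)"
    using 1(5) 2(5) by (simp add: algebra_simps)
  ultimately show ?thesis unfolding sub_lap_def by blast
qed

definition disk_monomial :: "nat \<Rightarrow> nat \<Rightarrow> cmat2 \<Rightarrow> complex"
  where "disk_monomial p q g = (g$1$1) ^ p * cnj (g$1$1) ^ q"

text \<open>
  Minus the eigenvalue of the sub-Laplacian on the eigenfunction with leading monomial \<open>a^p * cnj a^q\<close>.
\<close>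

definition eigval :: "nat \<Rightarrow> nat \<Rightarrow> nat"
  where "eigval p q = 4 * p * q + 2 * p + 2 * q"

text \<open>
  Right multiplication acts on each row separately, so the first row \<open>(a, b)\<close> moves by itself: \<open>X\<close> maps it to
  \<open>(- b, a)\<close> and \<open>Y\<close> to \<open>(\<i> b, \<i> a)\<close>. The parameter \<open>v\<close>, which is 1 for \<open>X\<close> and \<open>\<i>\<close> for
  \<open>Y\<close>, treats both fields at once.
\<close>

lemma first_row_derivs:
  fixes g :: cmat2
  assumes "A = mX \<and> v = 1 \<or> A = mY \<and> v = \<i>"
  shows "((\<lambda>s. (g ** mexp (s *\<^sub>R A))$1$1) has_vector_derivative (- (g$1$2) * cnj v)) (at 0)"
    and "((\<lambda>s. (g ** mexp (s *\<^sub>R A))$1$2) has_vector_derivative (g$1$1 * v)) (at 0)"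
    and "mexp (0 *\<^sub>R A) = mat 1"
proof -
  have ex: "mexp (s *\<^sub>R A) = su2_mat (of_real (cos s)) (v * of_real (sin s))" for s
    using assms mexp_X mexp_Y by auto
  have c: "((\<lambda>s. complex_of_real (cos s)) has_vector_derivative of_real 0) (at 0)"
    by (intro has_vector_derivative_of_real) (auto intro!: derivative_eq_intros
        simp flip: has_real_derivative_iff_has_vector_derivative)
  have s: "((\<lambda>s. complex_of_real (sin s)) has_vector_derivative of_real 1) (at 0)"
    by (intro has_vector_derivative_of_real) (auto intro!: derivative_eq_intros
        simp flip: has_real_derivative_iff_has_vector_derivative)
  have e1: "(g ** mexp (s *\<^sub>R A))$1$1 = g$1$1 * of_real (cos s) + (- (g$1$2) * cnj v) * of_real (sin s)"
    and e2: "(g ** mexp (s *\<^sub>R A))$1$2 = g$1$1 * v * of_real (sin s) + g$1$2 * of_real (cos s)" for s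
    by (simp_all add: ex mat2_mult_entry)
  have "((\<lambda>s. g$1$1 * of_real (cos s) + (- (g$1$2) * cnj v) * of_real (sin s))
      has_vector_derivative (g$1$1 * of_real 0 + (- (g$1$2) * cnj v) * of_real 1)) (at 0)"
    by (intro has_vector_derivative_add has_vector_derivative_mult_right c s)
  then show "((\<lambda>s. (g ** mexp (s *\<^sub>R A))$1$1) has_vector_derivative (- (g$1$2) * cnj v)) (at 0)"
    unfolding e1 by simp
  have "((\<lambda>s. g$1$1 * v * of_real (sin s) + g$1$2 * of_real (cos s))
      has_vector_derivative (g$1$1 * v * of_real 1 + g$1$2 * of_real 0)) (at 0)"
    by (intro has_vector_derivative_add has_vector_derivative_mult_right c s)
  then show "((\<lambda>s. (g ** mexp (s *\<^sub>R A))$1$2) has_vector_derivative (g$1$1 * v)) (at 0)"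
    unfolding e2 by simp
  show "mexp (0 *\<^sub>R A) = mat 1"
    unfolding ex by (simp add: mat2_eq_iff mat2_one)
qed

lemma disk_monomial_dir_deriv:
  assumes "A = mX \<and> v = 1 \<or> A = mY \<and> v = \<i>"
  shows "dir_deriv A (disk_monomial p q)
     (\<lambda>g. of_nat p * (g$1$1)^(p-1) * (- (g$1$2) * cnj v) * cnj (g$1$1) ^ q
        + (g$1$1)^p * (of_nat q * cnj (g$1$1)^(q-1) * (- cnj (g$1$2) * v)))" (is ?T1)
   and "dir_deriv A (\<lambda>g. of_nat p * (g$1$1)^(p-1) * (- (g$1$2) * cnj v) * cnj (g$1$1) ^ q
        + (g$1$1)^p * (of_nat q * cnj (g$1$1)^(q-1) * (- cnj (g$1$2) * v)))
     (\<lambda>g. of_nat p * of_nat (p-1) * (g$1$1)^(p-1-1) * (g$1$2 * cnj v)^2 * cnj (g$1$1) ^ q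
        - of_nat (p+q) * (v * cnj v) * (of_nat 1 * disk_monomial p q g)
        + 2 * of_nat (p * q) * (v * cnj v) * (g$1$1)^(p-1) * cnj (g$1$1) ^(q-1) * (g$1$2 * cnj (g$1$2))
        + of_nat q * of_nat (q-1) * (g$1$1)^p * cnj (g$1$1)^(q-1-1) * (cnj (g$1$2) * v)^2)" (is ?T2)
proof -
  note d = first_row_derivs[OF assms]
  have one: "g ** mexp (0 *\<^sub>R A) = g" for g :: cmat2
    unfolding d(3) by simp
  show ?T1
    unfolding dir_deriv_def disk_monomial_def
    by (intro allI has_vector_derivative_eq_rhs[OF has_vector_derivative_mult[OF
         has_vector_derivative_power[OF d(1)] has_vector_derivative_power[OF has_vector_derivative_cnj[OF d(1)]]]])
       (unfold one, simp add: algebra_simps)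
  show ?T2
    unfolding dir_deriv_def
    apply (intro allI)
    apply (rule has_vector_derivative_eq_rhs)
     apply (rule has_vector_derivative_add has_vector_derivative_mult
         has_vector_derivative_power has_vector_derivative_cnj has_vector_derivative_minus d(1) d(2) has_vector_derivative_const)+
    apply (unfold one disk_monomial_def)
    apply (cases p; cases q)
    apply (simp_all add: algebra_simps power2_eq_square)
    done
qed

section \<open>Zernike eigenfunctions\<close>

text \<open>
  The terms with \<open>b^2\<close> and \<open>(cnj b)^2\<close> carry the factors \<open>(cnj v)^2\<close> and \<open>v^2\<close>, which cancel between
  \<open>v = 1\<close> and \<open>v = \<i>\<close>. In the mixed term \<open>\<bar>b\<bar>^2 = 1 - \<bar>a\<bar>^2\<close> produces the lower monomial.
\<close>

lemma sub_lap_disk_monomial: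
  "sub_lap (disk_monomial p q)
     (\<lambda>g. of_nat (4 * p * q) * disk_monomial (p - 1) (q - 1) g - of_nat (eigval p q) * disk_monomial p q g)"
proof -
  note X = disk_monomial_dir_deriv[of mX 1 p q, OF disjI1[OF conjI[OF refl refl]]]
  note Y = disk_monomial_dir_deriv[of mY \<i> p q, OF disjI2[OF conjI[OF refl refl]]]
  have b: "g$1$2 * cnj (g$1$2) = 1 - g$1$1 * cnj (g$1$1)" if "g \<in> SU2" for g
  proof -
    from SU2_E(2)[OF that] have "complex_of_real ((cmod (g$1$1))\<^sup>2 + (cmod (g$1$2))\<^sup>2) = 1" by simp
    then show ?thesis
      unfolding of_real_add cmod_sq_complex by (simp add: algebra_simps)
  qed
  show ?thesis
    unfolding sub_lap_def
    by (rule exI conjI X(1) X(2) Y(1) Y(2))+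
       (rule ballI, simp only: b, cases p; cases q;
        simp add: disk_monomial_def eigval_def power2_eq_square algebra_simps)
qed

text \<open>
  The coefficient of the eigenfunction of index \<open>(p - s, q - s)\<close> in the monomial of index \<open>(p, q)\<close>.
\<close>

definition zernike_coeff :: "nat \<Rightarrow> nat \<Rightarrow> nat \<Rightarrow> real"
  where "zernike_coeff p q s = real (p + q + 1 - 2 * s) * fact p * fact q / (fact s * fact (p + q + 1 - s))"

lemma zernike_coeff_0: "zernike_coeff p q 0 = fact p * fact q / fact (p + q)"
  by (simp add: zernike_coeff_def del: of_nat_Suc of_nat_add)

text \<open>
  This is the relation between coefficients that makes the expansion of a monomial compatible with
  \<open>sub_lap_disk_monomial\<close>.
\<close>

lemma zernike_coeff_rec:
  assumes "1 \<le> s" "s \<le> p" "s \<le> q"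
  shows "4 * real p * real q * zernike_coeff (p - 1) (q - 1) (s - 1) =
    (real (eigval p q) - real (eigval (p - s) (q - s))) * zernike_coeff p q s"
proof -
  obtain i j s' where eq: "p = i + Suc s'" "q = j + Suc s'" "s = Suc s'"
    using assms by (metis One_nat_def Suc_le_D le_add_diff_inverse2)
  have 1: "i + Suc s' + (j + Suc s') + 1 - 2 * Suc s' = Suc (i + j)"
    "i + Suc s' + (j + Suc s') + 1 - Suc s' = Suc (i + j + Suc s')"
    "i + s' + (j + s') + 1 - 2 * s' = Suc (i + j)"
    "i + s' + (j + s') + 1 - s' = i + j + Suc s'" by simp_all
  have 2: "i + Suc s' - 1 = i + s'" "j + Suc s' - 1 = j + s'" "Suc s' - 1 = s'"
     "i + Suc s' - Suc s' = i" "j + Suc s' - Suc s' = j" by simp_all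
  have f: "fact (i + Suc s') = real (i + Suc s') * fact (i + s')"
     "fact (j + Suc s') = real (j + Suc s') * fact (j + s')"
     "fact (Suc s') = real (Suc s') * fact s'"
     "fact (Suc (i + j + Suc s')) = real (Suc (i + j + Suc s')) * fact (i + j + Suc s')"
    by (simp_all del: of_nat_Suc of_nat_add)
  have e: "real (eigval (i + Suc s') (j + Suc s')) - real (eigval i j) = 4 * real (Suc s') * real (Suc (i + j + Suc s'))"
    by (simp add: eigval_def algebra_simps)
  have k: "(4::real) * a * b * (c * d * g / (h * m)) = 4 * u * w * (c * (a * d) * (b * g) / (u * h * (w * m)))"
    if "u \<noteq> 0" "w \<noteq> 0" for a b c d g h m u w :: real
    using that by (simp add: field_simps)
  show ?thesis
    unfolding eq zernike_coeff_def unfolding 2 unfolding 1 e unfolding f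
    by (rule k) simp_all
qed

text \<open>
  With \<open>N = p + q + 1\<close> the sum telescopes, because \<open>(N - 2 s) / (s! (N - s)!)\<close> is the difference of
  \<open>1 / (s! (N - s - 1)!)\<close> and \<open>1 / ((s - 1)! (N - s)!)\<close>. It is the value at the identity of the expansion of
  a monomial into eigenfunctions.
\<close>

lemma zernike_coeff_sum: "(\<Sum>s\<le>min p q. zernike_coeff p q s) = 1"
proof -
  have part: "(\<Sum>s\<le>m. zernike_coeff p q s) = fact p * fact q / (fact m * fact (p + q - m))"
    if "2 * m \<le> p + q" for m
    using that
  proof (induction m)
    case 0
    then show ?case by (simp add: zernike_coeff_0)
  next
    case (Suc m)
    define k where "k = p + q - 2 * Suc m"
    have k: "p + q = k + 2 * Suc m" using Suc.prems k_def by simp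
    have 1: "p + q - m = k + Suc (Suc m)" "p + q - Suc m = k + Suc m"
       "p + q + 1 - 2 * Suc m = Suc k" "p + q + 1 - Suc m = k + Suc (Suc m)" using k by simp_all
    have f: "fact (k + Suc (Suc m)) = real (k + Suc (Suc m)) * fact (k + Suc m)" "fact (Suc m) = real (Suc m) * fact m"
      by simp_all
    have a: "x / (c * (w * d)) + v * x / ((u * c) * (w * d)) = x / ((u * c) * d)"
      if "u \<noteq> 0" "w \<noteq> 0" "u + v = w" for x c d u v w :: real
    proof -
      have "x / (c * (w * d)) + v * x / ((u * c) * (w * d)) = (u + v) * x / ((u * c) * (w * d))"
        using that(1,2) by (simp add: divide_simps) (simp add: algebra_simps)
      then show ?thesis using that by simp
    qed
    have "(\<Sum>s\<le>Suc m. zernike_coeff p q s) = fact p * fact q / (fact m * fact (p + q - m)) + zernike_coeff p q (Suc m)"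
      using Suc by simp
    also have "\<dots> = fact p * fact q / (fact m * (real (k + Suc (Suc m)) * fact (k + Suc m)))
        + real (Suc k) * (fact p * fact q) / (real (Suc m) * fact m * (real (k + Suc (Suc m)) * fact (k + Suc m)))"
      unfolding zernike_coeff_def 1 f by (simp add: mult_ac)
    also have "\<dots> = fact p * fact q / (real (Suc m) * fact m * fact (k + Suc m))"
      by (rule a) simp_all
    finally show ?case unfolding 1 f .
  qed
  have "fact (min p q) * fact (p + q - min p q) = (fact p * fact q :: real)"
    by (simp add: min_def mult.commute)
  then show ?thesis using part[of "min p q"] by (simp add: min_def)
qed

lemma zernike_coeff_0_nonzero: "zernike_coeff p q 0 \<noteq> 0"
  by (simp add: zernike_coeff_0)

text \<open>
  The Zernike polynomials of the unit disk, evaluated at the upper left entry and normalised to 1 at the identity.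
  They are defined by inverting the expansion of the monomials, the form in which they are used.
\<close>

function zernike :: "nat \<Rightarrow> nat \<Rightarrow> cmat2 \<Rightarrow> complex"
  where "zernike p q g = (disk_monomial p q g
    - (\<Sum>s = 1..min p q. of_real (zernike_coeff p q s) * zernike (p - s) (q - s) g))
    / of_real (zernike_coeff p q 0)"
  by auto
termination by (relation "Wellfounded.measure (\<lambda>(p, q, g). p)") auto

declare zernike.simps [simp del]

lemma sum_atMost_shift: "(\<Sum>s\<le>n. f s) = f 0 + (\<Sum>s=1..n. f s)" for f :: "nat \<Rightarrow> 'a::comm_monoid_add"
  by (metis One_nat_def atLeast0AtMost le0 sum.atLeast_Suc_atMost)

lemma disk_monomial_expansion:
  "disk_monomial p q g = (\<Sum>s\<le>min p q. of_real (zernike_coeff p q s) * zernike (p - s) (q - s) g)"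
  unfolding sum_atMost_shift using zernike_coeff_0_nonzero[of p q]
  by (simp add: zernike.simps[of p q g])

lemma zernike_one: "zernike p q (mat 1) = 1"
proof (induction p arbitrary: q rule: less_induct)
  case (less p)
  have "(\<Sum>s = 1..min p q. of_real (zernike_coeff p q s) * zernike (p - s) (q - s) (mat 1))
      = (\<Sum>s = 1..min p q. complex_of_real (zernike_coeff p q s))"
    by (intro sum.cong) (auto simp: less)
  also have "\<dots> = 1 - of_real (zernike_coeff p q 0)"
    using arg_cong[OF zernike_coeff_sum[of p q], of complex_of_real] unfolding sum_atMost_shift
    by (simp add: algebra_simps)
  finally show ?case
    using zernike_coeff_0_nonzero[of p q]
    by (simp add: zernike.simps[of p q "mat 1"] disk_monomial_def mat2_one)
qed

lemma sub_lap_0: "sub_lap (\<lambda>g. 0) (\<lambda>g. 0)"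
proof -
  have "dir_deriv A (\<lambda>g. 0) (\<lambda>g. 0)" for A by (simp add: dir_deriv_def)
  then show ?thesis unfolding sub_lap_def by (intro exI[of _ "\<lambda>g. 0"]) auto
qed

lemma sub_lap_sum:
  assumes "finite S" "\<And>s. s \<in> S \<Longrightarrow> sub_lap (\<Phi> s) (\<Psi> s)"
  shows "sub_lap (\<lambda>g. \<Sum>s\<in>S. c s * \<Phi> s g) (\<lambda>g. \<Sum>s\<in>S. c s * \<Psi> s g)"
  using assms
proof (induction S)
  case empty
  then show ?case by (simp add: sub_lap_0)
next
  case (insert s S)
  have "sub_lap (\<lambda>g. (\<Sum>s\<in>S. c s * \<Phi> s g) - (- c s) * \<Phi> s g) (\<lambda>g. (\<Sum>s\<in>S. c s * \<Psi> s g) - (- c s) * \<Psi> s g)"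
    using insert by (intro sub_lap_lincomb) auto
  then show ?case using insert by (simp add: add.commute)
qed

lemma sub_lap_cong:
  assumes "sub_lap \<Phi> \<Psi>" "\<And>g. \<Phi> g = \<Phi>' g" "\<And>g. g \<in> SU2 \<Longrightarrow> \<Psi> g = \<Psi>' g"
  shows "sub_lap \<Phi>' \<Psi>'"
proof -
  have "\<Phi> = \<Phi>'" using assms(2) by auto
  with assms(1,3) show ?thesis unfolding sub_lap_def by auto
qed

text \<open>
  By \<open>sub_lap_disk_monomial\<close> the monomial fails to be an eigenfunction by a multiple of a lower monomial.
  Expanding that one into eigenfunctions, \<open>zernike_coeff_rec\<close> shows that the correction subtracted in the definition
  of \<open>zernike\<close> compensates the failure exactly.
\<close>

lemma sub_lap_zernike: "sub_lap (zernike p q) (\<lambda>g. - of_nat (eigval p q) * zernike p q g)"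
proof (induction p arbitrary: q rule: less_induct)
  case (less p)
  let ?d = "zernike_coeff p q" and ?S = "{1..min p q}"
  let ?Z = "\<lambda>s. zernike (p - s) (q - s)" and ?l = "\<lambda>s. complex_of_real (real (eigval (p - s) (q - s)))"
  have 1: "sub_lap (\<lambda>g. \<Sum>s\<in>?S. of_real (?d s) * ?Z s g)
      (\<lambda>g. \<Sum>s\<in>?S. of_real (?d s) * (- of_nat (eigval (p - s) (q - s)) * ?Z s g))"
    by (intro sub_lap_sum less) auto
  have "sub_lap (\<lambda>g. 0 - (- 1 / of_real (?d 0)) * (disk_monomial p q g - 1 * (\<Sum>s\<in>?S. of_real (?d s) * ?Z s g)))
    (\<lambda>g. 0 - (- 1 / of_real (?d 0)) * ((of_nat (4 * p * q) * disk_monomial (p - 1) (q - 1) g - of_nat (eigval p q) * disk_monomial p q g)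
      - 1 * (\<Sum>s\<in>?S. of_real (?d s) * (- of_nat (eigval (p - s) (q - s)) * ?Z s g))))"
    by (intro sub_lap_lincomb sub_lap_0 sub_lap_disk_monomial 1)
  then show ?case
  proof (rule sub_lap_cong)
    fix g
    show "0 - (- 1 / of_real (?d 0)) * (disk_monomial p q g - 1 * (\<Sum>s\<in>?S. of_real (?d s) * ?Z s g)) = zernike p q g"
      by (simp add: zernike.simps[of p q g])
    have "of_nat (4 * p * q) * disk_monomial (p - 1) (q - 1) g
        = (\<Sum>s\<in>?S. (of_nat (eigval p q) - ?l s) * of_real (?d s) * ?Z s g)"
    proof (cases "p = 0 \<or> q = 0")
      case True
      then show ?thesis by auto
    next
      case False
      have "(\<Sum>s\<le>min (p - 1) (q - 1). h (Suc s)) = (\<Sum>s\<in>?S. h s)" for h :: "nat \<Rightarrow> complex"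
        using False by (intro sum.reindex_bij_witness[of _ "\<lambda>s. s - 1" Suc]) auto
      from this[of "\<lambda>s. of_real (zernike_coeff (p - 1) (q - 1) (s - 1)) * ?Z s g"]
      have "disk_monomial (p - 1) (q - 1) g
        = (\<Sum>s\<in>?S. of_real (zernike_coeff (p - 1) (q - 1) (s - 1)) * ?Z s g)"
        unfolding disk_monomial_expansion[of "p - 1"] by simp
      then have "of_nat (4 * p * q) * disk_monomial (p - 1) (q - 1) g
        = (\<Sum>s\<in>?S. of_real (4 * real p * real q * zernike_coeff (p - 1) (q - 1) (s - 1)) * ?Z s g)"
        by (simp add: sum_distrib_left mult_ac)
      also have "\<dots> = (\<Sum>s\<in>?S. (of_nat (eigval p q) - ?l s) * of_real (?d s) * ?Z s g)"
      proof (rule sum.cong)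
        fix s assume "s \<in> ?S"
        then have "4 * real p * real q * zernike_coeff (p - 1) (q - 1) (s - 1) = (real (eigval p q) - real (eigval (p - s) (q - s))) * ?d s"
          by (intro zernike_coeff_rec) auto
        then show "of_real (4 * real p * real q * zernike_coeff (p - 1) (q - 1) (s - 1)) * ?Z s g
             = (of_nat (eigval p q) - ?l s) * of_real (?d s) * ?Z s g" by (simp only: of_real_mult of_real_diff of_real_of_nat_eq)
      qed simp
      finally show ?thesis .
    qed
    then have "(of_nat (4 * p * q) * disk_monomial (p - 1) (q - 1) g - of_nat (eigval p q) * disk_monomial p q g)
      - 1 * (\<Sum>s\<in>?S. of_real (?d s) * (- of_nat (eigval (p - s) (q - s)) * ?Z s g))
      = - of_nat (eigval p q) * (disk_monomial p q g - (\<Sum>s\<in>?S. of_real (?d s) * ?Z s g))"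
      by (simp add: algebra_simps sum_distrib_left sum_negf flip: sum.distrib sum_subtractf)
    then show "0 - (- 1 / of_real (?d 0)) * ((of_nat (4 * p * q) * disk_monomial (p - 1) (q - 1) g - of_nat (eigval p q) * disk_monomial p q g)
      - 1 * (\<Sum>s\<in>?S. of_real (?d s) * (- of_nat (eigval (p - s) (q - s)) * ?Z s g)))
      = - of_nat (eigval p q) * zernike p q g"
      by (simp add: zernike.simps[of p q g])
  qed
qed

text \<open>
  The derivative of a polynomial in a fixed direction is a polynomial again, so smoothness follows by induction on
  the order.
\<close>

lemma real_polynomial_has_derivative:
  assumes "real_polynomial_function f"
  shows "\<exists>f'. (\<forall>x. (f has_derivative f' x) (at x)) \<and> (\<forall>v. real_polynomial_function (\<lambda>x. f' x v))"
  using assms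
proof induction
  case (linear f)
  then show ?case
    by (intro exI[of _ "\<lambda>x. f"]) (auto intro: bounded_linear_imp_has_derivative)
next
  case (const c)
  show ?case by (intro exI[of _ "\<lambda>x v. 0"]) auto
next
  case (add f g)
  then obtain f' g' where "\<forall>x. (f has_derivative f' x) (at x)" "\<forall>v. real_polynomial_function (\<lambda>x. f' x v)"
    "\<forall>x. (g has_derivative g' x) (at x)" "\<forall>v. real_polynomial_function (\<lambda>x. g' x v)" by blast
  then show ?case
    by (intro exI[of _ "\<lambda>x v. f' x v + g' x v"]) (auto intro!: has_derivative_add)
next
  case (mult f g)
  then obtain f' g' where "\<forall>x. (f has_derivative f' x) (at x)" "\<forall>v. real_polynomial_function (\<lambda>x. f' x v)"
    "\<forall>x. (g has_derivative g' x) (at x)" "\<forall>v. real_polynomial_function (\<lambda>x. g' x v)" by blast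
  with mult.hyps show ?case
    by (intro exI[of _ "\<lambda>x v. f x * g' x v + f' x v * g x"]) (auto intro!: has_derivative_mult real_polynomial_function.intros(3,4))
qed

lemma Ck_on_polynomial:
  fixes f :: "'a::euclidean_space \<Rightarrow> real"
  assumes "real_polynomial_function f"
  shows "Ck_on n f U"
  using assms
proof (induction n arbitrary: f)
  case 0
  then show ?case
    by (simp add: continuous_on_polymonial_function real_polynomial_function_eq)
next
  case (Suc n)
  from real_polynomial_has_derivative[OF Suc.prems] obtain f' where
    f': "\<And>x. (f has_derivative f' x) (at x)" "\<And>v. real_polynomial_function (\<lambda>x. f' x v)" by blast
  then have "frechet_derivative f (at x) = f' x" for x
    by (metis frechet_derivative_at)
  with f' Suc.IH show ?case by (auto simp: differentiable_def)
qed

lemma smooth_on_polynomial: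
  assumes "real_polynomial_function f"
  shows "smooth_on S f"
  unfolding smooth_on_def using Ck_on_polynomial[OF assms] by (intro exI[of _ UNIV] exI[of _ f]) auto

definition complex_polynomial :: "(cmat2 \<Rightarrow> complex) \<Rightarrow> bool"
  where "complex_polynomial \<Phi> \<longleftrightarrow>
    real_polynomial_function (\<lambda>g. Re (\<Phi> g)) \<and> real_polynomial_function (\<lambda>g. Im (\<Phi> g))"

lemma complex_polynomial_const: "complex_polynomial (\<lambda>g. c)"
  by (auto simp: complex_polynomial_def)

lemma complex_polynomial_diff:
  "complex_polynomial \<Phi> \<Longrightarrow> complex_polynomial \<Psi> \<Longrightarrow> complex_polynomial (\<lambda>g. \<Phi> g - \<Psi> g)"
  by (auto simp: complex_polynomial_def)

lemma complex_polynomial_add: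
  "complex_polynomial \<Phi> \<Longrightarrow> complex_polynomial \<Psi> \<Longrightarrow> complex_polynomial (\<lambda>g. \<Phi> g + \<Psi> g)"
  by (auto simp: complex_polynomial_def)

lemma complex_polynomial_mult:
  "complex_polynomial \<Phi> \<Longrightarrow> complex_polynomial \<Psi> \<Longrightarrow> complex_polynomial (\<lambda>g. \<Phi> g * \<Psi> g)"
  by (auto simp: complex_polynomial_def)

lemma complex_polynomial_power:
  "complex_polynomial \<Phi> \<Longrightarrow> complex_polynomial (\<lambda>g. \<Phi> g ^ n)"
  by (induction n) (auto intro: complex_polynomial_mult complex_polynomial_const)

lemma complex_polynomial_sum:
  "(\<And>s. s \<in> S \<Longrightarrow> complex_polynomial (\<Phi> s)) \<Longrightarrow> complex_polynomial (\<lambda>g. \<Sum>s\<in>S. \<Phi> s g)"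
  by (induction S rule: infinite_finite_induct)
     (auto intro: complex_polynomial_add complex_polynomial_const)

lemma complex_polynomial_disk_monomial: "complex_polynomial (disk_monomial p q)"
proof -
  have lin: "bounded_linear (\<lambda>g::cmat2. Re (g$1$1))" "bounded_linear (\<lambda>g::cmat2. Im (g$1$1))"
    by (intro bounded_linear_compose[OF bounded_linear_Re] bounded_linear_compose[OF bounded_linear_Im]
        bounded_linear_compose[OF bounded_linear_vec_nth] bounded_linear_vec_nth)+
  have "complex_polynomial (\<lambda>g. g$1$1)" "complex_polynomial (\<lambda>g. cnj (g$1$1))"
    unfolding complex_polynomial_def using lin
    by auto
  then show ?thesis
    unfolding disk_monomial_def[abs_def] by (intro complex_polynomial_mult complex_polynomial_power)
qed

lemma complex_polynomial_zernike: "complex_polynomial (zernike p q)"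
proof (induction p arbitrary: q rule: less_induct)
  case (less p)
  have "complex_polynomial (\<lambda>g. (disk_monomial p q g
    - (\<Sum>s = 1..min p q. of_real (zernike_coeff p q s) * zernike (p - s) (q - s) g))
    * (1 / of_real (zernike_coeff p q 0)))"
    by (intro complex_polynomial_mult complex_polynomial_diff complex_polynomial_sum
        complex_polynomial_const complex_polynomial_disk_monomial less) auto
  moreover have "zernike p q = (\<lambda>g. (disk_monomial p q g
    - (\<Sum>s = 1..min p q. of_real (zernike_coeff p q s) * zernike (p - s) (q - s) g))
    * (1 / of_real (zernike_coeff p q 0)))"
    by (rule ext) (simp add: zernike.simps[of p q])
  ultimately show ?case by simp
qed

section \<open>Haar measure in cylindric coordinates\<close>

lemma su2_mat_lincomb: "su2_mat a b = Re a *\<^sub>R mat 1 + Im a *\<^sub>R mZ + Re b *\<^sub>R mX + Im b *\<^sub>R mY"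
  by (simp add: mat2_eq_iff mat2_one mX_def mY_def mZ_def complex_eq_iff)

lemma continuous_on_su2_mat [continuous_intros]:
  assumes "continuous_on S f" "continuous_on S g"
  shows "continuous_on S (\<lambda>x. su2_mat (f x) (g x))"
  unfolding su2_mat_lincomb by (intro continuous_intros assms)

lemma compact_SU2: "compact SU2"
proof -
  have "SU2 = (\<lambda>x. su2_mat (fst x) (snd x)) ` sphere 0 1"
  proof (intro equalityI subsetI)
    fix g assume "g \<in> SU2"
    from SU2_E[OF this] show "g \<in> (\<lambda>x. su2_mat (fst x) (snd x)) ` sphere 0 1"
      by (intro image_eqI[of _ _ "(g$1$1, g$1$2)"]) (auto simp: norm_prod_def)
  next
    fix g assume "g \<in> (\<lambda>x. su2_mat (fst x) (snd x)) ` sphere 0 1"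
    then show "g \<in> SU2"
      by (auto intro!: su2_mat_in_SU2 simp: norm_prod_def)
  qed
  moreover have "continuous_on (sphere 0 1) (\<lambda>x. su2_mat (fst x) (snd x))"
    by (intro continuous_intros)
  ultimately show ?thesis
    by (metis compact_continuous_image compact_sphere)
qed

lemma continuous_on_cyl: "continuous_on UNIV cyl"
proof -
  have eq: "cyl = (\<lambda>x. su2_mat (of_real (cos (fst x)) * cis (snd (snd x)))
      (of_real (sin (fst x)) * cis (fst (snd x) - snd (snd x))))"
    by (auto simp: cyl_eq)
  show ?thesis
    unfolding eq cis_conv_exp by (intro continuous_intros)
qed

lemma space_haar: "space haar = SU2"
  by (simp add: haar_def space_restrict_space)

lemma sets_haar: "sets haar = sets (restrict_space borel SU2)"
  by (simp add: haar_def)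

lemma borel_measurable_haar_continuous:
  fixes f :: "cmat2 \<Rightarrow> 'b::topological_space"
  assumes "continuous_on SU2 f"
  shows "f \<in> borel_measurable haar"
  using borel_measurable_continuous_on_restrict[OF assms] measurable_cong_sets[OF sets_haar refl] by blast

text \<open>
  At the endpoint \<open>r = pi / 2\<close>, included here so that the intervals are compact, \<open>sin (2 * r)\<close> vanishes.
\<close>

definition haar_weight :: "real \<times> real \<times> real \<Rightarrow> real"
  where "haar_weight = (\<lambda>(r, \<theta>, z). (sin (2 * r) * indicator {0..pi/2} r) *
    (indicator {0..2*pi} \<theta> * (indicator {-pi..pi} z / (4 * pi^2))))"

lemma haar_weight_nonneg: "haar_weight x \<ge> 0"
  by (auto simp: haar_weight_def indicator_def split: prod.splits intro!: divide_nonneg_nonneg mult_nonneg_nonneg sin_ge_zero)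

lemma haar_weight_measurable [measurable]: "haar_weight \<in> borel_measurable borel"
  unfolding haar_weight_def by (simp add: borel_prod[symmetric])

lemma haar_eq: "haar = distr (density lborel (\<lambda>x. ennreal (haar_weight x))) (restrict_space borel SU2) cyl"
proof -
  have "(\<lambda>(r, \<theta>, z). ennreal (
         indicator ({0..<pi/2} \<times> {0..2*pi} \<times> {-pi..pi}) (r, \<theta>, z) * (sin (2*r) / (4 * pi^2))))
      = (\<lambda>x. ennreal (haar_weight x))"
    by (auto simp: haar_weight_def indicator_def fun_eq_iff) (simp add: mult.commute)
  then show ?thesis unfolding haar_def by simp
qed

lemma measurable_cyl [measurable]: "cyl \<in> measurable borel (restrict_space borel SU2)"
  by (intro measurable_restrict_space2 borel_measurable_continuous_onI continuous_on_cyl)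
     (auto simp: cyl_in_SU2)

lemma haar_integral:
  fixes f :: "cmat2 \<Rightarrow> real"
  assumes [measurable]: "f \<in> borel_measurable (restrict_space borel SU2)"
  shows "integrable haar f \<longleftrightarrow> integrable lborel (\<lambda>x. haar_weight x * f (cyl x))"
    and "(\<integral>g. f g \<partial>haar) = (\<integral>x. haar_weight x * f (cyl x) \<partial>lborel)"
proof -
  have [measurable]: "(\<lambda>x. f (cyl x)) \<in> borel_measurable borel"
    by measurable
  show "integrable haar f \<longleftrightarrow> integrable lborel (\<lambda>x. haar_weight x * f (cyl x))"
    unfolding haar_eq by (subst integrable_distr_eq) (auto simp: integrable_density haar_weight_nonneg)
  show "(\<integral>g. f g \<partial>haar) = (\<integral>x. haar_weight x * f (cyl x) \<partial>lborel)"
    unfolding haar_eq by (subst integral_distr) (auto simp: integral_density haar_weight_nonneg)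
qed

text \<open>
  Fubini for a product of functions of separate variables; applied twice, it separates the three coordinates.
\<close>

lemma lborel_product:
  fixes f :: "'a::euclidean_space \<Rightarrow> real" and g :: "'b::euclidean_space \<Rightarrow> real"
  assumes f: "integrable lborel f" and g: "integrable lborel g"
  shows "integrable lborel (\<lambda>x. f (fst x) * g (snd x))"
    and "(\<integral>x. f (fst x) * g (snd x) \<partial>lborel) = (\<integral>x. f x \<partial>lborel) * (\<integral>y. g y \<partial>lborel)"
proof -
  have [measurable]: "f \<in> borel_measurable lborel" "g \<in> borel_measurable lborel"
    using f g by auto
  have "integrable (lborel \<Otimes>\<^sub>M lborel) (\<lambda>x. f (fst x) * g (snd x))"
    by (rule lborel_pair.Fubini_integrable) (auto simp: abs_mult f g)
  then show "integrable lborel (\<lambda>x. f (fst x) * g (snd x))"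
    "(\<integral>x. f (fst x) * g (snd x) \<partial>lborel) = (\<integral>x. f x \<partial>lborel) * (\<integral>y. g y \<partial>lborel)"
    using lborel_pair.integral_fst'[of "\<lambda>x. f (fst x) * g (snd x)"] by (simp_all add: lborel_prod)
qed

lemma integral_indicator_FTC:
  fixes F f :: "real \<Rightarrow> real"
  assumes "a \<le> b" "\<And>x. (F has_real_derivative f x) (at x)" "continuous_on {a..b} f"
  shows "integrable lborel (\<lambda>x. f x * indicator {a..b} x)"
    and "(\<integral>x. f x * indicator {a..b} x \<partial>lborel) = F b - F a"
proof -
  have "set_integrable lborel {a..b} f" by (rule borel_integrable_atLeastAtMost') fact
  then show "integrable lborel (\<lambda>x. f x * indicator {a..b} x)"
    by (simp add: set_integrable_def mult.commute)
  show "(\<integral>x. f x * indicator {a..b} x \<partial>lborel) = F b - F a"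
    using integral_FTC_atLeastAtMost[of a b F f] assms
    by (simp add: mult.commute has_real_derivative_iff_has_vector_derivative has_vector_derivative_at_within)
qed

text \<open>
  The variable \<open>\<theta>\<close> contributes the factor \<open>2 * pi\<close>, which leaves \<open>1 / (2 * pi)\<close> of the constant
  \<open>1 / (4 * pi^2)\<close>.
\<close>

lemma haar_integral_separated:
  fixes u v :: "real \<Rightarrow> real"
  assumes f[measurable]: "f \<in> borel_measurable (restrict_space borel SU2)"
    and fcyl: "\<And>r \<theta> z. f (cyl (r, \<theta>, z)) = u r * v z"
    and u: "integrable lborel (\<lambda>r. (sin (2 * r) * u r) * indicator {0..pi/2} r)"
    and v: "integrable lborel (\<lambda>z. v z * indicator {-pi..pi} z)"
  shows "integrable haar f"
    and "(\<integral>g. f g \<partial>haar) = (\<integral>r. (sin (2 * r) * u r) * indicator {0..pi/2} r \<partial>lborel) *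
       (\<integral>z. v z * indicator {-pi..pi} z \<partial>lborel) / (2 * pi)"
proof -
  let ?U = "\<lambda>r. (sin (2 * r) * u r) * indicator {0..pi/2} r"
  let ?V = "\<lambda>z. (v z * indicator {-pi..pi} z) / (4 * pi^2)"
  let ?T = "\<lambda>\<theta>::real. 1 * indicator {0..2*pi} \<theta> :: real"
  have eq: "(\<lambda>x. haar_weight x * f (cyl x)) = (\<lambda>x. ?U (fst x) * (\<lambda>y. ?T (fst y) * ?V (snd y)) (snd x))"
    by (auto simp: fun_eq_iff haar_weight_def fcyl)
  have V: "integrable lborel ?V" using v by simp
  have T: "integrable lborel ?T" "(\<integral>x. ?T x \<partial>lborel) = 2 * pi - 0"
    by (intro integral_indicator_FTC[where F = "\<lambda>x. x"]; auto intro!: derivative_eq_intros)+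
  note 1 = lborel_product[OF T(1) V]
  note 2 = lborel_product[OF u 1(1)]
  show "integrable haar f"
    using 2(1) unfolding haar_integral[OF f] eq .
  have "(\<integral>g. f g \<partial>haar) = (\<integral>r. ?U r \<partial>lborel) * ((2 * pi - 0) * ((\<integral>z. v z * indicator {-pi..pi} z \<partial>lborel) / (4 * pi^2)))"
    unfolding haar_integral[OF f] eq 2(2) 1(2) T(2) by simp
  then show "(\<integral>g. f g \<partial>haar) = (\<integral>r. (sin (2 * r) * u r) * indicator {0..pi/2} r \<partial>lborel) *
       (\<integral>z. v z * indicator {-pi..pi} z \<partial>lborel) / (2 * pi)"
    by (simp add: power2_eq_square)
qed

lemma radial_integral:
  "integrable lborel (\<lambda>r. (sin (2 * r) * cos r ^ n) * indicator {0..pi/2} r)"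
  "(\<integral>r. (sin (2 * r) * cos r ^ n) * indicator {0..pi/2} r \<partial>lborel) = 2 / (n + 2)"
proof -
  have *: "((\<lambda>r. - 2 / (n + 2) * cos r ^ (n + 2)) has_real_derivative sin (2 * r) * cos r ^ n) (at r)" for r
  proof -
    have "((\<lambda>r. cos r ^ Suc (Suc n)) has_real_derivative real (Suc (Suc n)) * (- sin r * cos r ^ Suc n)) (at r)"
      using DERIV_power[OF DERIV_cos, of "Suc (Suc n)" r] by (simp only: diff_Suc_Suc diff_zero)
    from DERIV_cmult[OF this, of "- 2 / real (Suc (Suc n))"]
    have "((\<lambda>r. - 2 / real (Suc (Suc n)) * cos r ^ Suc (Suc n)) has_real_derivative
       - 2 / real (Suc (Suc n)) * (real (Suc (Suc n)) * (- sin r * cos r ^ Suc n))) (at r)" .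
    moreover have "- 2 / real (Suc (Suc n)) * (real (Suc (Suc n)) * (- sin r * cos r ^ Suc n)) = sin (2 * r) * cos r ^ n"
      unfolding sin_double by (simp del: of_nat_Suc)
    ultimately show ?thesis by (simp only: add_2_eq_Suc')
  qed
  show "integrable lborel (\<lambda>r. (sin (2 * r) * cos r ^ n) * indicator {0..pi/2} r)"
    by (rule integral_indicator_FTC(1)[OF _ *]) (auto intro!: continuous_intros)
  have "(\<integral>r. (sin (2 * r) * cos r ^ n) * indicator {0..pi/2} r \<partial>lborel)
     = - 2 / (n + 2) * cos (pi/2) ^ (n + 2) - - 2 / (n + 2) * cos 0 ^ (n + 2)"
    by (rule integral_indicator_FTC(2)[OF _ *]) (auto intro!: continuous_intros)
  then show "(\<integral>r. (sin (2 * r) * cos r ^ n) * indicator {0..pi/2} r \<partial>lborel) = 2 / (n + 2)"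
    by simp
qed

lemma angular_integral:
  "integrable lborel (\<lambda>z. Re (c * cis (of_int m * z)) * indicator {-pi..pi} z)"
  "(\<integral>z. Re (c * cis (of_int m * z)) * indicator {-pi..pi} z \<partial>lborel) = (if m = 0 then 2 * pi * Re c else 0)"
proof -
  show "integrable lborel (\<lambda>z. Re (c * cis (of_int m * z)) * indicator {-pi..pi} z)"
  proof -
    have "continuous_on {-pi..pi} (\<lambda>z. Re (c * cis (of_int m * z)))"
      unfolding cis_conv_exp by (intro continuous_intros)
    from borel_integrable_atLeastAtMost'[OF this] show ?thesis
      by (simp add: set_integrable_def mult.commute)
  qed
  show "(\<integral>z. Re (c * cis (of_int m * z)) * indicator {-pi..pi} z \<partial>lborel) = (if m = 0 then 2 * pi * Re c else 0)"
  proof (cases "m = 0")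
    case True
    have "(\<integral>z. Re c * indicator {-pi..pi} z \<partial>lborel) = Re c * pi - Re c * (-pi)"
      by (rule integral_indicator_FTC(2)) (auto intro!: derivative_eq_intros)
    with True show ?thesis by simp
  next
    case False
    have *: "((\<lambda>z. (Re c * sin (of_int m * z) + Im c * cos (of_int m * z)) / of_int m) has_real_derivative
        Re (c * cis (of_int m * z))) (at z)" for z
      using False by (auto intro!: derivative_eq_intros simp: field_simps)
    have "(\<integral>z. Re (c * cis (of_int m * z)) * indicator {-pi..pi} z \<partial>lborel)
      = (Re c * sin (of_int m * pi) + Im c * cos (of_int m * pi)) / of_int m
       - (Re c * sin (of_int m * (-pi)) + Im c * cos (of_int m * (-pi))) / of_int m"
      by (rule integral_indicator_FTC(2)[OF _ *]) (auto intro!: continuous_intros)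
    then show ?thesis using False by (simp add: sin_integer_2pi mult.commute[of _ pi] sin_int_times_real)
  qed
qed

lemma finite_measure_haar: "finite_measure haar"
proof -
  have "integrable haar (\<lambda>g. 1 :: real)"
    using radial_integral(1)[of 0] angular_integral(1)[of 1 0]
    by (intro haar_integral_separated(1)[where u = "\<lambda>_. 1" and v = "\<lambda>_. 1"]) auto
  then have "emeasure haar (space haar) < \<infinity>"
    by (simp add: integrable_iff_bounded)
  then show ?thesis by (intro finite_measureI) auto
qed

lemma haar_integrable_continuous:
  fixes f :: "cmat2 \<Rightarrow> real"
  assumes "continuous_on SU2 f"
  shows "integrable haar f"
proof -
  interpret finite_measure haar by (rule finite_measure_haar)
  have "bounded (f ` SU2)"
    by (intro compact_imp_bounded compact_continuous_image assms compact_SU2)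
  then obtain B where "\<And>g. g \<in> SU2 \<Longrightarrow> norm (f g) \<le> B"
    by (auto simp: bounded_iff)
  then show ?thesis
    by (intro integrable_const_bound[of _ B] borel_measurable_haar_continuous assms AE_I2)
       (simp add: space_haar)
qed

text \<open>
  In the variable \<open>a\<close>, Haar measure is the normalised area of the unit disk, for which distinct powers are
  orthogonal.
\<close>

lemma haar_integral_monomial:
  "(\<integral>g. Re (c * (g$1$1 ^ p * cnj (g$1$1) ^ q)) \<partial>haar) = (if p = q then Re c / (real p + 1) else 0)"
proof -
  have Re_mult_of_real: "Re (of_real x * w) = x * Re w" for x w by simp
  have cont: "continuous_on SU2 (\<lambda>g::cmat2. Re (c * (g$1$1 ^ p * cnj (g$1$1) ^ q)))"
    by (intro continuous_intros)
  have "cis z ^ p * cnj (cis z) ^ q = cis (of_int (int p - int q) * z)" for z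
  proof -
    have "cis z ^ p * cnj (cis z) ^ q = cis (real p * z + real q * (- z))"
      by (simp only: cis_cnj Complex.DeMoivre cis_mult)
    then show ?thesis by (simp add: algebra_simps)
  qed
  moreover have "c * ((of_real (cos r) * cis z) ^ p * cnj (of_real (cos r) * cis z) ^ q)
      = of_real (cos r ^ (p + q)) * (c * (cis z ^ p * cnj (cis z) ^ q))" for r z
    by (simp add: power_mult_distrib power_add mult_ac)
  ultimately have cyl: "Re (c * (cyl (r, \<theta>, z)$1$1 ^ p * cnj (cyl (r, \<theta>, z)$1$1) ^ q))
      = cos r ^ (p + q) * Re (c * cis (of_int (int p - int q) * z))" for r \<theta> z
    unfolding cyl_eq su2_mat_entry by (simp only: Re_mult_of_real)
  have "(\<integral>g. Re (c * (g$1$1 ^ p * cnj (g$1$1) ^ q)) \<partial>haar) =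
     (\<integral>r. (sin (2 * r) * cos r ^ (p + q)) * indicator {0..pi/2} r \<partial>lborel) *
     (\<integral>z. Re (c * cis (of_int (int p - int q) * z)) * indicator {-pi..pi} z \<partial>lborel) / (2 * pi)"
    by (rule haar_integral_separated(2)[OF _ cyl radial_integral(1) angular_integral(1)])
       (rule borel_measurable_continuous_on_restrict[OF cont])
  also have "\<dots> = (if p = q then Re c / (real p + 1) else 0)"
  proof -
    have "2 + 2 * real q \<noteq> 0" "real q + 1 \<noteq> 0" by linarith+
    then have "2 * Re c / (2 + 2 * real q) = Re c / (real q + 1)"
      by (simp add: frac_eq_eq algebra_simps)
    then show ?thesis unfolding radial_integral(2) angular_integral(2) by auto
  qed
  finally show ?thesis .
qed

section \<open>Fejer kernels\<close>

text \<open>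
  The Fejer kernel in the powers of \<open>a\<close>, rotated so that it peaks at the boundary point \<open>a = cis z\<close> of the
  disk, over which there is only one group element.
\<close>

definition fejer :: "nat \<Rightarrow> real \<Rightarrow> cmat2 \<Rightarrow> real"
  where "fejer M z g = (cmod (\<Sum>p<M. (g$1$1 * cis (- z)) ^ p))\<^sup>2"

lemma fejer_nonneg: "fejer M z g \<ge> 0"
  by (simp add: fejer_def)

lemma fejer_expansion:
  "fejer M z g = (\<Sum>p<M. \<Sum>q<M. Re (cis (of_int (int q - int p) * z) * (g$1$1 ^ p * cnj (g$1$1) ^ q)))"
proof -
  have *: "cis (- z) ^ p * cnj (cis (- z)) ^ q = cis (of_int (int q - int p) * z)" for p q
  proof -
    have "cis (- z) ^ p * cnj (cis (- z)) ^ q = cis (real p * (- z) + real q * (- (- z)))"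
      by (simp only: cis_cnj Complex.DeMoivre cis_mult)
    then show ?thesis by (simp add: algebra_simps)
  qed
  have "fejer M z g = Re (of_real ((cmod (\<Sum>p<M. (g$1$1 * cis (- z)) ^ p))\<^sup>2))"
    by (simp add: fejer_def)
  also have "\<dots> = Re ((\<Sum>p<M. (g$1$1 * cis (- z)) ^ p) * (\<Sum>q<M. cnj (g$1$1 * cis (- z)) ^ q))"
    unfolding cmod_sq_complex by simp
  also have "\<dots> = (\<Sum>p<M. \<Sum>q<M. Re ((cis (- z) ^ p * cnj (cis (- z)) ^ q) * (g$1$1 ^ p * cnj (g$1$1) ^ q)))"
    unfolding sum_product Re_sum
    by (intro sum.cong refl) (simp only: power_mult_distrib complex_cnj_mult mult_ac)
  finally show ?thesis unfolding * .
qed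

lemma continuous_on_fejer: "continuous_on S (fejer M z)"
  unfolding fejer_def[abs_def] by (intro continuous_intros)

text \<open>
  Only the diagonal terms of the double sum survive the integration. That the result diverges is what makes the
  normalised kernels concentrate.
\<close>

lemma fejer_integral: "(\<integral>g. fejer M z g \<partial>haar) = harm M"
proof -
  have int: "integrable haar (\<lambda>g. Re (c * (g$1$1 ^ p * cnj (g$1$1) ^ q)))" for c p q
    by (intro haar_integrable_continuous continuous_intros)
  have "(\<integral>g. fejer M z g \<partial>haar) = (\<Sum>p<M. \<Sum>q<M. if p = q then Re (cis (of_int (int q - int p) * z)) / (real p + 1) else 0)"
    unfolding fejer_expansion haar_integral_monomial[symmetric]
    by (subst Bochner_Integration.integral_sum, intro Bochner_Integration.integrable_sum int, intro sum.cong refl Bochner_Integration.integral_sum int)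
  also have "\<dots> = (\<Sum>p<M. 1 / (real p + 1))"
    by (simp add: sum.delta)
  also have "\<dots> = harm M"
    unfolding harm_altdef by (intro sum.cong) (auto simp: field_simps)
  finally show ?thesis .
qed

lemma SU2_entry_le_1: "g \<in> SU2 \<Longrightarrow> cmod (g$1$1) \<le> 1"
  using SU2_E(2)[of g] by (metis abs_norm_cancel abs_square_le_1 le_add_same_cancel1 zero_le_power2)

lemma fejer_bound:
  assumes "g \<in> SU2" "0 < \<delta>" "\<delta> \<le> cmod (1 - g$1$1 * cis (- z))"
  shows "fejer M z g \<le> 4 / \<delta>\<^sup>2"
proof -
  define w where "w = g$1$1 * cis (- z)"
  have w: "cmod w \<le> 1" "\<delta> \<le> cmod (1 - w)" "w \<noteq> 1"
    using SU2_entry_le_1[OF assms(1)] assms(2,3) by (auto simp: w_def norm_mult)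
  have "cmod (\<Sum>p<M. w ^ p) = cmod (1 - w ^ M) / cmod (1 - w)"
    using w(3) by (simp add: sum_gp_strict norm_divide norm_minus_commute)
  also have "\<dots> \<le> 2 / \<delta>"
  proof (intro frac_le)
    have "cmod (1 - w ^ M) \<le> 1 + cmod w ^ M"
      using norm_triangle_ineq4[of 1 "w ^ M"] by (simp add: norm_power)
    also have "\<dots> \<le> 2" using w(1) by (simp add: power_le_one)
    finally show "cmod (1 - w ^ M) \<le> 2" .
  qed (use w assms(2) in auto)
  finally have "(cmod (\<Sum>p<M. w ^ p))\<^sup>2 \<le> (2 / \<delta>)\<^sup>2"
    by (intro power_mono) auto
  then show ?thesis by (simp add: fejer_def w_def power_divide)
qed

text \<open>
  The mass \<open>harm M\<close> tends to infinity while the kernel stays bounded outside any neighbourhood of the peak.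
  By compactness, a region where \<open>\<phi>\<close> differs much from its value at the peak has \<open>a\<close> bounded away from
  \<open>cis z\<close>.
\<close>

lemma fejer_concentration:
  assumes \<phi>: "continuous_on SU2 \<phi>"
  shows "(\<lambda>M. (\<integral>g. \<phi> g * fejer M z g \<partial>haar) / harm M) \<longlonglongrightarrow> \<phi> (su2_mat (cis z) 0)"
proof (rule LIMSEQ_I)
  fix \<epsilon> :: real assume "\<epsilon> > 0"
  interpret finite_measure haar by (rule finite_measure_haar)
  define g\<^sub>0 where "g\<^sub>0 = su2_mat (cis z) 0"
  define \<psi> where "\<psi> g = \<bar>\<phi> g - \<phi> g\<^sub>0\<bar>" for g
  define d where "d g = cmod (1 - g$1$1 * cis (- z))" for g :: cmat2
  have g0: "g = g\<^sub>0" if "g \<in> SU2" "d g = 0" for g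
  proof -
    from that have "g$1$1 * cis (- z) = 1" by (simp add: d_def)
    then have "g$1$1 * cis (- z) * cis z = cis z" by simp
    then have 1: "g$1$1 = cis z" by (simp only: mult.assoc cis_mult) simp
    with SU2_E(2)[OF that(1)] have "g$1$2 = 0" by simp
    with 1 SU2_E(1)[OF that(1)] show ?thesis by (simp add: g\<^sub>0_def)
  qed
  have \<psi>: "continuous_on SU2 \<psi>" unfolding \<psi>_def by (intro continuous_intros \<phi>)
  have "compact {g \<in> SU2. \<epsilon> / 2 \<le> \<psi> g}"
  proof -
    have "{g \<in> SU2. \<epsilon> / 2 \<le> \<psi> g} = SU2 \<inter> \<psi> -` {\<epsilon> / 2..}" by blast
    then show ?thesis
      using closedin_compact[OF compact_SU2 continuous_closedin_preimage[OF \<psi> closed_atLeast]] by simp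
  qed
  moreover have "continuous_on {g \<in> SU2. \<epsilon> / 2 \<le> \<psi> g} d"
    unfolding d_def by (intro continuous_intros)
  ultimately have "\<exists>\<delta>>0. \<forall>g\<in>{g \<in> SU2. \<epsilon> / 2 \<le> \<psi> g}. \<delta> \<le> d g"
  proof (cases "{g \<in> SU2. \<epsilon> / 2 \<le> \<psi> g} = {}")
    case False
    assume "compact {g \<in> SU2. \<epsilon> / 2 \<le> \<psi> g}" "continuous_on {g \<in> SU2. \<epsilon> / 2 \<le> \<psi> g} d"
    from continuous_attains_inf[OF this(1) False this(2)] obtain g\<^sub>1 where
      g1: "g\<^sub>1 \<in> SU2" "\<epsilon> / 2 \<le> \<psi> g\<^sub>1" "\<And>g. g \<in> SU2 \<Longrightarrow> \<epsilon> / 2 \<le> \<psi> g \<Longrightarrow> d g\<^sub>1 \<le> d g" by auto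
    have "d g\<^sub>1 \<noteq> 0"
      using g0[OF g1(1)] g1(2) \<open>\<epsilon> > 0\<close> by (auto simp: \<psi>_def)
    then have "d g\<^sub>1 > 0" by (simp add: d_def)
    with g1 show ?thesis by auto
  qed (auto intro: exI[of _ 1])
  then obtain \<delta> where \<delta>: "\<delta> > 0" "\<And>g. g \<in> SU2 \<Longrightarrow> \<epsilon> / 2 \<le> \<psi> g \<Longrightarrow> \<delta> \<le> d g" by auto
  have "bounded (\<psi> ` SU2)"
    by (intro compact_imp_bounded compact_continuous_image \<psi> compact_SU2)
  then obtain B where B: "\<And>g. g \<in> SU2 \<Longrightarrow> norm (\<psi> g) \<le> B" "B > 0"
    by (auto simp: bounded_pos)
  \<comment> \<open>an upper bound for the contribution of the region where \<open>\<psi>\<close> is not small\<close>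
  define K where "K = B * (4 / \<delta>\<^sup>2) * measure haar (space haar)"
  have int: "integrable haar (fejer M z)" "integrable haar (\<lambda>g. \<phi> g * fejer M z g)"
     "integrable haar (\<lambda>g. \<psi> g * fejer M z g)" for M
    by (intro haar_integrable_continuous continuous_intros continuous_on_fejer \<phi> \<psi>)+
  have est: "\<bar>(\<integral>g. \<phi> g * fejer M z g \<partial>haar) - \<phi> g\<^sub>0 * harm M\<bar> \<le> \<epsilon> / 2 * harm M + K" for M
  proof -
    have "(\<integral>g. \<phi> g * fejer M z g \<partial>haar) - \<phi> g\<^sub>0 * harm M
       = (\<integral>g. \<phi> g * fejer M z g - \<phi> g\<^sub>0 * fejer M z g \<partial>haar)"
      unfolding fejer_integral[of M z, symmetric] using int by simp
    also have "\<bar>\<dots>\<bar> \<le> (\<integral>g. \<bar>\<phi> g * fejer M z g - \<phi> g\<^sub>0 * fejer M z g\<bar> \<partial>haar)"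
      by (rule integral_abs_bound)
    also have "\<dots> = (\<integral>g. \<psi> g * fejer M z g \<partial>haar)"
      by (simp add: \<psi>_def fejer_nonneg abs_mult flip: left_diff_distrib)
    also have "\<dots> \<le> (\<integral>g. \<epsilon> / 2 * fejer M z g + B * (4 / \<delta>\<^sup>2) \<partial>haar)"
    proof (intro integral_mono int Bochner_Integration.integrable_add integrable_mult_right integrable_const)
      fix g assume "g \<in> space haar"
      then have g: "g \<in> SU2" by (simp add: space_haar)
      show "\<psi> g * fejer M z g \<le> \<epsilon> / 2 * fejer M z g + B * (4 / \<delta>\<^sup>2)"
      proof (cases "\<epsilon> / 2 \<le> \<psi> g")
        case True
        with \<delta> g have "\<delta> \<le> cmod (1 - g$1$1 * cis (- z))" by (auto simp: d_def)
        from fejer_bound[OF g \<delta>(1) this] have "\<psi> g * fejer M z g \<le> B * (4 / \<delta>\<^sup>2)"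
          using B(1)[OF g] B(2) by (intro mult_mono fejer_nonneg) auto
        moreover have "\<epsilon> / 2 * fejer M z g \<ge> 0" using \<open>\<epsilon> > 0\<close> fejer_nonneg by simp
        ultimately show ?thesis by simp
      next
        case False
        then have "\<psi> g * fejer M z g \<le> \<epsilon> / 2 * fejer M z g"
          by (intro mult_right_mono fejer_nonneg) auto
        moreover have "0 \<le> B * (4 / \<delta>\<^sup>2)" using B(2) \<delta>(1) by simp
        ultimately show ?thesis by simp
      qed
    qed
    also have "\<dots> = \<epsilon> / 2 * harm M + K"
      using int(1) by (simp add: fejer_integral K_def mult_ac)
    finally show ?thesis .
  qed
  have "filterlim (\<lambda>M. harm M :: real) at_top sequentially"
    by (rule harm_at_top)
  then have "eventually (\<lambda>M. harm M > max 0 (2 * K / \<epsilon>)) sequentially"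
    by (rule filterlim_at_top_dense[THEN iffD1, rule_format])
  then obtain M\<^sub>0 where M0: "\<And>M. M \<ge> M\<^sub>0 \<Longrightarrow> harm M > max 0 (2 * K / \<epsilon>)"
    by (auto simp: eventually_sequentially)
  show "\<exists>no. \<forall>M\<ge>no. norm ((\<integral>g. \<phi> g * fejer M z g \<partial>haar) / harm M - \<phi> (su2_mat (cis z) 0)) < \<epsilon>"
  proof (intro exI allI impI)
    fix M assume "M \<ge> M\<^sub>0"
    have frac: "x / h - c = (x - c * h) / h" if "h > 0" for x c h :: real
      using that by (simp add: field_simps)
    from \<open>M \<ge> M\<^sub>0\<close> M0 have h: "harm M > (0::real)" "harm M > 2 * K / \<epsilon>" by auto
    have "(\<integral>g. \<phi> g * fejer M z g \<partial>haar) / harm M - \<phi> g\<^sub>0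
       = ((\<integral>g. \<phi> g * fejer M z g \<partial>haar) - \<phi> g\<^sub>0 * harm M) / harm M"
      by (rule frac) (rule h(1))
    also have "\<bar>\<dots>\<bar> \<le> (\<epsilon> / 2 * harm M + K) / harm M"
    proof -
      have "\<bar>x / h\<bar> \<le> y / h" if "h > 0" "\<bar>x\<bar> \<le> y" for x y h :: real
        using that by (simp add: divide_right_mono)
      then show ?thesis using h(1) est[of M] by blast
    qed
    also have "\<dots> < \<epsilon>"
      using h \<open>\<epsilon> > 0\<close> by (simp add: field_simps)
    finally show "norm ((\<integral>g. \<phi> g * fejer M z g \<partial>haar) / harm M - \<phi> (su2_mat (cis z) 0)) < \<epsilon>"
      by (simp add: g\<^sub>0_def)
  qed
qed

section \<open>From the generator to integrals of the heat kernel\<close>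

text \<open>
  Dominated convergence along sequences: a convergent sequence of parameters together with its limit is compact, which
  bounds the integrand.
\<close>

lemma continuous_on_parametric_integral:
  fixes k :: "'a::heine_borel \<times> cmat2 \<Rightarrow> real"
  assumes k: "continuous_on (T \<times> SU2) k"
  shows "continuous_on T (\<lambda>t. \<integral>y. k (t, y) \<partial>haar)"
  unfolding continuous_on_sequentially
proof (intro allI ballI impI, elim conjE)
  fix x :: "nat \<Rightarrow> 'a" and a assume a: "a \<in> T" and x: "\<forall>n. x n \<in> T" "x \<longlonglongrightarrow> a"
  interpret finite_measure haar by (rule finite_measure_haar)
  define K where "K = insert a (range x)"
  have "compact K" unfolding K_def using x(2) by (rule compact_sequence_with_limit)
  moreover have KT: "K \<subseteq> T" using a x(1) by (auto simp: K_def)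
  ultimately have "bounded (k ` (K \<times> SU2))"
    by (intro compact_imp_bounded compact_continuous_image continuous_on_subset[OF k] compact_Times compact_SU2) auto
  then obtain B where B: "\<And>t y. t \<in> K \<Longrightarrow> y \<in> SU2 \<Longrightarrow> norm (k (t, y)) \<le> B"
    by (auto simp: bounded_iff)
  have sec: "continuous_on SU2 (\<lambda>y. k (t, y))" if "t \<in> T" for t
    using that by (intro continuous_on_compose2[OF k] continuous_intros) auto
  have "(\<lambda>n. \<integral>y. k (x n, y) \<partial>haar) \<longlonglongrightarrow> (\<integral>y. k (a, y) \<partial>haar)"
  proof (rule integral_dominated_convergence[where w = "\<lambda>_. B"])
    show "AE y in haar. (\<lambda>n. k (x n, y)) \<longlonglongrightarrow> k (a, y)"
    proof (rule AE_I2)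
      fix y assume "y \<in> space haar"
      then have "continuous_on T (\<lambda>t. k (t, y))"
        by (intro continuous_on_compose2[OF k] continuous_intros) (auto simp: space_haar)
      then show "(\<lambda>n. k (x n, y)) \<longlonglongrightarrow> k (a, y)"
        using a x unfolding continuous_on_sequentially o_def by blast
    qed
    show "AE y in haar. norm (k (x n, y)) \<le> B" for n
      by (rule AE_I2) (use B in \<open>auto simp: space_haar K_def\<close>)
  qed (use a x(1) sec in \<open>auto intro: borel_measurable_haar_continuous\<close>)
  then show "((\<lambda>t. \<integral>y. k (t, y) \<partial>haar) \<circ> x) \<longlonglongrightarrow> (\<integral>y. k (a, y) \<partial>haar)"
    by (simp add: o_def)
qed

lemma continuous_imp_L2:
  assumes "continuous_on SU2 f"
  shows "f \<in> L2"
  unfolding L2_def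
  by (auto intro!: borel_measurable_haar_continuous haar_integrable_continuous continuous_intros assms)

lemma L2_mult_integrable:
  assumes "f \<in> L2" "g \<in> L2"
  shows "integrable haar (\<lambda>x. f x * g x)"
proof (rule Bochner_Integration.integrable_bound)
  show "integrable haar (\<lambda>x. (f x)\<^sup>2 + (g x)\<^sup>2)" using assms by (auto simp: L2_def)
  show "(\<lambda>x. f x * g x) \<in> borel_measurable haar" using assms by (auto simp: L2_def)
  have "\<bar>a * b\<bar> \<le> a\<^sup>2 + b\<^sup>2" for a b :: real
  proof -
    have "0 \<le> (\<bar>a\<bar> - \<bar>b\<bar>)\<^sup>2" by simp
    then have "2 * (\<bar>a\<bar> * \<bar>b\<bar>) \<le> a\<^sup>2 + b\<^sup>2" by (simp add: power2_diff)
    then show ?thesis unfolding abs_mult by (smt (verit) zero_le_mult_iff abs_ge_zero)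
  qed
  then show "AE x in haar. norm (f x * g x) \<le> norm ((f x)\<^sup>2 + (g x)\<^sup>2)"
    by (intro AE_I2) (simp add: order.trans[OF _ abs_ge_self])
qed

lemma L2_lincomb:
  assumes "f \<in> L2" "g \<in> L2"
  shows "(\<lambda>x. a * f x + b * g x) \<in> L2"
proof -
  have "integrable haar (\<lambda>x. a\<^sup>2 * (f x)\<^sup>2 + 2 * a * b * (f x * g x) + b\<^sup>2 * (g x)\<^sup>2)"
    using assms L2_mult_integrable[OF assms] by (auto simp: L2_def)
  moreover have "(\<lambda>x. a\<^sup>2 * (f x)\<^sup>2 + 2 * a * b * (f x * g x) + b\<^sup>2 * (g x)\<^sup>2) = (\<lambda>x. (a * f x + b * g x)\<^sup>2)"
    by (simp add: fun_eq_iff power2_eq_square algebra_simps)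
  ultimately show ?thesis
    using assms unfolding L2_def by (auto intro!: borel_measurable_add borel_measurable_times)
qed

text \<open>
  The quadratic \<open>s \<mapsto> \<integral>(f + s g)^2\<close> is nonnegative, so its discriminant is not positive.
\<close>

lemma L2_Cauchy_Schwarz:
  assumes f: "f \<in> L2" and g: "g \<in> L2"
  shows "\<bar>\<integral>x. f x * g x \<partial>haar\<bar> \<le> L2norm f * L2norm g"
proof -
  define A B C where "A = (\<integral>x. (f x)\<^sup>2 \<partial>haar)" and "B = (\<integral>x. f x * g x \<partial>haar)" and "C = (\<integral>x. (g x)\<^sup>2 \<partial>haar)"
  have nonneg: "A \<ge> 0" "C \<ge> 0" by (simp_all add: A_def C_def)
  have int: "integrable haar (\<lambda>x. (f x)\<^sup>2)" "integrable haar (\<lambda>x. (g x)\<^sup>2)" "integrable haar (\<lambda>x. f x * g x)"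
    using f g L2_mult_integrable[OF f g] by (auto simp: L2_def)
  have quad: "A + 2 * s * B + s\<^sup>2 * C \<ge> 0" for s
  proof -
    have "A + 2 * s * B + s\<^sup>2 * C = (\<integral>x. (f x)\<^sup>2 + 2 * s * (f x * g x) + s\<^sup>2 * (g x)\<^sup>2 \<partial>haar)"
      using int by (simp add: A_def B_def C_def)
    also have "\<dots> = (\<integral>x. (f x + s * g x)\<^sup>2 \<partial>haar)"
      by (intro Bochner_Integration.integral_cong) (auto simp: power2_eq_square algebra_simps)
    also have "\<dots> \<ge> 0" by simp
    finally show ?thesis .
  qed
  have "B\<^sup>2 \<le> A * C"
  proof (cases "C = 0")
    case True
    have "B = 0"
    proof (rule ccontr)
      assume "B \<noteq> 0"
      with quad[of "- (A + 1) / (2 * B)"] True show False by (simp add: field_simps)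
    qed
    then show ?thesis using nonneg by simp
  next
    case False
    with nonneg have "C > 0" by simp
    with quad[of "- B / C"] show ?thesis
      by (simp add: field_simps power2_eq_square)
  qed
  then have "sqrt (B\<^sup>2) \<le> sqrt (A * C)" by (rule real_sqrt_le_mono)
  then show ?thesis by (simp add: L2norm_def A_def B_def C_def real_sqrt_mult)
qed

text \<open>
  The generator of a semigroup only describes derivatives from the right. The set of times up to which \<open>G\<close> has grown
  with slope at most \<open>\<epsilon>\<close> is closed by continuity and can be extended to the right of any of its points by the
  hypothesis on the derivative.
\<close>

lemma right_derivative_zero_imp_constant:
  fixes G :: "real \<Rightarrow> real"
  assumes cont: "continuous_on {a..b} G" and "a \<le> b"
    and deriv: "\<And>t. a \<le> t \<Longrightarrow> t < b \<Longrightarrow> ((\<lambda>s. (G (t + s) - G t) / s) \<longlongrightarrow> 0) (at_right 0)"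
  shows "G b = G a"
proof -
  have "\<bar>G b - G a\<bar> \<le> \<epsilon> * (b - a)" if "\<epsilon> > 0" for \<epsilon>
  proof -
    \<comment> \<open>\<open>T\<close> consists of the times up to which the estimate holds throughout; its supremum is \<open>b\<close>\<close>
    define S where "S = {t \<in> {a..b}. \<bar>G t - G a\<bar> \<le> \<epsilon> * (t - a)}"
    define T where "T = {t \<in> {a..b}. {a..t} \<subseteq> S}"
    have "a \<in> T" using \<open>a \<le> b\<close> by (auto simp: T_def S_def)
    have bdd: "bdd_above T" by (auto simp: T_def bdd_above_def)
    define c where "c = Sup T"
    have c: "a \<le> c" "c \<le> b"
      using \<open>a \<in> T\<close> bdd by (auto simp: c_def T_def intro!: cSup_upper cSup_least)
    have below: "t \<in> S" if "a \<le> t" "t < c" for t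
    proof -
      obtain u where "u \<in> T" "t < u"
        using less_cSup_iff[OF _ bdd, of t] \<open>a \<in> T\<close> \<open>t < c\<close> unfolding c_def by blast
      with \<open>a \<le> t\<close> show ?thesis by (auto simp: T_def)
    qed
    have "closed S"
    proof -
      have "continuous_on {a..b} (\<lambda>t. \<bar>G t - G a\<bar> - \<epsilon> * (t - a))"
        by (intro continuous_intros cont)
      from continuous_closed_preimage[OF this closed_atLeastAtMost closed_atMost[of 0]]
      show ?thesis by (auto simp: S_def vimage_def Int_def)
    qed
    have "c \<in> S"
    proof (cases "c = a")
      case True
      then show ?thesis using \<open>a \<le> b\<close> by (simp add: S_def)
    next
      case False
      with c have "a < c" by simp
      have "{a<..<c} \<subseteq> S" using below by auto
      then have "closure {a<..<c} \<subseteq> S" using \<open>closed S\<close> by (rule closure_minimal)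
      then show ?thesis using \<open>a < c\<close> by auto
    qed
    have "c = b"
    proof (rule ccontr)
      assume "c \<noteq> b"
      with c have "c < b" by simp
      from tendstoD[OF deriv[OF c(1) this] \<open>\<epsilon> > 0\<close>]
      obtain h where h: "h > 0" "\<And>s. 0 < s \<Longrightarrow> s < h \<Longrightarrow> \<bar>(G (c + s) - G c) / s\<bar> < \<epsilon>"
        by (auto simp: eventually_at_right_field)
      define u where "u = min b (c + h / 2)"
      have u: "c < u" "u \<le> b" "u - c < h" using \<open>c < b\<close> h(1) by (auto simp: u_def min_def)
      have "t \<in> S" if "a \<le> t" "t \<le> u" for t
      proof (cases "t \<le> c")
        case True
        with below \<open>c \<in> S\<close> that show ?thesis by (cases "t = c") auto
      next
        case False
        with u that h(2)[of "t - c"] have "\<bar>G t - G c\<bar> \<le> \<epsilon> * (t - c)"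
          by (simp add: abs_divide divide_less_eq)
        moreover have "\<bar>G c - G a\<bar> \<le> \<epsilon> * (c - a)" using \<open>c \<in> S\<close> by (simp add: S_def)
        ultimately have "\<bar>G t - G a\<bar> \<le> \<epsilon> * (t - a)" by (simp add: algebra_simps)
        with that u show ?thesis by (simp add: S_def)
      qed
      then have "u \<in> T" using u c by (auto simp: T_def)
      then have "u \<le> c" unfolding c_def using bdd by (rule cSup_upper)
      with u show False by simp
    qed
    with \<open>c \<in> S\<close> show ?thesis by (simp add: S_def)
  qed
  note bound = this
  show ?thesis
  proof (rule ccontr)
    assume ne: "G b \<noteq> G a"
    with \<open>a \<le> b\<close> have "a < b" by (cases "a = b") auto
    then have "\<bar>G b - G a\<bar> \<le> \<bar>G b - G a\<bar> / (2 * (b - a)) * (b - a)"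
      using ne by (intro bound) simp
    also have "\<dots> = \<bar>G b - G a\<bar> / 2"
    proof -
      have "x / (2 * d) * d = x / 2" if "d > 0" for x d :: real using that by simp
      then show ?thesis using \<open>a < b\<close> by (meson diff_gt_0_iff_gt)
    qed
    finally show False using ne by simp
  qed
qed

lemma mat_one_eq: "(mat 1 :: cmat2) = su2_mat 1 0"
  by (simp add: mat2_eq_iff mat2_one)

lemma mat_one_in_SU2: "(mat 1 :: cmat2) \<in> SU2"
  unfolding mat_one_eq by (rule su2_mat_in_SU2) simp

lemma kernel_continuous:
  assumes "smooth_kernel P p"
  shows "continuous_on ({0<..} \<times> SU2 \<times> SU2) (\<lambda>(t, x, y). p t x y)"
proof -
  from assms obtain U F where "{0<..} \<times> SU2 \<times> SU2 \<subseteq> U" "\<forall>n. Ck_on n F U"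
    "\<forall>x\<in>{0<..} \<times> SU2 \<times> SU2. F x = (\<lambda>(t, x, y). p t x y) x"
    unfolding smooth_kernel_def smooth_on_def by blast
  moreover from this(2) have "continuous_on U F" by (metis Ck_on.simps(1))
  ultimately show ?thesis
    by (metis (no_types, lifting) continuous_on_cong continuous_on_subset)
qed

lemma kernel_from_identity_continuous:
  assumes p: "smooth_kernel P p" and t: "t > 0"
  shows "continuous_on SU2 (p t (mat 1))"
proof -
  have "continuous_on SU2 (\<lambda>y. (\<lambda>(t, x, y). p t x y) (t, mat 1, y))"
    using t mat_one_in_SU2
    by (intro continuous_on_compose2[OF kernel_continuous[OF p]] continuous_intros) auto
  then show ?thesis by simp
qed

lemma kernel_integral_continuous:
  assumes "smooth_kernel P p" "continuous_on SU2 f"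
  shows "continuous_on ({0<..} \<times> SU2) (\<lambda>(t, x). \<integral>y. p t x y * f y \<partial>haar)"
proof -
  have "continuous_on (({0<..} \<times> SU2) \<times> SU2) ((\<lambda>(t, x, y). p t x y) \<circ> (\<lambda>((t, x), y). (t, x, y)))"
    by (intro continuous_on_compose continuous_on_subset[OF kernel_continuous[OF assms(1)]])
       (auto simp: split_beta intro!: continuous_intros)
  moreover have "continuous_on (({0<..} \<times> SU2) \<times> SU2) (\<lambda>x. f (snd x))"
    by (intro continuous_on_compose2[OF assms(2)] continuous_intros) auto
  ultimately have "continuous_on (({0<..} \<times> SU2) \<times> SU2) (\<lambda>x. ((\<lambda>(t, x, y). p t x y) \<circ> (\<lambda>((t, x), y). (t, x, y))) x * f (snd x))"
    by (intro continuous_on_mult)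
  from continuous_on_parametric_integral[OF this] show ?thesis
    by (simp add: split_beta)
qed

text \<open>
  By the semigroup law, \<open>P t\<close> maps the difference quotient at time 0 to the one at time \<open>t\<close>, and \<open>P t\<close>
  is bounded. Testing against \<open>h\<close> makes the statement one about real functions.
\<close>

lemma weak_right_derivative:
  assumes P: "C0_semigroup P" and gen: "generator P f (\<lambda>x. - l * f x)" and h: "h \<in> L2" and "t \<ge> 0"
  shows "((\<lambda>s. ((\<integral>x. P (t + s) f x * h x \<partial>haar) - (\<integral>x. P t f x * h x \<partial>haar)) / s)
           \<longlongrightarrow> - l * (\<integral>x. P t f x * h x \<partial>haar)) (at_right 0)"
proof -
  define F where "F t = (\<integral>x. P t f x * h x \<partial>haar)" for t
  define d where "d s x = (P s f x - f x) / s - (- l * f x)" for s x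
  have f: "f \<in> L2" and d0: "((\<lambda>s. L2norm (d s)) \<longlongrightarrow> 0) (at_right 0)"
    using gen by (auto simp: generator_def L2_tendsto_def d_def[abs_def])
  have PL2: "P s g \<in> L2" if "s \<ge> 0" "g \<in> L2" for s g
    using P that by (auto simp: C0_semigroup_def)
  have lin: "AE x in haar. P t (\<lambda>y. a * f y + b * g y) x = a * P t f x + b * P t g x"
    if "f \<in> L2" "g \<in> L2" for f g a b
    using P \<open>t \<ge> 0\<close> that by (simp add: C0_semigroup_def)
  obtain M where M: "\<And>g. g \<in> L2 \<Longrightarrow> L2norm (P t g) \<le> M * L2norm g"
  proof -
    from P have "\<forall>t\<ge>0. \<exists>M. \<forall>f\<in>L2. L2norm (P t f) \<le> M * L2norm f"
      by (simp add: C0_semigroup_def)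
    with \<open>t \<ge> 0\<close> that show ?thesis by blast
  qed
  have key: "\<bar>(F (t + s) - F t) / s - (- l * F t)\<bar> \<le> M * L2norm (d s) * L2norm h" if "s > 0" for s
  proof -
    \<comment> \<open>the error of the difference quotient at time 0 as a linear combination, to which \<open>P t\<close> can be applied\<close>
    have d: "d s = (\<lambda>x. (1 / s) * P s f x + (l - 1 / s) * f x)"
    proof
      fix x
      have "(a - b) / s - (- l * b) = (1 / s) * a + (l - 1 / s) * b" for a b
        using that by (simp add: field_simps)
      then show "d s x = (1 / s) * P s f x + (l - 1 / s) * f x" unfolding d_def .
    qed
    have dL2: "d s \<in> L2" unfolding d using that f by (intro L2_lincomb PL2) auto
    have "AE x in haar. P t (d s) x = (1 / s) * P t (P s f) x + (l - 1 / s) * P t f x"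
      unfolding d using that by (intro lin PL2 f) auto
    moreover have "AE x in haar. P (t + s) f x = P t (P s f) x"
      using P \<open>t \<ge> 0\<close> f that by (simp add: C0_semigroup_def)
    ultimately have ae: "AE x in haar. P t (d s) x * h x = (1 / s) * (P (t + s) f x * h x) + (l - 1 / s) * (P t f x * h x)"
      by eventually_elim (simp only: distrib_right mult.assoc)
    have int: "integrable haar (\<lambda>x. P (t + s) f x * h x)" "integrable haar (\<lambda>x. P t f x * h x)"
       "integrable haar (\<lambda>x. P t (d s) x * h x)"
      using \<open>t \<ge> 0\<close> that f dL2 h by (auto intro!: L2_mult_integrable PL2)
    have "(\<integral>x. P t (d s) x * h x \<partial>haar) = (\<integral>x. (1 / s) * (P (t + s) f x * h x) + (l - 1 / s) * (P t f x * h x) \<partial>haar)"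
      using int by (intro integral_cong_AE ae) auto
    also have "\<dots> = (1 / s) * F (t + s) + (l - 1 / s) * F t"
      using int by (simp add: F_def)
    also have "\<dots> = (F (t + s) - F t) / s - (- l * F t)"
      using that by (simp add: field_simps)
    finally have "\<bar>(F (t + s) - F t) / s - (- l * F t)\<bar> = \<bar>\<integral>x. P t (d s) x * h x \<partial>haar\<bar>" by simp
    also have "\<dots> \<le> L2norm (P t (d s)) * L2norm h"
      using dL2 h \<open>t \<ge> 0\<close> by (intro L2_Cauchy_Schwarz PL2)
    also have "\<dots> \<le> M * L2norm (d s) * L2norm h"
      using M[OF dL2] by (intro mult_right_mono) (auto simp: L2norm_def)
    finally show ?thesis .
  qed
  have "((\<lambda>s. M * L2norm (d s) * L2norm h) \<longlongrightarrow> M * 0 * L2norm h) (at_right 0)"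
    by (intro tendsto_intros d0)
  then have "((\<lambda>s. M * L2norm (d s) * L2norm h) \<longlongrightarrow> 0) (at_right 0)" by simp
  moreover have "eventually (\<lambda>s. norm ((F (t + s) - F t) / s - (- l * F t)) \<le> M * L2norm (d s) * L2norm h) (at_right 0)"
    using key by (auto simp: eventually_at_right_field intro: exI[of _ 1])
  ultimately have "((\<lambda>s. (F (t + s) - F t) / s - (- l * F t)) \<longlongrightarrow> 0) (at_right 0)"
    by (rule Lim_null_comparison[rotated])
  then show ?thesis
    unfolding F_def by (rule LIM_zero_cancel)
qed

text \<open>
  The pairing with \<open>h\<close>, multiplied by \<open>exp (l * t)\<close>, has right derivative 0. Its continuity in \<open>t > 0\<close> is
  that of the kernel, and at \<open>t = 0\<close> it comes from the right derivative there.
\<close>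

lemma weak_eigen_evolution:
  assumes P: "C0_semigroup P" and gen: "generator P f (\<lambda>x. - l * f x)"
    and p: "smooth_kernel P p" and f: "continuous_on SU2 f" and h: "continuous_on SU2 h" and "b > 0"
  shows "(\<integral>x. (\<integral>y. p b x y * f y \<partial>haar) * h x \<partial>haar) = exp (- l * b) * (\<integral>x. f x * h x \<partial>haar)"
proof -
  note fL2 = continuous_imp_L2[OF f] and hL2 = continuous_imp_L2[OF h]
  define F where "F t = (\<integral>x. P t f x * h x \<partial>haar)" for t
  define u where "u t x = (\<integral>y. p t x y * f y \<partial>haar)" for t x
  have PL2: "P s f \<in> L2" if "s \<ge> 0" for s
    using P fL2 that by (auto simp: C0_semigroup_def)
  have u: "continuous_on ({0<..} \<times> SU2) (\<lambda>(t, x). u t x)"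
    unfolding u_def by (rule kernel_integral_continuous[OF p f])
  have ut: "continuous_on SU2 (u t)" if "t > 0" for t
  proof -
    have "continuous_on SU2 (\<lambda>x. (\<lambda>(t, x). u t x) (t, x))"
      using that by (intro continuous_on_compose2[OF u] continuous_intros) auto
    then show ?thesis by simp
  qed
  have Fu: "F t = (\<integral>x. u t x * h x \<partial>haar)" if "t > 0" for t
  proof -
    have "AE x in haar. P t f x = u t x"
      using p fL2 that by (simp add: smooth_kernel_def u_def)
    then have "AE x in haar. P t f x * h x = u t x * h x" by eventually_elim simp
    then show ?thesis unfolding F_def
      using PL2[of t] that borel_measurable_haar_continuous[OF h] borel_measurable_haar_continuous[OF ut[OF that]]
      by (intro integral_cong_AE) (auto simp: L2_def intro: borel_measurable_times)
  qed
  have Fcont: "continuous_on {0<..} F"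
  proof -
    have "continuous_on ({0<..} \<times> SU2) (\<lambda>x. (\<lambda>(t, x). u t x) x * h (snd x))"
      by (intro continuous_on_mult u continuous_on_compose2[OF h] continuous_intros) auto
    from continuous_on_parametric_integral[OF this]
    have "continuous_on {0<..} (\<lambda>t. \<integral>x. u t x * h x \<partial>haar)" by simp
    then show ?thesis by (rule continuous_on_eq) (auto simp: Fu)
  qed
  have Fder: "((\<lambda>s. (F (t + s) - F t) / s) \<longlongrightarrow> - l * F t) (at_right 0)" if "t \<ge> 0" for t
    unfolding F_def using P gen hL2 that by (rule weak_right_derivative)
  define G where "G t = exp (l * t) * F t" for t
  have "G b = G 0"
  proof (rule right_derivative_zero_imp_constant[where G = G and a = 0 and b = b])
    have "((\<lambda>s. F 0 + s * ((F (0 + s) - F 0) / s)) \<longlongrightarrow> F 0 + 0 * (- l * F 0)) (at_right 0)"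
      by (intro tendsto_intros Fder) auto
    moreover have "eventually (\<lambda>s. F 0 + s * ((F (0 + s) - F 0) / s) = F s) (at_right 0)"
      by (auto simp: eventually_at_right_field intro: exI[of _ 1])
    ultimately have "(F \<longlongrightarrow> F 0) (at_right 0)"
      by (auto intro: Lim_transform_eventually)
    then have F0: "continuous (at 0 within {0..b}) F"
      using \<open>b > 0\<close> by (simp add: continuous_within at_within_Icc_at_right)
    have "continuous (at t within {0..b}) F" if "t \<in> {0..b}" for t
    proof (cases "t = 0")
      case False
      with that have "t \<in> {0<..}" by simp
      with Fcont have "isCont F t"
        by (simp add: continuous_on_eq_continuous_at)
      then show ?thesis by (rule continuous_at_imp_continuous_at_within)
    qed (use F0 in simp)
    then have "continuous_on {0..b} F" by (simp add: continuous_on_eq_continuous_within)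
    then show "continuous_on {0..b} G"
      unfolding G_def by (intro continuous_intros)
    fix t :: real assume t: "0 \<le> t" "t < b"
    have "((\<lambda>x. exp (l * x)) has_real_derivative exp (l * t) * l) (at t)"
      by (auto intro!: derivative_eq_intros)
    then have 1: "((\<lambda>s. (exp (l * (t + s)) - exp (l * t)) / s) \<longlongrightarrow> exp (l * t) * l) (at_right 0)"
      by (auto simp: DERIV_def intro: tendsto_mono[OF at_le])
    have 2: "((\<lambda>s. exp (l * (t + s))) \<longlongrightarrow> exp (l * (t + 0))) (at_right 0)"
      by (intro tendsto_intros)
    have "((\<lambda>s. exp (l * (t + s)) * ((F (t + s) - F t) / s) + (exp (l * (t + s)) - exp (l * t)) / s * F t)
       \<longlongrightarrow> exp (l * (t + 0)) * (- l * F t) + exp (l * t) * l * F t) (at_right 0)"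
      by (intro tendsto_intros 1 2 Fder t)
    moreover have "exp (l * (t + s)) * ((F (t + s) - F t) / s) + (exp (l * (t + s)) - exp (l * t)) / s * F t
       = (G (t + s) - G t) / s" for s
      by (simp add: G_def add_divide_distrib diff_divide_distrib algebra_simps)
    ultimately show "((\<lambda>s. (G (t + s) - G t) / s) \<longlongrightarrow> 0) (at_right 0)" by simp
  qed (use \<open>b > 0\<close> in simp)
  moreover have "F 0 = (\<integral>x. f x * h x \<partial>haar)"
  proof -
    have "AE x in haar. P 0 f x = f x" using P fL2 by (simp add: C0_semigroup_def)
    then have "AE x in haar. P 0 f x * h x = f x * h x" by eventually_elim simp
    then show ?thesis unfolding F_def
      using PL2[of 0] borel_measurable_haar_continuous[OF h] borel_measurable_haar_continuous[OF f]
      by (intro integral_cong_AE) (auto simp: L2_def intro: borel_measurable_times)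
  qed
  ultimately have "exp (l * b) * F b = (\<integral>x. f x * h x \<partial>haar)" by (simp add: G_def)
  then have "F b = exp (- l * b) * (\<integral>x. f x * h x \<partial>haar)"
    by (simp add: exp_minus field_simps)
  then show ?thesis using Fu[OF \<open>b > 0\<close>] by (simp add: u_def)
qed

text \<open>
  Taking Fejer kernels with peak at the identity for \<open>h\<close> in \<open>weak_eigen_evolution\<close> localises the identity of
  functions at that point.
\<close>

lemma kernel_eigenfunction:
  assumes P: "C0_semigroup P" and gen: "generator P f (\<lambda>x. - l * f x)"
    and p: "smooth_kernel P p" and f: "continuous_on SU2 f" and "t > 0"
  shows "(\<integral>y. p t (mat 1) y * f y \<partial>haar) = exp (- l * t) * f (mat 1)"
proof -
  define u where "u x = (\<integral>y. p t x y * f y \<partial>haar)" for x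
  have u: "continuous_on SU2 u"
  proof -
    have "continuous_on SU2 (\<lambda>x. (\<lambda>(t, x). \<integral>y. p t x y * f y \<partial>haar) (t, x))"
      using \<open>t > 0\<close> by (intro continuous_on_compose2[OF kernel_integral_continuous[OF p f]] continuous_intros) auto
    then show ?thesis by (simp add: u_def)
  qed
  define \<phi> where "\<phi> x = u x - exp (- l * t) * f x" for x
  have \<phi>: "continuous_on SU2 \<phi>" unfolding \<phi>_def by (intro continuous_intros u f)
  have "(\<integral>x. \<phi> x * fejer M 0 x \<partial>haar) = 0" for M
  proof -
    have h: "continuous_on SU2 (fejer M 0)" by (rule continuous_on_fejer)
    have "(\<integral>x. \<phi> x * fejer M 0 x \<partial>haar) = (\<integral>x. u x * fejer M 0 x - exp (- l * t) * (f x * fejer M 0 x) \<partial>haar)"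
      by (simp add: \<phi>_def algebra_simps)
    also have "\<dots> = (\<integral>x. u x * fejer M 0 x \<partial>haar) - exp (- l * t) * (\<integral>x. f x * fejer M 0 x \<partial>haar)"
      by (subst Bochner_Integration.integral_diff)
         (auto intro!: haar_integrable_continuous continuous_intros u f h simp del: mult_eq_0_iff)
    also have "\<dots> = 0"
      unfolding u_def weak_eigen_evolution[OF P gen p f h \<open>t > 0\<close>] by simp
    finally show ?thesis .
  qed
  with fejer_concentration[OF \<phi>, of 0] have "(\<lambda>M. 0) \<longlonglongrightarrow> \<phi> (su2_mat (cis 0) 0)" by simp
  then have "\<phi> (su2_mat (cis 0) 0) = 0" by (simp add: LIMSEQ_const_iff)
  moreover have "su2_mat (cis 0) 0 = mat 1" by (simp add: mat_one_eq)
  ultimately show ?thesis by (simp add: \<phi>_def u_def)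
qed

lemma real_polynomial_zernike: "real_polynomial_function (\<lambda>g. Re (c * zernike i j g))"
  using complex_polynomial_mult[OF complex_polynomial_const complex_polynomial_zernike, of c i j]
  by (simp add: complex_polynomial_def)

lemma continuous_on_zernike: "continuous_on S (\<lambda>g. Re (c * zernike i j g))"
  using real_polynomial_zernike
  by (simp add: continuous_on_polymonial_function real_polynomial_function_eq)

text \<open>
  The real part of a polynomial is smooth, so the constant sequence witnesses membership in the closed
  sub-Laplacian.
\<close>

lemma generator_zernike:
  assumes "heat_semigroup P"
  shows "generator P (\<lambda>g. Re (c * zernike i j g)) (\<lambda>g. - real (eigval i j) * Re (c * zernike i j g))"
proof -
  let ?f = "\<lambda>g. Re (c * zernike i j g)"
  have L2: "?f \<in> L2" "(\<lambda>g. - real (eigval i j) * ?f g) \<in> L2"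
    by (intro continuous_imp_L2 continuous_intros continuous_on_zernike)+
  have "subLaplacian ?f g = - real (eigval i j) * ?f g" if "g \<in> SU2" for g
  proof -
    have "subLaplacian ?f g = Re (c * (- of_nat (eigval i j) * zernike i j g))"
      by (rule subLaplacian_Re[OF sub_lap_zernike that])
    then show ?thesis by (simp add: algebra_simps)
  qed
  note eig = this
  have "L2norm (\<lambda>g. subLaplacian ?f g - (- real (eigval i j) * ?f g)) = 0"
  proof -
    have "(\<integral>g. (subLaplacian ?f g - (- real (eigval i j) * ?f g))\<^sup>2 \<partial>haar) = (\<integral>g. 0 \<partial>haar)"
      by (intro Bochner_Integration.integral_cong refl) (simp only: space_haar eig, simp)
    then show ?thesis by (simp add: L2norm_def)
  qed
  then have "closed_subLaplacian ?f (\<lambda>g. - real (eigval i j) * ?f g)"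
    unfolding closed_subLaplacian_def L2_tendsto_def
    using L2 smooth_on_polynomial[OF real_polynomial_zernike]
    by (intro conjI exI[of _ "\<lambda>n. ?f"]) (auto simp: L2norm_def)
  with assms show ?thesis by (simp add: heat_semigroup_def)
qed

lemma kernel_monomial:
  assumes P: "heat_semigroup P" and p: "smooth_kernel P p" and "t > 0"
  shows "(\<integral>y. p t (mat 1) y * Re (c * disk_monomial m n y) \<partial>haar)
    = (\<Sum>s\<le>min m n. zernike_coeff m n s * exp (- real (eigval (m - s) (n - s)) * t)) * Re c"
proof -
  note pc = kernel_from_identity_continuous[OF p \<open>t > 0\<close>]
  have int: "integrable haar (\<lambda>y. p t (mat 1) y * Re (c * zernike i j y))" for i j
    by (intro haar_integrable_continuous continuous_on_mult pc continuous_on_zernike)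
  have eig: "(\<integral>y. p t (mat 1) y * Re (c * zernike i j y) \<partial>haar) = exp (- real (eigval i j) * t) * Re c" for i j
  proof -
    have "C0_semigroup P" using P by (simp add: heat_semigroup_def)
    from kernel_eigenfunction[OF this generator_zernike[OF P] p continuous_on_zernike \<open>t > 0\<close>] show ?thesis
      by (simp only: zernike_one mult_1_right)
  qed
  have "Re (c * disk_monomial m n y) = (\<Sum>s\<le>min m n. zernike_coeff m n s * Re (c * zernike (m - s) (n - s) y))" for y
    unfolding disk_monomial_expansion sum_distrib_left Re_sum
    by (intro sum.cong refl) (simp add: algebra_simps)
  then have "(\<integral>y. p t (mat 1) y * Re (c * disk_monomial m n y) \<partial>haar)
     = (\<integral>y. (\<Sum>s\<le>min m n. zernike_coeff m n s * (p t (mat 1) y * Re (c * zernike (m - s) (n - s) y))) \<partial>haar)"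
    by (simp add: sum_distrib_left mult_ac)
  also have "\<dots> = (\<Sum>s\<le>min m n. zernike_coeff m n s * (\<integral>y. p t (mat 1) y * Re (c * zernike (m - s) (n - s) y) \<partial>haar))"
    by (subst Bochner_Integration.integral_sum) (use int in auto)
  also have "\<dots> = (\<Sum>s\<le>min m n. zernike_coeff m n s * (exp (- real (eigval (m - s) (n - s)) * t) * Re c))"
    unfolding eig ..
  finally show ?thesis by (simp only: sum_distrib_right mult.assoc)
qed

section \<open>The spectral series on the circle\<close>

text \<open>
  Infinite sums are integrals with respect to the counting measure.
\<close>

lemma infsum_dominated_convergence:
  fixes f :: "nat \<Rightarrow> 'a \<Rightarrow> real"
  assumes g: "g summable_on A"
    and bound: "\<And>M x. x \<in> A \<Longrightarrow> \<bar>f M x\<bar> \<le> g x"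
    and lim: "\<And>x. x \<in> A \<Longrightarrow> (\<lambda>M. f M x) \<longlonglongrightarrow> h x"
  shows "(\<lambda>M. \<Sum>\<^sub>\<infinity>x\<in>A. f M x) \<longlonglongrightarrow> (\<Sum>\<^sub>\<infinity>x\<in>A. h x)"
proof -
  have h_bound: "\<bar>h x\<bar> \<le> g x" if "x \<in> A" for x
    using tendsto_rabs[OF lim[OF that]] by (rule LIMSEQ_le_const2) (use bound[OF that] in blast)
  have as_integral: "(\<Sum>\<^sub>\<infinity>x\<in>A. k x) = (\<integral>x. k x \<partial>count_space A)"
    if "\<And>x. x \<in> A \<Longrightarrow> \<bar>k x\<bar> \<le> g x" for k
  proof -
    have "(\<lambda>x. norm (k x)) summable_on A"
      by (rule Infinite_Sum.abs_summable_on_comparison_test'[OF g]) (use that in simp)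
    from infsetsum_infsum[OF abs_summable_equivalent[THEN iffD1, OF this]] show ?thesis
      by (simp add: infsetsum_def)
  qed
  have "integrable (count_space A) g"
    by (rule abs_summable_equivalent[THEN iffD1, OF summable_on_iff_abs_summable_on_real[THEN iffD1, OF g],
        unfolded Infinite_Set_Sum.abs_summable_on_def])
  then have "(\<lambda>M. \<integral>x. f M x \<partial>count_space A) \<longlonglongrightarrow> (\<integral>x. h x \<partial>count_space A)"
    by (intro integral_dominated_convergence[where w = g]) (use bound lim in \<open>auto intro!: AE_I2\<close>)
  then show ?thesis
    using as_integral[OF h_bound] as_integral[OF bound] by simp
qed

text \<open>
  The indices \<open>m = i + s\<close> and \<open>n = j + s\<close> both stay below \<open>M\<close> exactly if \<open>s < M - max i j\<close>.
\<close>

lemma sum_reindex_diagonals: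
  fixes h :: "nat \<Rightarrow> nat \<Rightarrow> nat \<Rightarrow> real"
  shows "(\<Sum>m<M. \<Sum>n<M. \<Sum>s\<le>min m n. h (m - s) (n - s) s) = (\<Sum>i<M. \<Sum>j<M. \<Sum>s<M - max i j. h i j s)"
proof -
  let ?S = "{..<M} \<times> {..<M}"
  have "(\<Sum>m<M. \<Sum>n<M. \<Sum>s\<le>min m n. h (m - s) (n - s) s)
     = (\<Sum>x\<in>?S. \<Sum>s\<le>min (fst x) (snd x). h (fst x - s) (snd x - s) s)"
    by (simp add: sum.cartesian_product split_beta)
  also have "\<dots> = (\<Sum>(x, s)\<in>(SIGMA x:?S. {..min (fst x) (snd x)}). h (fst x - s) (snd x - s) s)"
    by (rule sum.Sigma) auto
  also have "\<dots> = (\<Sum>(x, s)\<in>(SIGMA x:?S. {..<M - max (fst x) (snd x)}). h (fst x) (snd x) s)"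
    by (rule sum.reindex_bij_witness[of _ "\<lambda>(x, s). ((fst x + s, snd x + s), s)" "\<lambda>(x, s). ((fst x - s, snd x - s), s)"]) auto
  also have "\<dots> = (\<Sum>x\<in>?S. \<Sum>s<M - max (fst x) (snd x). h (fst x) (snd x) s)"
    by (rule sum.Sigma[symmetric]) auto
  also have "\<dots> = (\<Sum>i<M. \<Sum>j<M. \<Sum>s<M - max i j. h i j s)"
    by (simp add: sum.cartesian_product split_beta)
  finally show ?thesis .
qed

text \<open>
  The Zernike coefficient without its factor \<open>i + j + 1\<close>. As a function of \<open>s\<close> it behaves like
  \<open>1 / (s + 1)\<close>, the general term of the harmonic sums.
\<close>

definition fejer_weight :: "nat \<Rightarrow> nat \<Rightarrow> nat \<Rightarrow> real"
  where "fejer_weight i j s = fact (i + s) * fact (j + s) / (fact s * fact (i + j + s + 1))"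

lemma zernike_coeff_eq_weight: "zernike_coeff (i + s) (j + s) s = real (i + j + 1) * fejer_weight i j s"
proof -
  have "i + s + (j + s) + 1 - 2 * s = i + j + 1" "i + s + (j + s) + 1 - s = i + j + s + 1" by simp_all
  then show ?thesis
    unfolding zernike_coeff_def fejer_weight_def by (simp only: times_divide_eq_right mult.assoc)
qed

lemma fejer_weight_0: "fejer_weight i 0 s = 1 / real (i + s + 1)"
  by (simp add: fejer_weight_def)

lemma fejer_weight_Suc: "fejer_weight i (Suc j) s = fejer_weight i j s * (real (j + s + 1) / real (i + j + s + 2))"
proof -
  have "fact (Suc j + s) = real (j + s + 1) * fact (j + s)"
    "fact (i + Suc j + s + 1) = real (i + j + s + 2) * fact (i + j + s + 1)"
    by (simp_all add: algebra_simps)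
  moreover have "a * (b * c) / (d * (e * f)) = a * c / (d * f) * (b / e)" for a b c d e f :: real
    by (simp add: mult_ac)
  ultimately show ?thesis unfolding fejer_weight_def by simp
qed

lemma fejer_weight_nonneg: "fejer_weight i j s \<ge> 0"
  by (simp add: fejer_weight_def)

lemma fejer_weight_le: "fejer_weight i j s \<le> 1 / real (s + 1)"
proof (induction j)
  case 0
  show ?case unfolding fejer_weight_0 by (intro divide_left_mono) auto
next
  case (Suc j)
  have "fejer_weight i (Suc j) s \<le> fejer_weight i j s * 1"
    unfolding fejer_weight_Suc by (intro mult_left_mono fejer_weight_nonneg) simp
  with Suc show ?case by simp
qed

text \<open>
  Together with \<open>fejer_weight_le\<close> this determines the weight up to a summable error. The constant grows by
  \<open>i + 1\<close> with each step in \<open>j\<close>.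
\<close>

lemma fejer_weight_ge: "fejer_weight i j s \<ge> (1 - real (i + j * (i + 1)) / real (s + 1)) / real (s + 1)"
proof (induction j)
  case 0
  have "(1 - real i / real (s + 1)) / real (s + 1) \<le> 1 / real (i + s + 1)"
    by (simp add: divide_simps) (simp add: algebra_simps)
  then show ?case unfolding fejer_weight_0 by simp
next
  case (Suc j)
  have "(1 - real (i + Suc j * (i + 1)) / real (s + 1)) / real (s + 1)
      = (1 - real (i + j * (i + 1)) / real (s + 1)) / real (s + 1) - (real (i + 1) / real (s + 1)) * (1 / real (s + 1))"
  proof -
    have "(1 - (a + b) / c) / c = (1 - a / c) / c - (b / c) * (1 / c)" for a b c :: real
      by (simp add: diff_divide_distrib add_divide_distrib)
    moreover have "real (i + Suc j * (i + 1)) = real (i + j * (i + 1)) + real (i + 1)" by simp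
    ultimately show ?thesis by presburger
  qed
  also have "\<dots> \<le> fejer_weight i j s - (real (i + 1) / real (i + j + s + 2)) * fejer_weight i j s"
    by (intro diff_mono Suc mult_mono fejer_weight_le fejer_weight_nonneg divide_left_mono) auto
  also have "\<dots> = fejer_weight i (Suc j) s"
  proof -
    have "1 - real (i + 1) / real (i + j + s + 2) = real (j + s + 1) / real (i + j + s + 2)"
      by (simp add: field_simps)
    then show ?thesis unfolding fejer_weight_Suc by (metis mult.commute mult.right_neutral right_diff_distrib)
  qed
  finally show ?case .
qed

lemma harm_lessThan: "harm M = (\<Sum>s<M. 1 / real (s + 1))"
  unfolding harm_altdef by (intro sum.cong) (auto simp: field_simps)

lemma harm_diff_le: "harm M \<le> harm (M - k) + real k"
proof (induction M)
  case (Suc M)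
  show ?case
  proof (cases "Suc M \<le> k")
    case True
    have "harm (Suc M) = (\<Sum>s<Suc M. 1 / real (s + 1))" by (rule harm_lessThan)
    also have "\<dots> \<le> (\<Sum>s<Suc M. 1)" by (intro sum_mono) simp
    finally show ?thesis using True by (simp add: harm_expand)
  next
    case False
    then have eq: "Suc M - k = Suc (M - k)" by simp
    have "inverse (real (Suc M)) \<le> inverse (real (Suc (M - k)))" by (intro le_imp_inverse_le) auto
    with Suc show ?thesis unfolding eq harm_Suc by linarith
  qed
qed (simp add: harm_expand)

text \<open>
  The difference from the harmonic sum is bounded: cutting off \<open>k\<close> terms costs at most \<open>k\<close>, and the errors
  in \<open>fejer_weight_ge\<close> are summable.
\<close>

lemma fejer_weight_average:
  "(\<lambda>M. (\<Sum>s<M - k. fejer_weight i j s) / harm M) \<longlonglongrightarrow> 1"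
proof -
  define c where "c = real (i + j * (i + 1))"
  have "summable (\<lambda>s. inverse ((real (Suc s))\<^sup>2))"
    using inverse_squares_sums sums_summable by (simp add: inverse_eq_divide add.commute) blast
  then obtain B where B: "\<And>n. (\<Sum>s<n. inverse ((real (Suc s))\<^sup>2)) \<le> B"
    using sum_le_suminf[of "\<lambda>s. inverse ((real (Suc s))\<^sup>2)"] by (metis finite_lessThan inverse_nonnegative_iff_nonnegative zero_le_power2)
  have upper: "(\<Sum>s<M - k. fejer_weight i j s) \<le> harm M" for M
  proof -
    have "(\<Sum>s<M - k. fejer_weight i j s) \<le> (\<Sum>s<M - k. 1 / real (s + 1))"
      by (intro sum_mono fejer_weight_le)
    also have "\<dots> \<le> (\<Sum>s<M. 1 / real (s + 1))" by (intro sum_mono2) auto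
    finally show ?thesis by (simp only: harm_lessThan)
  qed
  have lower: "harm M - (real k + c * B) \<le> (\<Sum>s<M - k. fejer_weight i j s)" for M
  proof -
    have "harm M - (real k + c * B) \<le> harm (M - k) - c * (\<Sum>s<M - k. inverse ((real (Suc s))\<^sup>2))"
      using harm_diff_le[of M k] mult_left_mono[OF B[of "M - k"], of c] by (simp add: c_def)
    also have "\<dots> = (\<Sum>s<M - k. (1 - c / real (s + 1)) / real (s + 1))"
    proof -
      have "1 / x - c * inverse (x\<^sup>2) = (1 - c / x) / x" for x :: real
        by (simp add: divide_inverse power2_eq_square algebra_simps)
      then show ?thesis
        unfolding harm_lessThan sum_distrib_left sum_subtractf[symmetric] by simp
    qed
    also have "\<dots> \<le> (\<Sum>s<M - k. fejer_weight i j s)"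
      unfolding c_def by (intro sum_mono fejer_weight_ge)
    finally show ?thesis .
  qed
  have harm: "filterlim (\<lambda>M. harm M :: real) at_top sequentially" by (rule harm_at_top)
  have "(\<lambda>M. 1 - (real k + c * B) * inverse (harm M)) \<longlonglongrightarrow> 1 - (real k + c * B) * 0"
    by (intro tendsto_diff tendsto_mult tendsto_const tendsto_inverse_0_at_top[OF harm])
  then have low: "(\<lambda>M. 1 - (real k + c * B) * inverse (harm M)) \<longlonglongrightarrow> 1" by simp
  have pos: "eventually (\<lambda>M. harm M > (0::real)) sequentially"
    using harm by (rule filterlim_at_top_dense[THEN iffD1, rule_format])
  show ?thesis
  proof (rule tendsto_sandwich[OF _ _ low tendsto_const])
    show "eventually (\<lambda>M. 1 - (real k + c * B) * inverse (harm M) \<le> (\<Sum>s<M - k. fejer_weight i j s) / harm M) sequentially"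
      using pos
    proof eventually_elim
      case (elim M)
      have "x \<le> y / h" if "h > 0" "x * h \<le> y" for x y h :: real using that by (simp add: field_simps)
      moreover have "(1 - a * inverse h) * h = h - a" if "h > 0" for a h :: real using that by (simp add: field_simps)
      ultimately show ?case using elim lower[of M] by metis
    qed
    show "eventually (\<lambda>M. (\<Sum>s<M - k. fejer_weight i j s) / harm M \<le> 1) sequentially"
      using pos
    proof eventually_elim
      case (elim M)
      have "y / h \<le> 1" if "h > 0" "y \<le> h" for y h :: real using that by simp
      then show ?case using elim upper by blast
    qed
  qed
qed

lemma fejer_weight_average_bound: "\<bar>(\<Sum>s<M - k. fejer_weight i j s) / harm M\<bar> \<le> 1"
proof -
  have "(\<Sum>s<M - k. fejer_weight i j s) \<le> (\<Sum>s<M - k. 1 / real (s + 1))"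
    by (intro sum_mono fejer_weight_le)
  also have "\<dots> \<le> (\<Sum>s<M. 1 / real (s + 1))" by (intro sum_mono2) auto
  finally have 1: "(\<Sum>s<M - k. fejer_weight i j s) \<le> harm M" by (simp only: harm_lessThan)
  have 2: "0 \<le> (\<Sum>s<M - k. fejer_weight i j s)" by (intro sum_nonneg fejer_weight_nonneg)
  have "\<bar>y / h\<bar> \<le> 1" if "0 \<le> y" "y \<le> h" for y h :: real
    using that by (cases "h = 0") (auto simp: divide_simps)
  with 1 2 show ?thesis by blast
qed

text \<open>
  The contribution of the eigenfunction of index \<open>(i, j)\<close>, with \<open>i + j + 1\<close> the dimension of the
  irreducible representation to which it belongs.
\<close>

definition spectral_term :: "real \<Rightarrow> real \<Rightarrow> nat \<times> nat \<Rightarrow> real"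
  where "spectral_term t z = (\<lambda>(i, j). real (i + j + 1) * exp (- real (eigval i j) * t) * cos ((real i - real j) * z))"

lemma summable_linear_exp:
  assumes "t > 0"
  shows "(\<lambda>n::nat. (real n + 1) * exp (- t * real n)) summable_on UNIV"
proof -
  define r where "r = exp (- t)"
  have r: "0 < r" "r < 1" using assms by (auto simp: r_def)
  have "(\<lambda>n::nat. (real n + 1) * exp (- t * real n)) = (\<lambda>n. real (Suc n) * r ^ n)"
    by (simp add: r_def fun_eq_iff mult_ac flip: exp_of_nat_mult)
  moreover have "summable (\<lambda>n. real (Suc n) * r ^ n)"
    using geometric_deriv_sums[of r] r by (auto simp: sums_iff)
  ultimately show ?thesis
    using r by (subst summable_on_UNIV_nonneg_real_iff) auto
qed

lemma summable_on_product:
  fixes f g :: "'a \<Rightarrow> real"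
  assumes "f summable_on A" "g summable_on B" "\<And>x. x \<in> A \<Longrightarrow> f x \<ge> 0" "\<And>x. x \<in> B \<Longrightarrow> g x \<ge> 0"
  shows "(\<lambda>(x, y). f x * g y) summable_on A \<times> B"
proof (rule summable_on_SigmaI)
  show "((\<lambda>y. (\<lambda>(x, y). f x * g y) (x, y)) has_sum (f x * infsum g B)) B" for x
    using assms(2) by (simp add: has_sum_cmult_right)
  show "(\<lambda>x. f x * infsum g B) summable_on A"
    using assms(1) by (rule summable_on_cmult_left)
qed (use assms in auto)

lemma spectral_term_summable:
  assumes "t > 0"
  shows "spectral_term t z summable_on UNIV"
proof -
  have 1: "(\<lambda>(i, j). ((real i + 1) * exp (- (2 * t) * real i)) * ((real j + 1) * exp (- (2 * t) * real j))) summable_on UNIV \<times> UNIV"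
    using assms by (intro summable_on_product summable_linear_exp) auto
  have "(\<lambda>x. norm (spectral_term t z x)) summable_on UNIV \<times> UNIV"
  proof (rule Infinite_Sum.abs_summable_on_comparison_test'[OF 1])
    fix x :: "nat \<times> nat"
    obtain i j where x: "x = (i, j)" by (cases x)
    have "exp (- real (eigval i j) * t) \<le> exp (- (2 * t) * real i + - (2 * t) * real j)"
      using assms by (auto simp: eigval_def algebra_simps)
    also have "\<dots> = exp (- (2 * t) * real i) * exp (- (2 * t) * real j)" by (rule exp_add)
    finally have "norm (spectral_term t z x) \<le> ((real i + 1) * (real j + 1)) * (exp (- (2 * t) * real i) * exp (- (2 * t) * real j)) * 1"
      unfolding x spectral_term_def prod.case real_norm_def abs_mult
      by (intro mult_mono) (auto simp: algebra_simps)
    then show "norm (spectral_term t z x) \<le> (\<lambda>(i, j). ((real i + 1) * exp (- (2 * t) * real i)) * ((real j + 1) * exp (- (2 * t) * real j))) x"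
      by (simp add: x mult_ac)
  qed
  then show ?thesis unfolding UNIV_Times_UNIV by (rule summable_on_iff_abs_summable_on_real[THEN iffD2])
qed

text \<open>
  Collecting the expansions of the monomials in the Fejer kernel by eigenfunction: the monomials
  \<open>(i + s, j + s)\<close> are the ones in which the eigenfunction \<open>(i, j)\<close> occurs.
\<close>

lemma kernel_fejer_integral:
  assumes P: "heat_semigroup P" and p: "smooth_kernel P p" and "t > 0"
  shows "(\<integral>g. p t (mat 1) g * fejer M z g \<partial>haar)
    = (\<Sum>\<^sub>\<infinity>x. spectral_term t z x * ((\<Sum>s<M - max (fst x) (snd x). fejer_weight (fst x) (snd x) s)))"
proof -
  note pc = kernel_from_identity_continuous[OF p \<open>t > 0\<close>]
  have int: "integrable haar (\<lambda>g. p t (mat 1) g * Re (c * disk_monomial m n g))" for c m n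
    unfolding disk_monomial_def by (intro haar_integrable_continuous continuous_on_mult pc continuous_intros)
  have "(\<integral>g. p t (mat 1) g * fejer M z g \<partial>haar)
     = (\<integral>g. (\<Sum>m<M. \<Sum>n<M. p t (mat 1) g * Re (cis (of_int (int n - int m) * z) * disk_monomial m n g)) \<partial>haar)"
    unfolding fejer_expansion disk_monomial_def sum_distrib_left ..
  also have "\<dots> = (\<Sum>m<M. \<Sum>n<M. (\<integral>g. p t (mat 1) g * Re (cis (of_int (int n - int m) * z) * disk_monomial m n g) \<partial>haar))"
    by (subst Bochner_Integration.integral_sum, intro Bochner_Integration.integrable_sum int, intro sum.cong refl Bochner_Integration.integral_sum int)
  also have "\<dots> = (\<Sum>m<M. \<Sum>n<M. \<Sum>s\<le>min m n. (\<lambda>i j s. spectral_term t z (i, j) * fejer_weight i j s) (m - s) (n - s) s)"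
  proof (intro sum.cong refl)
    fix m n
    have cos: "Re (cis (of_int (int n - int m) * z)) = cos ((real m - real n) * z)"
    proof -
      have "of_int (int n - int m) * z = - ((real m - real n) * z)" by (simp add: algebra_simps)
      then show ?thesis by (simp only: cis.sel cos_minus)
    qed
    have summand: "zernike_coeff m n s * exp (- real (eigval (m - s) (n - s)) * t) * cos ((real m - real n) * z)
       = spectral_term t z (m - s, n - s) * fejer_weight (m - s) (n - s) s" if "s \<in> {..min m n}" for s
    proof -
      from that have "m = m - s + s" "n = n - s + s" by auto
      then have "zernike_coeff m n s = real (m - s + (n - s) + 1) * fejer_weight (m - s) (n - s) s"
        using zernike_coeff_eq_weight[of "m - s" s "n - s"] by simp
      moreover have "real m - real n = real (m - s) - real (n - s)" using that by auto
      ultimately show ?thesis by (simp add: spectral_term_def mult_ac)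
    qed
    show "(\<integral>g. p t (mat 1) g * Re (cis (of_int (int n - int m) * z) * disk_monomial m n g) \<partial>haar)
       = (\<Sum>s\<le>min m n. (\<lambda>i j s. spectral_term t z (i, j) * fejer_weight i j s) (m - s) (n - s) s)"
      unfolding kernel_monomial[OF assms] cos sum_distrib_right using summand by (intro sum.cong refl) blast
  qed
  also have "\<dots> = (\<Sum>i<M. \<Sum>j<M. \<Sum>s<M - max i j. spectral_term t z (i, j) * fejer_weight i j s)"
    by (rule sum_reindex_diagonals)
  also have "\<dots> = (\<Sum>x\<in>{..<M} \<times> {..<M}. spectral_term t z x * (\<Sum>s<M - max (fst x) (snd x). fejer_weight (fst x) (snd x) s))"
    by (simp add: sum.cartesian_product sum_distrib_left split_beta)
  also have "\<dots> = (\<Sum>\<^sub>\<infinity>x\<in>{..<M} \<times> {..<M}. spectral_term t z x * (\<Sum>s<M - max (fst x) (snd x). fejer_weight (fst x) (snd x) s))"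
    by (rule infsum_finite[symmetric]) auto
  also have "\<dots> = (\<Sum>\<^sub>\<infinity>x. spectral_term t z x * ((\<Sum>s<M - max (fst x) (snd x). fejer_weight (fst x) (snd x) s)))"
  proof (rule infsum_cong_neutral)
    fix x :: "nat \<times> nat" assume "x \<in> UNIV - {..<M} \<times> {..<M}"
    then have "M - max (fst x) (snd x) = 0" by (cases x) auto
    then show "spectral_term t z x * (\<Sum>s<M - max (fst x) (snd x). fejer_weight (fst x) (snd x) s) = 0" by simp
  qed auto
  finally show ?thesis .
qed

text \<open>
  The limit of the normalised integrals is computed twice: as a value of the kernel by \<open>fejer_concentration\<close>, and
  term by term, where the averaged weights are at most 1 and tend to 1.
\<close>

lemma kernel_spectral_expansion:
  assumes P: "heat_semigroup P" and p: "smooth_kernel P p" and "t > 0"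
  shows "p t (mat 1) (su2_mat (cis z) 0) = (\<Sum>\<^sub>\<infinity>x. spectral_term t z x)"
proof -
  note pc = kernel_from_identity_continuous[OF p \<open>t > 0\<close>]
  let ?w = "\<lambda>M x. (\<Sum>s<M - max (fst x) (snd x). fejer_weight (fst x) (snd x) s) / harm M"
  have "(\<integral>g. p t (mat 1) g * fejer M z g \<partial>haar) / harm M = (\<Sum>\<^sub>\<infinity>x. spectral_term t z x * ?w M x)" for M
    unfolding kernel_fejer_integral[OF assms]
    by (simp only: times_divide_eq_right divide_inverse mult.assoc[symmetric] infsum_cmult_left')
  with fejer_concentration[OF pc, of z]
  have "(\<lambda>M. \<Sum>\<^sub>\<infinity>x. spectral_term t z x * ?w M x) \<longlonglongrightarrow> p t (mat 1) (su2_mat (cis z) 0)" by simp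
  moreover have "(\<lambda>M. \<Sum>\<^sub>\<infinity>x. spectral_term t z x * ?w M x) \<longlonglongrightarrow> (\<Sum>\<^sub>\<infinity>x. spectral_term t z x)"
  proof (rule infsum_dominated_convergence)
    show "(\<lambda>x. norm (spectral_term t z x)) summable_on UNIV"
      by (rule summable_on_iff_abs_summable_on_real[THEN iffD1, OF spectral_term_summable[OF \<open>t > 0\<close>]])
    show "\<bar>spectral_term t z x * ?w M x\<bar> \<le> norm (spectral_term t z x)" for M x
      unfolding abs_mult real_norm_def by (intro mult_left_le fejer_weight_average_bound) simp
    show "(\<lambda>M. spectral_term t z x * ?w M x) \<longlonglongrightarrow> spectral_term t z x" for x
      using tendsto_mult_left[OF fejer_weight_average] by fastforce
  qed
  ultimately show ?thesis by (rule LIMSEQ_unique)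
qed

section \<open>The sum over odd integers by residues\<close>

lemma rectpath_integral_bound:
  assumes ab: "Re a \<le> Re b" "Im a \<le> Im b"
    and cont: "continuous_on (path_image (rectpath a b)) f"
    and B: "0 \<le> B" "0 \<le> B'"
    and hor: "\<And>x. Im x = Im a \<or> Im x = Im b \<Longrightarrow> Re a \<le> Re x \<Longrightarrow> Re x \<le> Re b \<Longrightarrow> norm (f x) \<le> B"
    and ver: "\<And>x. Re x = Re a \<or> Re x = Re b \<Longrightarrow> Im a \<le> Im x \<Longrightarrow> Im x \<le> Im b \<Longrightarrow> norm (f x) \<le> B'"
  shows "norm (contour_integral (rectpath a b) f) \<le> 2 * (B * (Re b - Re a)) + 2 * (B' * (Im b - Im a))"
proof -
  define c d where "c = Complex (Re b) (Im a)" and "d = Complex (Re a) (Im b)"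
  note cd = c_def d_def
  have path: "rectpath a b = linepath a c +++ linepath c b +++ linepath b d +++ linepath d a"
    by (simp add: rectpath_def cd Let_def)
  have im: "path_image (rectpath a b) = closed_segment a c \<union> closed_segment c b \<union> closed_segment b d \<union> closed_segment d a"
    unfolding path by (simp add: path_image_join Un_assoc)
  have seg: "closed_segment a c = {x. Im x = Im a \<and> Re x \<in> {Re a..Re b}}"
     "closed_segment b d = {x. Im x = Im b \<and> Re x \<in> {Re a..Re b}}"
     "closed_segment c b = {x. Re x = Re b \<and> Im x \<in> {Im a..Im b}}"
     "closed_segment d a = {x. Re x = Re a \<and> Im x \<in> {Im a..Im b}}"
    using ab by (auto simp: cd closed_segment_same_Im closed_segment_same_Re closed_segment_eq_real_ivl)
  have int: "f contour_integrable_on linepath a c" "f contour_integrable_on linepath c b"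
    "f contour_integrable_on linepath b d" "f contour_integrable_on linepath d a"
    by (intro contour_integrable_continuous_linepath continuous_on_subset[OF cont]; auto simp: im)+
  have split: "contour_integral (rectpath a b) f = contour_integral (linepath a c) f + (contour_integral (linepath c b) f
      + (contour_integral (linepath b d) f + contour_integral (linepath d a) f))"
    unfolding path using int by (simp add: contour_integrable_joinI)
  have "norm (contour_integral (rectpath a b) f) \<le> norm (contour_integral (linepath a c) f) + (norm (contour_integral (linepath c b) f)
      + (norm (contour_integral (linepath b d) f) + norm (contour_integral (linepath d a) f)))"
    unfolding split by (intro order.trans[OF norm_triangle_ineq] add_mono order.refl)
  also have "\<dots> \<le> B * norm (c - a) + (B' * norm (b - c) + (B * norm (d - b) + B' * norm (a - d)))"
    by (intro add_mono contour_integral_bound_linepath int B) (auto simp: seg intro!: hor ver)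
  finally have "norm (contour_integral (rectpath a b) f) \<le> B * norm (c - a) + (B' * norm (b - c) + (B * norm (d - b) + B' * norm (a - d)))" .
  moreover have "norm (c - a) = Re b - Re a" "norm (b - c) = Im b - Im a" "norm (d - b) = Re b - Re a" "norm (a - d) = Im b - Im a"
    using ab by (auto simp: cd cmod_def)
  ultimately show ?thesis by simp
qed

lemma norm_exp_i_times: "norm (exp (\<i> * of_real c * x)) = exp (- c * Im x)"
  by simp

lemma norm_sinh_ge: "norm (sinh (w::complex)) \<ge> sinh \<bar>Re w\<bar>"
proof -
  have "norm (exp w) - norm (exp (- w)) \<le> norm (exp w - exp (- w))" "norm (exp (- w)) - norm (exp w) \<le> norm (exp w - exp (- w))"
    by (rule norm_triangle_ineq2, metis norm_minus_commute norm_triangle_ineq2)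
  then have "exp \<bar>Re w\<bar> - exp (- \<bar>Re w\<bar>) \<le> norm (exp w - exp (- w))"
    by (auto simp: abs_if)
  then show ?thesis by (simp add: sinh_field_def norm_divide)
qed

text \<open>
  On these horizontal lines \<open>sinh\<close> is as large as \<open>cosh\<close> on the real line; they will carry the horizontal
  sides of the contours.
\<close>

lemma sinh_add_half_odd_pi: "sinh (complex_of_real a + \<i> * of_real (pi * (of_int l + 1/2))) = \<i> * (-1) powi l * of_real (cosh a)"
proof -
  have 1: "exp (\<i> * of_real (pi * (of_int l + 1/2))) = \<i> * (-1) powi l"
  proof -
    have "cis (pi * (of_int l + 1/2)) = cis (of_int l * pi) * cis (pi / 2)"
      unfolding cis_mult by (simp only: distrib_left mult.commute[of pi] mult_1_left times_divide_eq_left)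
    also have "cis (of_int l * pi) = (-1) powi l"
      by (metis cis_pi cis_power_int)
    finally have "cis (pi * (of_int l + 1/2)) = \<i> * (-1) powi l" by (simp add: mult.commute)
    then show ?thesis unfolding cis_conv_exp .
  qed
  have 2: "exp (- (\<i> * of_real (pi * (of_int l + 1/2)))) = - \<i> * (-1) powi l"
    unfolding exp_minus 1 by (simp add: power_int_minus[symmetric] power_int_minus_left)
  have "exp (complex_of_real a + \<i> * of_real (pi * (of_int l + 1/2))) = exp (of_real a) * (\<i> * (-1) powi l)"
    "exp (- (complex_of_real a + \<i> * of_real (pi * (of_int l + 1/2)))) = exp (- of_real a) * (- \<i> * (-1) powi l)"
    unfolding exp_add minus_add_distrib 1 2 by simp_all
  then show ?thesis
    by (simp add: sinh_field_def cosh_field_def exp_of_real[symmetric] field_simps)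
qed

lemma sinh_eq_0_iff: "sinh (w::complex) = 0 \<longleftrightarrow> (\<exists>l::int. w = \<i> * of_real (pi * of_int l))"
proof -
  have "sinh w = 0 \<longleftrightarrow> sin (\<i> * w) = 0" by (simp add: sinh_conv_sin)
  also have "\<dots> \<longleftrightarrow> (\<exists>l::int. \<i> * w = of_real (l * pi))" by (simp add: Complex_Transcendental.sin_eq_0)
  also have "\<dots> \<longleftrightarrow> (\<exists>l::int. w = \<i> * of_real (pi * of_int l))"
  proof (intro iffI; elim exE)
    fix l :: int assume "\<i> * w = of_real (l * pi)"
    then have "\<i> * (\<i> * w) = \<i> * of_real (l * pi)" by (rule arg_cong)
    then have "w = \<i> * of_real (pi * of_int (- l))"
      by (simp flip: mult.assoc) (metis minus_equation_iff minus_mult_commute mult.commute mult.left_commute)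
    then show "\<exists>l::int. w = \<i> * of_real (pi * of_int l)" by blast
  next
    fix l :: int assume "w = \<i> * of_real (pi * of_int l)"
    then have "\<i> * w = of_real (of_int (- l) * pi)" by (simp flip: mult.assoc)
    then show "\<exists>l::int. \<i> * w = of_real (l * pi)" by blast
  qed
  finally show ?thesis .
qed

lemma one_plus_exp_eq_0_iff:
  "1 + exp (\<i> * of_real pi * x) = 0 \<longleftrightarrow> (\<exists>m::int. x = of_int (2 * m + 1))"
proof -
  have "1 + exp (\<i> * of_real pi * x) = 0 \<longleftrightarrow> exp (\<i> * of_real pi * x) = exp (\<i> * of_real pi)"
    by (simp add: add_eq_0_iff eq_commute[of "exp _" "-1"] exp_pi_i')
  also have "\<dots> \<longleftrightarrow> (\<exists>m::int. \<i> * of_real pi * x = \<i> * of_real pi + (of_int (2 * m) * pi) * \<i>)"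
    by (rule exp_eq)
  also have "\<dots> \<longleftrightarrow> (\<exists>m::int. \<i> * of_real pi * x = \<i> * of_real pi * of_int (2 * m + 1))"
    by (simp add: algebra_simps)
  also have "\<dots> \<longleftrightarrow> (\<exists>m::int. x = of_int (2 * m + 1))"
    by (subst mult_cancel_left) simp
  finally show ?thesis .
qed

text \<open>
  The factor \<open>1 / (1 + exp (\<i> * pi * x))\<close> has simple poles at the odd integers. Away from them it decays in the lower
  half plane and is bounded in the upper one, where \<open>exp (\<i> * x * z / 2)\<close> decays; for \<open>0 < z < 2 * pi\<close> the product is small
  in both directions.
\<close>

definition contour_integrand :: "real \<Rightarrow> real \<Rightarrow> complex \<Rightarrow> complex"
  where "contour_integrand t z x = x * exp (\<i> * of_real (z / 2) * x) /
    (sinh (of_real t * x + \<i> * of_real (z / 2)) * (1 + exp (\<i> * of_real pi * x)))"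

lemma contour_integrand_holomorphic:
  assumes "\<And>x. x \<in> S \<Longrightarrow> sinh (of_real t * x + \<i> * of_real (z / 2)) * (1 + exp (\<i> * of_real pi * x)) \<noteq> 0"
  shows "contour_integrand t z holomorphic_on S"
  unfolding contour_integrand_def[abs_def] sinh_field_def using assms
  by (intro holomorphic_intros) (auto simp: sinh_field_def)

text \<open>
  The zeros of \<open>sinh (t * x + \<i> * z / 2)\<close> are \<open>\<i>\<close> times these numbers.
\<close>

definition dual_pole :: "real \<Rightarrow> real \<Rightarrow> int \<Rightarrow> real"
  where "dual_pole t z l = (pi * of_int l - z / 2) / t"

lemma sinh_zero_at_dual_pole:
  assumes "t > 0"
  shows "sinh (of_real t * x + \<i> * of_real (z / 2)) = 0 \<longleftrightarrow> (\<exists>l. x = \<i> * of_real (dual_pole t z l))"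
proof -
  have "of_real t * x + \<i> * of_real (z / 2) = \<i> * of_real (pi * of_int l) \<longleftrightarrow> x = \<i> * of_real (dual_pole t z l)" for l
    using assms by (auto simp: dual_pole_def field_simps)
  then show ?thesis unfolding sinh_eq_0_iff by simp
qed

lemma residue_at_odd_integer:
  assumes "t > 0" "odd m"
  shows "residue (contour_integrand t z) (of_int m) = \<i> / pi *
    (of_int m * exp (\<i> * of_real (z / 2) * of_int m) / sinh (of_real t * of_int m + \<i> * of_real (z / 2)))"
proof -
  let ?d = "\<lambda>x. sinh (of_real t * x + \<i> * of_real (z / 2)) * (1 + exp (\<i> * of_real pi * x))"
  have m: "m \<noteq> 0" using assms(2) by auto
  have e: "exp (\<i> * of_real pi * of_int m) = -1"
    using one_plus_exp_eq_0_iff[of "of_int m"] assms(2) by (auto elim!: oddE simp: add_eq_0_iff)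
  have s: "sinh (of_real t * of_int m + \<i> * of_real (z / 2)) \<noteq> 0"
  proof
    assume "sinh (of_real t * of_int m + \<i> * of_real (z / 2)) = 0"
    then obtain l where "complex_of_int m = \<i> * of_real (dual_pole t z l)"
      unfolding sinh_zero_at_dual_pole[OF assms(1)] ..
    then have "Re (complex_of_int m) = Re (\<i> * of_real (dual_pole t z l))" by (rule arg_cong)
    with m show False by simp
  qed
  have der: "(?d has_field_derivative - (\<i> * of_real pi * sinh (of_real t * of_int m + \<i> * of_real (z / 2)))) (at (of_int m))"
    by (auto intro!: derivative_eq_intros simp: e)
  have "residue (\<lambda>w. w * exp (\<i> * of_real (z / 2) * w) / ?d w) (of_int m) =
     of_int m * exp (\<i> * of_real (z / 2) * of_int m) / - (\<i> * of_real pi * sinh (of_real t * of_int m + \<i> * of_real (z / 2)))"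
    by (rule residue_simple_pole_deriv[where s = UNIV, OF _ _ _ _ _ der])
       (use m s e in \<open>auto simp: sinh_field_def intro!: holomorphic_intros\<close>)
  also have "\<dots> = \<i> / pi * (of_int m * exp (\<i> * of_real (z / 2) * of_int m) / sinh (of_real t * of_int m + \<i> * of_real (z / 2)))"
  proof -
    have "a / - (\<i> * of_real pi * b) = \<i> / pi * (a / b)" for a b :: complex
      by (simp add: divide_simps)
    then show ?thesis .
  qed
  finally show ?thesis unfolding contour_integrand_def[abs_def] .
qed

lemma residue_at_dual_pole:
  assumes "t > 0" "0 < z" "z < pi"
  shows "residue (contour_integrand t z) (\<i> * of_real (dual_pole t z l)) = \<i> * of_real ((-1) powi l *
    dual_pole t z l * exp (- (z / 2) * dual_pole t z l) / (t * (1 + exp (- pi * dual_pole t z l))))"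
proof -
  define b where "b = dual_pole t z l"
  let ?x = "\<i> * complex_of_real b"
  let ?d = "\<lambda>x. sinh (of_real t * x + \<i> * of_real (z / 2)) * (1 + exp (\<i> * of_real pi * x))"
  have arg: "of_real t * ?x + \<i> * of_real (z / 2) = \<i> * of_real (pi * of_int l)"
    using assms(1) by (simp add: b_def dual_pole_def field_simps)
  have b: "b \<noteq> 0"
  proof
    assume "b = 0"
    then have eq: "of_int l = (z / 2) / pi" using assms(1) by (auto simp: b_def dual_pole_def field_simps)
    have "0 < (z / 2) / pi" "(z / 2) / pi < 1" using assms by (auto simp: divide_less_eq)
    then have "0 < l" "l < 1" unfolding eq[symmetric] by simp_all
    then show False by simp
  qed
  have cosh: "cosh (of_real t * ?x + \<i> * of_real (z / 2)) = of_real ((-1) powi l)"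
  proof -
    have "cosh (\<i> * of_real (pi * of_int l)) = cos (- of_real (pi * of_int l))"
      unfolding cosh_conv_cos by (simp flip: mult.assoc)
    also have "\<dots> = of_real (cos (pi * of_int l))" by (simp only: cos_minus cos_of_real)
    also have "cos (pi * of_int l) = (-1) powi l"
      by (simp add: power_int_minus_left)
    finally show ?thesis unfolding arg .
  qed
  have sinh: "sinh (of_real t * ?x + \<i> * of_real (z / 2)) = 0"
    unfolding sinh_zero_at_dual_pole[OF assms(1)] b_def by blast
  have expr: "exp (\<i> * of_real c * ?x) = of_real (exp (- c * b))" for c :: real
  proof -
    have "\<i> * of_real c * ?x = of_real (- c * b)" by (simp add: complex_eq_iff)
    then show ?thesis by (simp only: exp_of_real)
  qed
  have nz: "1 + exp (- pi * b) > 0" by (simp add: add_pos_pos)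
  have p1: "(-1::real) powi l \<noteq> 0" by simp
  have der: "(?d has_field_derivative of_real (t * (-1) powi l * (1 + exp (- pi * b)))) (at ?x)"
    by (rule derivative_eq_intros refl | unfold sinh cosh expr)+ simp
  have "residue (\<lambda>w. w * exp (\<i> * of_real (z / 2) * w) / ?d w) ?x =
     ?x * exp (\<i> * of_real (z / 2) * ?x) / of_real (t * (-1) powi l * (1 + exp (- pi * b)))"
    by (rule residue_simple_pole_deriv[where s = UNIV, OF _ _ _ _ _ der])
       (use b p1 nz sinh assms(1) in \<open>auto simp: sinh_field_def simp del: of_real_mult of_real_add intro!: holomorphic_intros\<close>)
  also have "\<dots> = \<i> * of_real (b * exp (- (z / 2) * b) / (t * (-1) powi l * (1 + exp (- pi * b))))"
    unfolding expr by simp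
  also have "b * exp (- (z / 2) * b) / (t * (-1) powi l * (1 + exp (- pi * b)))
     = (-1) powi l * b * exp (- (z / 2) * b) / (t * (1 + exp (- pi * b)))"
  proof -
    have "(-1::real) powi l * (-1) powi l = 1" by (simp add: power_int_mult_distrib[symmetric])
    then show ?thesis using p1 by (simp add: divide_simps)
  qed
  finally show ?thesis unfolding contour_integrand_def[abs_def] b_def .
qed

text \<open>
  Twice this real part is the joint contribution of \<open>2 i + 1\<close> and its negative, whose terms are complex conjugates.
\<close>

definition odd_term :: "real \<Rightarrow> real \<Rightarrow> nat \<Rightarrow> real"
  where "odd_term t z i = Re (of_real (2 * real i + 1) * exp (\<i> * of_real (z / 2) * of_real (2 * real i + 1)) /
     sinh (of_real t * of_real (2 * real i + 1) + \<i> * of_real (z / 2)))"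

definition dual_term :: "real \<Rightarrow> real \<Rightarrow> int \<Rightarrow> real"
  where "dual_term t z l = (-1) powi l * dual_pole t z l * exp (- (z / 2) * dual_pole t z l) /
     (t * (1 + exp (- pi * dual_pole t z l)))"

lemma residue_odd_pair:
  assumes "t > 0"
  shows "residue (contour_integrand t z) (of_int (2 * int i + 1)) + residue (contour_integrand t z) (of_int (- (2 * int i + 1)))
    = \<i> * of_real (2 / pi * odd_term t z i)"
proof -
  define a where "a = 2 * real i + 1"
  define w where "w = complex_of_real a * exp (\<i> * of_real (z / 2) * of_real a) / sinh (of_real t * of_real a + \<i> * of_real (z / 2))"
  have exp_cnj': "exp (\<i> * of_real (z / 2) * of_real (- a)) = cnj (exp (\<i> * of_real (z / 2) * of_real a))"
    by (simp add: exp_cnj)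
  have "sinh (of_real t * of_real (- a) + \<i> * of_real (z / 2)) = - cnj (sinh (of_real t * of_real a + \<i> * of_real (z / 2)))"
  proof -
    have "of_real t * of_real (- a) + \<i> * of_real (z / 2) = - cnj (of_real t * of_real a + \<i> * of_real (z / 2))"
      by (simp add: complex_eq_iff)
    moreover have "sinh (cnj u) = cnj (sinh u)" for u
      by (simp add: sinh_field_def exp_cnj)
    ultimately show ?thesis by (simp only: sinh_minus)
  qed
  then have "complex_of_real (- a) * exp (\<i> * of_real (z / 2) * of_real (- a)) / sinh (of_real t * of_real (- a) + \<i> * of_real (z / 2)) = cnj w"
    unfolding exp_cnj' w_def by simp
  then have w': "complex_of_real (- a) * exp (\<i> * of_real (z / 2) * of_real (- a)) / sinh (of_real t * of_real (- a) + \<i> * of_real (z / 2)) = cnj w" .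
  have a: "of_int (2 * int i + 1) = complex_of_real a" "of_int (- (2 * int i + 1)) = complex_of_real (- a)"
    by (simp_all add: a_def)
  have odd: "odd (2 * int i + 1)" "odd (- (2 * int i + 1))" by simp_all
  have "residue (contour_integrand t z) (of_int (2 * int i + 1)) = \<i> / pi * w"
    "residue (contour_integrand t z) (of_int (- (2 * int i + 1))) = \<i> / pi * cnj w"
    using residue_at_odd_integer[OF assms odd(1), of z] residue_at_odd_integer[OF assms odd(2), of z]
    unfolding a w' by (simp_all only: w_def)
  then have "residue (contour_integrand t z) (of_int (2 * int i + 1)) + residue (contour_integrand t z) (of_int (- (2 * int i + 1)))
     = \<i> / pi * w + \<i> / pi * cnj w"
    by (simp only:)
  also have "\<dots> = \<i> / pi * (w + cnj w)" by (simp only: distrib_left)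
  also have "\<dots> = \<i> * of_real (2 / pi * Re w)" by (simp add: complex_add_cnj)
  finally show ?thesis by (simp add: odd_term_def w_def a_def)
qed

text \<open>
  On the vertical sides the real part is an even integer, where \<open>exp (\<i> * pi * x)\<close> is positive, so that
  \<open>1 + exp (\<i> * pi * x)\<close> is not small.
\<close>

lemma contour_integrand_bound_vertical:
  assumes "t > 0" "0 < z" "z < pi" "N > 0" "\<bar>Re x\<bar> = 2 * real N" "\<bar>Im x\<bar> \<le> Y"
  shows "norm (contour_integrand t z x) \<le> (2 * real N + Y) / sinh (2 * real N * t)"
proof -
  have nx: "norm x \<le> 2 * real N + Y"
    using cmod_le[of x] assms(5,6) by simp
  have e1: "exp (\<i> * of_real pi * x) = of_real (exp (- pi * Im x))"
  proof -
    have "Re x = 2 * real N \<or> Re x = - (2 * real N)" using assms(5) by auto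
    then have c: "cis (pi * Re x) = 1"
    proof
      assume "Re x = 2 * real N"
      then have "pi * Re x = 2 * pi * real N" by simp
      then show ?thesis by (metis cis_multiple_2pi Ints_of_nat)
    next
      assume "Re x = - (2 * real N)"
      then have "pi * Re x = 2 * pi * (- real N)" by simp
      then show ?thesis by (metis cis_multiple_2pi Ints_of_nat Ints_minus)
    qed
    have "\<i> * of_real pi * x = of_real (- pi * Im x) + \<i> * of_real (pi * Re x)" by (simp add: complex_eq_iff)
    then have "exp (\<i> * of_real pi * x) = exp (of_real (- pi * Im x)) * cis (pi * Re x)"
      by (simp only: exp_add cis_conv_exp)
    then show ?thesis unfolding c by (simp only: exp_of_real mult_1_right)
  qed
  have d1: "norm (1 + exp (\<i> * of_real pi * x)) = 1 + exp (- pi * Im x)"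
  proof -
    have "1 + exp (\<i> * of_real pi * x) = of_real (1 + exp (- pi * Im x))" unfolding e1 by simp
    then show ?thesis by (simp only: norm_of_real) (simp add: add_nonneg_nonneg)
  qed
  have d2: "norm (sinh (of_real t * x + \<i> * of_real (z / 2))) \<ge> sinh (2 * real N * t)"
  proof -
    have "\<bar>Re (of_real t * x + \<i> * of_real (z / 2))\<bar> = 2 * real N * t"
      using assms(1,5) by (simp add: abs_mult)
    then show ?thesis using norm_sinh_ge[of "of_real t * x + \<i> * of_real (z / 2)"] by simp
  qed
  have s0: "sinh (2 * real N * t) > 0" using assms by simp
  have le: "exp (- (z / 2) * Im x) \<le> 1 + exp (- pi * Im x)"
  proof (cases "Im x \<ge> 0")
    case True
    then have "exp (- (z / 2) * Im x) \<le> 1" using assms(2) by simp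
    then show ?thesis by (simp add: add_increasing2)
  next
    case False
    then have "pi * Im x \<le> (z / 2) * Im x" using assms(2,3) by (intro mult_right_mono_neg) auto
    then have "exp (- (z / 2) * Im x) \<le> exp (- pi * Im x)" by simp
    then show ?thesis by linarith
  qed
  have "norm (contour_integrand t z x) = norm x * (exp (- (z / 2) * Im x) / (1 + exp (- pi * Im x))) / norm (sinh (of_real t * x + \<i> * of_real (z / 2)))"
    unfolding contour_integrand_def norm_divide norm_mult norm_exp_i_times d1 by simp
  also have "\<dots> \<le> (2 * real N + Y) * 1 / sinh (2 * real N * t)"
    using nx d2 s0 le by (intro frac_le mult_mono) (auto simp: divide_simps add_pos_pos intro: order.trans[OF norm_ge_zero])
  finally show ?thesis by simp
qed

text \<open>
  In the lower half plane \<open>1 + exp (\<i> * pi * x)\<close> grows like \<open>exp (pi * \<bar>Im x\<bar>)\<close> and beats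
  \<open>exp (\<bar>Im x\<bar> * z / 2)\<close>. Since \<open>pi - z / 2 > z / 2\<close>, the rate of decay \<open>z / 2\<close> holds in both half
  planes.
\<close>

lemma contour_integrand_bound_horizontal:
  assumes "t > 0" "0 < z" "z < pi" "\<bar>Re x\<bar> \<le> X" "\<bar>Im x\<bar> \<le> Y"
    and im: "t * Im x + z / 2 = pi * (of_int l + 1 / 2)" and y: "1 \<le> y" "y \<le> \<bar>Im x\<bar>"
  shows "norm (contour_integrand t z x) \<le> 2 * (X + Y) * exp (- (y * z / 2))"
proof -
  have nx: "norm x \<le> X + Y"
    using cmod_le[of x] assms(4,5) by simp
  have "of_real t * x + \<i> * of_real (z / 2) = of_real (t * Re x) + \<i> * of_real (pi * (of_int l + 1/2))"
    using im by (simp add: complex_eq_iff)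
  then have "sinh (of_real t * x + \<i> * of_real (z / 2)) = \<i> * (-1) powi l * of_real (cosh (t * Re x))"
    by (simp only: sinh_add_half_odd_pi)
  then have "norm (sinh (of_real t * x + \<i> * of_real (z / 2))) = cosh (t * Re x)"
    by (simp add: norm_mult norm_power_int del: of_real_mult)
  then have d1: "norm (sinh (of_real t * x + \<i> * of_real (z / 2))) \<ge> 1" by (simp add: cosh_real_ge_1)
  have e3: "exp (-pi) \<le> 1 / 2"
  proof -
    have "2 \<le> exp pi" using exp_ge_add_one_self[of pi] pi_gt3 by linarith
    then show ?thesis by (simp add: exp_minus field_simps)
  qed
  have n: "norm (exp (\<i> * of_real pi * x)) = exp (- pi * Im x)" by (rule norm_exp_i_times)
  have d2: "exp (- (z / 2) * Im x) \<le> 2 * exp (- (y * z / 2)) * norm (1 + exp (\<i> * of_real pi * x))"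
  proof (cases "Im x \<ge> 0")
    case True
    with y have yx: "y \<le> Im x" "1 \<le> Im x" by auto
    then have "exp (- pi * Im x) \<le> exp (- pi)" by simp
    then have "norm (1 + exp (\<i> * of_real pi * x)) \<ge> 1 / 2"
    proof -
      have "1 - exp (- pi * Im x) \<le> norm (1 + exp (\<i> * of_real pi * x))"
        using norm_triangle_ineq2[of 1 "- exp (\<i> * of_real pi * x)"] n by simp
      with \<open>exp (- pi * Im x) \<le> exp (- pi)\<close> e3 show ?thesis by linarith
    qed
    then have low: "1 \<le> 2 * norm (1 + exp (\<i> * of_real pi * x))" by simp
    have "exp (- (z / 2) * Im x) \<le> exp (- (y * z / 2)) * 1"
      using yx(1) assms(2) by (simp add: mult.commute)
    also have "\<dots> \<le> exp (- (y * z / 2)) * (2 * norm (1 + exp (\<i> * of_real pi * x)))"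
      using low by (intro mult_left_mono) auto
    finally show ?thesis by (simp only: mult_ac)
  next
    case False
    with y have yx: "y \<le> - Im x" "1 \<le> - Im x" by auto
    define v where "v = - Im x"
    have v: "y \<le> v" "1 \<le> v" "Im x = - v" using yx by (auto simp: v_def)
    have "1 \<le> exp (pi * v) / 2"
    proof -
      have "2 \<le> exp pi" using exp_ge_add_one_self[of pi] pi_gt3 by linarith
      also have "\<dots> \<le> exp (pi * v)" using v by simp
      finally show ?thesis by simp
    qed
    then have low: "norm (1 + exp (\<i> * of_real pi * x)) \<ge> exp (pi * v) / 2"
      using norm_triangle_ineq2[of "exp (\<i> * of_real pi * x)" "-1"] n by (simp add: v add.commute)
    have "exp (z / 2 * v) = exp (- (v * (pi - z / 2))) * exp (pi * v)"
      by (simp add: exp_add[symmetric] algebra_simps)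
    also have "\<dots> \<le> exp (- (y * z / 2)) * exp (pi * v)"
    proof -
      have "y * (z / 2) \<le> v * (pi - z / 2)" using v assms y by (intro mult_mono) auto
      then show ?thesis by simp
    qed
    also have "\<dots> \<le> exp (- (y * z / 2)) * (2 * norm (1 + exp (\<i> * of_real pi * x)))"
      using low by (intro mult_left_mono) auto
    finally show ?thesis by (simp add: v mult_ac)
  qed
  have "norm (1 + exp (\<i> * of_real pi * x)) \<noteq> 0"
  proof
    assume "norm (1 + exp (\<i> * of_real pi * x)) = 0"
    with d2 show False by (simp add: not_le[symmetric])
  qed
  then have d3: "exp (- (z / 2) * Im x) / norm (1 + exp (\<i> * of_real pi * x)) \<le> 2 * exp (- (y * z / 2))"
    using d2 by (simp add: divide_le_eq)
  have "norm (contour_integrand t z x) = norm x * (exp (- (z / 2) * Im x) / norm (1 + exp (\<i> * of_real pi * x)))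
      / norm (sinh (of_real t * x + \<i> * of_real (z / 2)))"
    unfolding contour_integrand_def norm_divide norm_mult norm_exp_i_times by simp
  also have "\<dots> \<le> (X + Y) * (2 * exp (- (y * z / 2))) / 1"
    using nx order.trans[OF norm_ge_zero nx] d1 d3 by (intro frac_le mult_mono) (auto intro: order.trans[OF norm_ge_zero])
  finally show ?thesis by (simp add: algebra_simps)
qed

definition rect_top :: "real \<Rightarrow> real \<Rightarrow> nat \<Rightarrow> real"
  where "rect_top t z N = (pi * (real N + 1 / 2) - z / 2) / t"

definition rect_bottom :: "real \<Rightarrow> real \<Rightarrow> nat \<Rightarrow> real"
  where "rect_bottom t z N = (pi * (real N + 1 / 2) + z / 2) / t"

text \<open>
  The vertical sides pass through even integers and the horizontal ones halfway between consecutive zeros of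
  \<open>sinh\<close>.
\<close>

definition pole_rect :: "real \<Rightarrow> real \<Rightarrow> nat \<Rightarrow> real \<Rightarrow> complex"
  where "pole_rect t z N = rectpath (Complex (- (2 * real N)) (- rect_bottom t z N))
    (Complex (2 * real N) (rect_top t z N))"

lemma rect_bounds:
  assumes "t > 0" "0 < z" "z < pi"
  shows "0 < rect_top t z N" "rect_top t z N \<le> rect_bottom t z N"
proof -
  have "z / 2 < pi * (real N + 1 / 2)"
  proof -
    have "pi * (1 / 2) \<le> pi * (real N + 1 / 2)" by (intro mult_left_mono) auto
    with assms show ?thesis by linarith
  qed
  then show "0 < rect_top t z N" using assms by (simp add: rect_top_def)
  show "rect_top t z N \<le> rect_bottom t z N"
    using assms by (simp add: rect_top_def rect_bottom_def divide_right_mono)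
qed

definition residue_sum :: "real \<Rightarrow> real \<Rightarrow> nat \<Rightarrow> real"
  where "residue_sum t z N =
    2 / pi * (\<Sum>i<N. odd_term t z i) + (\<Sum>l\<in>{- int N..int N}. dual_term t z l)"

text \<open>
  The residue theorem is applied in the slightly larger open rectangle between \<open>a'\<close> and \<open>b'\<close>, which contains no
  further poles.
\<close>

lemma contour_residues:
  assumes t: "t > 0" and z: "0 < z" "z < pi" and N: "N > 0"
  shows "continuous_on (path_image (pole_rect t z N)) (contour_integrand t z)"
    and "contour_integral (pole_rect t z N) (contour_integrand t z) = - (2 * pi * residue_sum t z N)"
proof -
  define y Y where "y = rect_top t z N" and "Y = rect_bottom t z N"
  note y_def = y_def[unfolded rect_top_def] and Y_def = Y_def[unfolded rect_bottom_def]
  define a b where "a = Complex (- (2 * real N)) (- Y)" and "b = Complex (2 * real N) y"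
  have rect: "pole_rect t z N = rectpath a b"
    by (simp add: pole_rect_def a_def b_def y_def Y_def rect_top_def rect_bottom_def)
  define a' b' where "a' = Complex (- (2 * real N + 1)) ((- (pi * (real N + 1)) - z / 2) / t)"
    and "b' = Complex (2 * real N + 1) ((pi * (real N + 1) - z / 2) / t)"
  define odds where "odds = (\<lambda>i. complex_of_int (2 * int i + 1)) ` {..<N} \<union> (\<lambda>i. complex_of_int (- (2 * int i + 1))) ` {..<N}"
  define duals where "duals = (\<lambda>l. \<i> * complex_of_real (dual_pole t z l)) ` {- int N..int N}"
  let ?D = "\<lambda>x. sinh (of_real t * x + \<i> * of_real (z / 2)) * (1 + exp (\<i> * of_real pi * x))"
  let ?R = "residue (contour_integrand t z)"
  have yY: "0 < y" "y \<le> Y"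
    using rect_bounds[OF t z, of N] by (simp_all add: y_def Y_def rect_top_def rect_bottom_def)
  have negY: "- Y = (- (pi * (real N + 1 / 2)) - z / 2) / t"
  proof -
    have "- ((u + v) / t) = (- u - v) / t" for u v :: real
      by (simp add: diff_divide_distrib add_divide_distrib)
    then show ?thesis unfolding Y_def .
  qed
  have zeros: "x \<in> odds \<union> duals" if "x \<in> box a' b'" "?D x = 0" for x
  proof -
    from that(2) consider l where "x = \<i> * of_real (dual_pole t z l)" | m where "x = of_int (2 * m + 1)"
      unfolding mult_eq_0_iff sinh_zero_at_dual_pole[OF t] one_plus_exp_eq_0_iff by blast
    then show ?thesis
    proof cases
      case 1
      with that(1) have "- (pi * (real N + 1)) < pi * of_int l" "pi * of_int l < pi * (real N + 1)"
        using t by (auto simp: a'_def b'_def in_box_complex_iff dual_pole_def divide_less_cancel)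
      then have "pi * of_int (- int N - 1) < pi * of_int l" "pi * of_int l < pi * of_int (int N + 1)"
        by (simp_all add: algebra_simps)
      then have "- int N - 1 < l" "l < int N + 1"
        unfolding mult_less_cancel_left_pos[OF pi_gt_zero] of_int_less_iff by auto
      then show ?thesis using 1 by (auto simp: duals_def)
    next
      case 2
      with that(1) have "\<bar>real_of_int (2 * m + 1)\<bar> < 2 * real N + 1"
        by (auto simp: a'_def b'_def in_box_complex_iff)
      then have m: "\<bar>2 * m + 1\<bar> < 2 * int N + 1" by linarith
      show ?thesis
      proof (cases "m \<ge> 0")
        case True
        with m 2 show ?thesis unfolding odds_def
          by (intro UnI1 image_eqI[of _ _ "nat m"]) auto
      next
        case False
        with m 2 show ?thesis unfolding odds_def
          by (intro UnI1 UnI2 image_eqI[of _ _ "nat (- m - 1)"]) auto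
      qed
    qed
  qed
  have inbox: "odds \<union> duals \<subseteq> box a b"
  proof -
    have "complex_of_int (2 * int i + 1) \<in> box a b" "complex_of_int (- (2 * int i + 1)) \<in> box a b" if "i < N" for i
      using that yY by (auto simp: a_def b_def in_box_complex_iff)
    moreover have "\<i> * complex_of_real (dual_pole t z l) \<in> box a b" if "l \<in> {- int N..int N}" for l
    proof -
      from that have "- int N \<le> l" "l \<le> int N" by auto
      then have "- (real N + 1 / 2) < of_int l" "of_int l < real N + 1 / 2" by linarith+
      then have "pi * - (real N + 1 / 2) < pi * of_int l" "pi * of_int l < pi * (real N + 1 / 2)"
        unfolding mult_less_cancel_left_pos[OF pi_gt_zero] by simp_all
      then have 1: "- (pi * (real N + 1 / 2)) < pi * of_int l" and 2: "pi * of_int l < pi * (real N + 1 / 2)"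
        by (simp_all only: mult_minus_right)
      have "(- (pi * (real N + 1 / 2)) - z / 2) / t < (pi * of_int l - z / 2) / t"
         "(pi * of_int l - z / 2) / t < (pi * (real N + 1 / 2) - z / 2) / t"
        by (rule divide_strict_right_mono[OF diff_strict_right_mono[OF 1] t]
             divide_strict_right_mono[OF diff_strict_right_mono[OF 2] t])+
      with negY show ?thesis using N by (simp add: a_def b_def in_box_complex_iff dual_pole_def y_def)
    qed
    ultimately show ?thesis unfolding odds_def duals_def by blast
  qed
  have fin: "finite (odds \<union> duals)" by (simp add: odds_def duals_def)
  have order: "Re a < Re b" "Im a < Im b"
    using N yY by (auto simp: a_def b_def)
  have sub: "cbox a b \<subseteq> box a' b'"
  proof -
    have "(- (pi * (real N + 1)) - z / 2) / t < - Y"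
      unfolding negY by (intro divide_strict_right_mono t) simp
    moreover have "y < (pi * (real N + 1) - z / 2) / t"
      unfolding y_def by (intro divide_strict_right_mono t) simp
    ultimately show ?thesis by (auto simp: a_def b_def a'_def b'_def in_box_complex_iff in_cbox_complex_iff)
  qed
  have image: "path_image (rectpath a b) \<subseteq> box a' b' - (odds \<union> duals)"
  proof (intro subsetI DiffI notI)
    fix x assume x: "x \<in> path_image (rectpath a b)"
    then have "x \<in> cbox a b"
      using path_image_rectpath_subset_cbox[of a b] order by (meson less_imp_le subsetD)
    with sub show "x \<in> box a' b'" by (rule subsetD)
    assume "x \<in> odds \<union> duals"
    with inbox have "x \<in> box a b" by (rule subsetD)
    with x path_image_rectpath_inter_box[of a b] order show False
      by (metis IntI empty_iff less_imp_le)
  qed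
  have holo: "contour_integrand t z holomorphic_on box a' b' - (odds \<union> duals)"
    by (rule contour_integrand_holomorphic) (use zeros in blast)
  have "contour_integral (rectpath a b) (contour_integrand t z) = 2 * pi * \<i> * (\<Sum>p\<in>odds \<union> duals. winding_number (rectpath a b) p * ?R p)"
  proof (rule Residue_theorem[OF _ _ fin holo])
    show "\<forall>x. x \<notin> box a' b' \<longrightarrow> winding_number (rectpath a b) x = 0"
      using sub order by (intro allI impI winding_number_rectpath_outside) auto
  qed (use image in \<open>auto intro: convex_connected\<close>)
  also have "(\<Sum>p\<in>odds \<union> duals. winding_number (rectpath a b) p * ?R p)
     = (\<Sum>p\<in>odds \<union> duals. ?R p)"
    using inbox by (intro sum.cong refl) (auto simp: winding_number_rectpath)
  also have "\<dots> = (\<Sum>p\<in>odds. ?R p) + (\<Sum>p\<in>duals. ?R p)"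
  proof (rule sum.union_disjoint)
    show "odds \<inter> duals = {}"
    proof -
      have "Re x \<noteq> 0" if "x \<in> odds" for x
      proof -
        have "\<exists>k. x = complex_of_int (2 * k + 1)"
          using that unfolding odds_def
        proof (elim UnE imageE)
          fix i assume "x = complex_of_int (2 * int i + 1)"
          then show ?thesis by (rule exI)
        next
          fix i assume "x = complex_of_int (- (2 * int i + 1))"
          moreover have "- (2 * int i + 1) = 2 * (- int i - 1) + 1" by simp
          ultimately have "x = complex_of_int (2 * (- int i - 1) + 1)" by (simp only:)
          then show ?thesis by (rule exI)
        qed
        then obtain k where "x = complex_of_int (2 * k + 1)" ..
        then have "Re x = real_of_int (2 * k + 1)" by simp
        moreover have "2 * k + 1 \<noteq> 0" by presburger
        ultimately show ?thesis using of_int_0_eq_iff by metis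
      qed
      moreover have "Re x = 0" if "x \<in> duals" for x using that by (auto simp: duals_def)
      ultimately show ?thesis by blast
    qed
  qed (auto simp: odds_def duals_def)
  also have "(\<Sum>p\<in>duals. ?R p) = (\<Sum>l\<in>{- int N..int N}. \<i> * of_real (dual_term t z l))"
  proof -
    have "inj_on (\<lambda>l. \<i> * complex_of_real (dual_pole t z l)) {- int N..int N}"
      using t by (intro inj_onI) (simp add: dual_pole_def)
    then show ?thesis
      unfolding duals_def by (subst sum.reindex) (auto simp: residue_at_dual_pole[OF t z] dual_term_def intro!: sum.cong)
  qed
  also have "(\<Sum>p\<in>odds. ?R p)
    = (\<Sum>i<N. ?R (of_int (2 * int i + 1)) + ?R (of_int (- (2 * int i + 1))))"
  proof -
    have inj: "inj_on (\<lambda>i. complex_of_int (2 * int i + 1)) {..<N}" "inj_on (\<lambda>i. complex_of_int (- (2 * int i + 1))) {..<N}"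
      by (auto intro!: inj_onI simp only: of_int_eq_iff)
    have "(\<Sum>p\<in>odds. ?R p) = (\<Sum>p\<in>(\<lambda>i. complex_of_int (2 * int i + 1)) ` {..<N}. ?R p)
       + (\<Sum>p\<in>(\<lambda>i. complex_of_int (- (2 * int i + 1))) ` {..<N}. ?R p)"
      unfolding odds_def
    proof (rule sum.union_disjoint)
      show "(\<lambda>i. complex_of_int (2 * int i + 1)) ` {..<N} \<inter> (\<lambda>i. complex_of_int (- (2 * int i + 1))) ` {..<N} = {}"
        by (auto simp only: of_int_eq_iff)
    qed auto
    then show ?thesis
      unfolding sum.reindex[OF inj(1)] sum.reindex[OF inj(2)] o_def sum.distrib .
  qed
  also have "\<dots> = (\<Sum>i<N. \<i> * of_real (2 / pi * odd_term t z i))"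
    unfolding residue_odd_pair[OF t] ..
  also have "(\<Sum>i<N. \<i> * of_real (2 / pi * odd_term t z i)) + (\<Sum>l\<in>{- int N..int N}. \<i> * of_real (dual_term t z l)) = \<i> * of_real (residue_sum t z N)"
    by (simp add: residue_sum_def sum_distrib_left distrib_left)
  finally have val: "contour_integral (rectpath a b) (contour_integrand t z) = 2 * pi * \<i> * (\<i> * of_real (residue_sum t z N))" .
  show "contour_integral (pole_rect t z N) (contour_integrand t z) = - (2 * pi * residue_sum t z N)"
    unfolding rect val by (simp add: complex_eq_iff)
  show "continuous_on (path_image (pole_rect t z N)) (contour_integrand t z)"
    unfolding rect using holo image by (meson continuous_on_subset holomorphic_on_imp_continuous_on)
qed

lemma residue_sum_bound:
  fixes y Y :: "nat \<Rightarrow> real"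
  assumes t: "t > 0" and z: "0 < z" "z < pi" and N: "N > 0" "rect_top t z N \<ge> 1"
  defines "y \<equiv> rect_top t z" and "Y \<equiv> rect_bottom t z"
  shows "2 * pi * \<bar>residue_sum t z N\<bar> \<le>
    2 * (2 * (2 * real N + Y N) * exp (- (y N * z / 2)) * (4 * real N))
      + 2 * ((2 * real N + Y N) / sinh (2 * real N * t) * (y N + Y N))"
proof -
  define a b where "a = Complex (- (2 * real N)) (- Y N)" and "b = Complex (2 * real N) (y N)"
  have rect: "pole_rect t z N = rectpath a b"
    by (simp add: pole_rect_def a_def b_def y_def Y_def)
  note yY = rect_bounds[OF t z, of N, folded y_def Y_def]
  have order: "Re a < Re b" "Im a < Im b"
    using N(1) yY by (auto simp: a_def b_def)
  have "norm (contour_integral (rectpath a b) (contour_integrand t z))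
     \<le> 2 * (2 * (2 * real N + Y N) * exp (- (y N * z / 2)) * (Re b - Re a)) + 2 * ((2 * real N + Y N) / sinh (2 * real N * t) * (Im b - Im a))"
  proof (rule rectpath_integral_bound)
    show "continuous_on (path_image (rectpath a b)) (contour_integrand t z)"
      using contour_residues(1)[OF t z N(1)] by (simp only: rect)
    show "0 \<le> 2 * (2 * real N + Y N) * exp (- (y N * z / 2))" "0 \<le> (2 * real N + Y N) / sinh (2 * real N * t)"
      using yY t by simp_all
    fix x
    show "norm (contour_integrand t z x) \<le> (2 * real N + Y N) / sinh (2 * real N * t)"
      if "Re x = Re a \<or> Re x = Re b" "Im a \<le> Im x" "Im x \<le> Im b"
      using that yY N(1) by (intro contour_integrand_bound_vertical[OF t z]) (auto simp: a_def b_def)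
    show "norm (contour_integrand t z x) \<le> 2 * (2 * real N + Y N) * exp (- (y N * z / 2))"
      if "Im x = Im a \<or> Im x = Im b" "Re a \<le> Re x" "Re x \<le> Re b"
    proof -
      have "t * Im x + z / 2 = pi * (of_int (int N) + 1 / 2) \<or> t * Im x + z / 2 = pi * (of_int (- int N - 1) + 1 / 2)"
      proof -
        have tY: "t * Y N = pi * (real N + 1 / 2) + z / 2" "t * y N = pi * (real N + 1 / 2) - z / 2"
          using t by (simp_all add: Y_def y_def rect_top_def rect_bottom_def)
        from that(1) have "Im x = - Y N \<or> Im x = y N" by (simp add: a_def b_def)
        then have "t * Im x = - (t * Y N) \<or> t * Im x = t * y N" by auto
        moreover have "pi * (of_int (- int N - 1) + 1 / 2) = - (pi * (real N + 1 / 2))"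
          by (simp add: algebra_simps)
        ultimately show ?thesis unfolding tY by auto
      qed
      then obtain l where "t * Im x + z / 2 = pi * (of_int l + 1 / 2)" by blast
      then show ?thesis
        using that yY N(1) N(2)[folded y_def] by (intro contour_integrand_bound_horizontal[OF t z]) (auto simp: a_def b_def)
    qed
  qed (use order in auto)
  moreover have "Re b - Re a = 4 * real N" "Im b - Im a = y N + Y N" by (simp_all add: a_def b_def)
  moreover have "norm (contour_integral (rectpath a b) (contour_integrand t z)) = 2 * pi * \<bar>residue_sum t z N\<bar>"
    unfolding rect[symmetric] contour_residues(2)[OF t z N(1)] by (simp add: norm_mult)
  ultimately show ?thesis by (simp only:)
qed

text \<open>
  The bound of \<open>residue_sum_bound\<close> tends to 0: it is a polynomial in \<open>N\<close> divided by an exponential on each side of the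
  rectangle.
\<close>

lemma residue_sum_tendsto_0:
  assumes t: "t > 0" and z: "0 < z" "z < pi"
  shows "residue_sum t z \<longlonglongrightarrow> 0"
proof -
  define y Y where "y = rect_top t z" and "Y = rect_bottom t z"
  define E where "E N = 2 * (2 * (2 * real N + Y N) * exp (- (y N * z / 2)) * (4 * real N))
      + 2 * ((2 * real N + Y N) / sinh (2 * real N * t) * (y N + Y N))" for N
  have "E \<longlonglongrightarrow> 0"
  proof -
    define c where "c = pi / t"
    have c: "c > 0" "c * z / 2 > 0" "2 + c > 0" "2 * c > 0" using t z by (simp_all add: c_def add_pos_pos)
    have E: "E N = 2 * (2 * ((2 + c) * real N + (pi / 2 + z / 2) / t) * exp (- ((c * z / 2) * real N + (pi / 2 - z / 2) / t * z / 2)) * (4 * real N))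
      + 2 * (((2 + c) * real N + (pi / 2 + z / 2) / t) / sinh (2 * t * real N) * ((2 * c) * real N + pi / t))" for N
    proof -
      have y: "y N = c * real N + (pi / 2 - z / 2) / t"
        by (simp add: y_def rect_top_def c_def add_divide_distrib diff_divide_distrib algebra_simps)
      have Y: "Y N = c * real N + (pi / 2 + z / 2) / t"
        by (simp add: Y_def rect_bottom_def c_def add_divide_distrib algebra_simps)
      have 1: "2 * real N + Y N = (2 + c) * real N + (pi / 2 + z / 2) / t" unfolding Y by (simp add: algebra_simps)
      have 2: "y N + Y N = (2 * c) * real N + pi / t" unfolding y Y by (simp add: add_divide_distrib diff_divide_distrib)
      have 3: "y N * z / 2 = (c * z / 2) * real N + (pi / 2 - z / 2) / t * z / 2"
      proof -
        have "(c * n + d) * z / 2 = (c * z / 2) * n + d * z / 2" for n d by (simp add: field_simps)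
        then show ?thesis unfolding y .
      qed
      have 4: "2 * real N * t = 2 * t * real N" by simp
      show ?thesis unfolding E_def 1 2 3 4 ..
    qed
    \<comment> \<open>with independent constants, so that the growth rates can be compared automatically\<close>
    have lim: "(\<lambda>N. 2 * (2 * (k * real N + e) * exp (- (a * real N + d)) * (4 * real N))) \<longlonglongrightarrow> 0"
      "(\<lambda>N. 2 * ((k * real N + e) / sinh (2 * t * real N) * (b * real N + f))) \<longlonglongrightarrow> 0"
      if "a > 0" "k > 0" "b > 0" for a b d e f k :: real
      using that t by real_asymp+
    have "E \<longlonglongrightarrow> 0 + 0"
      unfolding E by (rule tendsto_add[OF lim(1)[OF c(2,3,4)] lim(2)[OF c(2,3,4)]])
    then show ?thesis by simp
  qed
  moreover have "filterlim y at_top sequentially"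
    unfolding y_def rect_top_def[abs_def] using t z by real_asymp
  then have "eventually (\<lambda>N. y N \<ge> 1) sequentially" by (simp add: filterlim_at_top)
  then have "eventually (\<lambda>N. norm (residue_sum t z N) \<le> E N) sequentially"
    using eventually_gt_at_top[of 0]
  proof eventually_elim
    case (elim N)
    have "\<bar>residue_sum t z N\<bar> * 1 \<le> \<bar>residue_sum t z N\<bar> * (2 * pi)" using pi_gt3 by (intro mult_left_mono) auto
    also have "\<dots> = 2 * pi * \<bar>residue_sum t z N\<bar>" by (rule mult.commute)
    also have "\<dots> \<le> E N" unfolding E_def y_def Y_def using t z elim by (intro residue_sum_bound) (auto simp: y_def)
    finally show ?case by simp
  qed
  ultimately show ?thesis by (rule Lim_null_comparison[rotated])
qed

section \<open>A double series and its rows, columns and hooks\<close>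

text \<open>
  The second series is split as \<open>c + j = (c - 1) + (j + 1)\<close> into a geometric series and its derivative.
\<close>

lemma has_sum_alternating_geometric:
  fixes X :: real
  assumes "0 \<le> X" "X < 1"
  shows "((\<lambda>j. (- X) ^ j) has_sum (1 / (1 + X))) UNIV"
    and "((\<lambda>j. (c + real j) * (- X) ^ j) has_sum ((c - 1) / (1 + X) + 1 / (1 + X)\<^sup>2)) UNIV"
proof -
  have X: "norm (- X) < 1" using assms by simp
  show 1: "((\<lambda>j. (- X) ^ j) has_sum (1 / (1 + X))) UNIV"
    using geometric_sums[OF X] assms
    by (intro norm_summable_imp_has_sum) (auto simp: norm_power summable_geometric)
  have "summable (\<lambda>j. norm (of_nat (Suc j) * (- X) ^ j))"
    using geometric_deriv_sums[of X] assms
    by (simp add: norm_mult norm_power sums_iff abs_mult)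
  then have 2: "((\<lambda>j. of_nat (Suc j) * (- X) ^ j) has_sum (1 / (1 + X)\<^sup>2)) UNIV"
    using geometric_deriv_sums[OF X] by (intro norm_summable_imp_has_sum) auto
  have "((\<lambda>j. (c - 1) * (- X) ^ j + of_nat (Suc j) * (- X) ^ j) has_sum ((c - 1) * (1 / (1 + X)) + 1 / (1 + X)\<^sup>2)) UNIV"
    by (intro has_sum_add has_sum_cmult_right 1 2)
  then show "((\<lambda>j. (c + real j) * (- X) ^ j) has_sum ((c - 1) / (1 + X) + 1 / (1 + X)\<^sup>2)) UNIV"
    by (simp add: algebra_simps)
qed

lemma power_minus_factor: "(- (a * q ^ j)) ^ k = (-1) ^ k * a ^ k * q ^ (k * j)" for a q :: real
  by (simp add: power_minus[of "a * q ^ j"] power_mult_distrib mult.commute[of k] power_mult)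

text \<open>
  The double series behind both sides of the duality. Up to the extra factor \<open>x\<close> it is symmetric under the exchange of
  \<open>x, j\<close> with \<open>y, k\<close>.
\<close>

definition lattice_term :: "real \<Rightarrow> real \<Rightarrow> nat \<Rightarrow> nat \<Rightarrow> real"
  where "lattice_term x y k j = (-1) ^ (k + j) * x ^ (j + 1) * y ^ k * (x * y) ^ (k * j)"

text \<open>
  The closed form of the sum along one arm of a diagonal hook: for \<open>K \<ge> 0\<close> over the points \<open>(K, K + n)\<close>,
  and for \<open>K < 0\<close> over the points \<open>(- K + n, - K - 1)\<close>, with \<open>n \<ge> 0\<close>. Together the arms cover every
  pair \<open>(k, j)\<close> of natural numbers once.
\<close>

definition hook_sum :: "real \<Rightarrow> real \<Rightarrow> int \<Rightarrow> real"
  where "hook_sum x y K = (if K \<ge> 0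
     then x * (x * y) ^ (nat K * (nat K + 1)) * (2 * of_int K / (1 + x * (x * y) ^ nat K) + 1 / (1 + x * (x * y) ^ nat K)\<^sup>2)
     else - ((x * y) ^ (nat (- K) * nat (- K))) * ((2 * of_int (- K) - 1) / (1 + y * (x * y) ^ (nat (- K) - 1)) + 1 / (1 + y * (x * y) ^ (nat (- K) - 1))\<^sup>2))"

context
  fixes x y :: real
  assumes x: "0 < x" "x < 1" and y: "0 < y" "y < 1"
begin

lemma xy: "0 < x * y" "x * y < 1"
  using x y by (simp_all add: mult_strict_mono[of x 1 y 1, simplified])

lemma lattice_factor_bounds: "0 \<le> y * (x * y) ^ j" "y * (x * y) ^ j < 1" "0 \<le> x * (x * y) ^ k" "x * (x * y) ^ k < 1"
proof -
  have p: "0 \<le> (x * y) ^ n" "(x * y) ^ n \<le> 1" for n using xy by (simp_all add: power_le_one less_imp_le)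
  show "0 \<le> y * (x * y) ^ j" "0 \<le> x * (x * y) ^ k" using p x y by simp_all
  have "y * (x * y) ^ j \<le> y * 1" using p y by (intro mult_left_mono) auto
  then show "y * (x * y) ^ j < 1" using y by linarith
  have "x * (x * y) ^ k \<le> x * 1" using p x by (intro mult_left_mono) auto
  then show "x * (x * y) ^ k < 1" using x by linarith
qed

lemma lattice_row: "((\<lambda>k. lattice_term x y k j) has_sum ((-1) ^ j * x ^ (j + 1) / (1 + y * (x * y) ^ j))) UNIV"
proof -
  have "lattice_term x y k j = ((-1) ^ j * x ^ (j + 1)) * (- (y * (x * y) ^ j)) ^ k" for k
    unfolding lattice_term_def power_minus_factor power_add by (simp only: mult_ac)
  moreover have "((\<lambda>k. ((-1) ^ j * x ^ (j + 1)) * (- (y * (x * y) ^ j)) ^ k) has_sum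
      (((-1) ^ j * x ^ (j + 1)) * (1 / (1 + y * (x * y) ^ j)))) UNIV"
    by (intro has_sum_cmult_right has_sum_alternating_geometric(1) lattice_factor_bounds)
  ultimately show ?thesis by simp
qed

lemma lattice_column: "((\<lambda>j. lattice_term x y k j) has_sum ((-1) ^ k * y ^ k * x / (1 + x * (x * y) ^ k))) UNIV"
proof -
  have "lattice_term x y k j = ((-1) ^ k * y ^ k * x) * (- (x * (x * y) ^ k)) ^ j" for j
    unfolding lattice_term_def power_minus_factor power_add power_one_right by (simp only: mult_ac)
  moreover have "((\<lambda>j. ((-1) ^ k * y ^ k * x) * (- (x * (x * y) ^ k)) ^ j) has_sum
      (((-1) ^ k * y ^ k * x) * (1 / (1 + x * (x * y) ^ k)))) UNIV"
    by (intro has_sum_cmult_right has_sum_alternating_geometric(1) lattice_factor_bounds)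
  ultimately show ?thesis by simp
qed

lemma lattice_summable:
  assumes "\<And>k j. \<bar>c (k, j)\<bar> \<le> (real k + 1) * (real j + 1)"
  shows "(\<lambda>(k, j). c (k, j) * lattice_term x y k j) summable_on UNIV"
proof -
  have lin: "(\<lambda>n::nat. (real n + 1) * r ^ n) summable_on UNIV" if "0 < r" "r < 1" for r :: real
  proof -
    have "summable (\<lambda>n. of_nat (Suc n) * r ^ n)"
      using geometric_deriv_sums[of r] that by (simp add: sums_iff)
    then show ?thesis using that by (subst summable_on_UNIV_nonneg_real_iff) (auto simp: add.commute)
  qed
  define G where "G = (\<lambda>(k, j). ((real k + 1) * y ^ k) * ((real j + 1) * x ^ j))"
  have G: "G summable_on UNIV \<times> UNIV"
    unfolding G_def
  proof (rule summable_on_SigmaI)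
    show "((\<lambda>j. (\<lambda>(k, j). ((real k + 1) * y ^ k) * ((real j + 1) * x ^ j)) (k, j)) has_sum
        ((real k + 1) * y ^ k) * (\<Sum>\<^sub>\<infinity>j. (real j + 1) * x ^ j)) UNIV" for k
      using lin[OF x] by (simp add: has_sum_cmult_right)
    show "(\<lambda>k. ((real k + 1) * y ^ k) * (\<Sum>\<^sub>\<infinity>j. (real j + 1) * x ^ j)) summable_on UNIV"
      using lin[OF y] by (rule summable_on_cmult_left)
  qed (use x y in auto)
  have "(\<lambda>p. norm ((\<lambda>(k, j). c (k, j) * lattice_term x y k j) p)) summable_on UNIV \<times> UNIV"
  proof (rule Infinite_Sum.abs_summable_on_comparison_test'[OF G])
    fix p :: "nat \<times> nat"
    obtain k j where p: "p = (k, j)" by (cases p)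
    have "\<bar>lattice_term x y k j\<bar> = x ^ j * y ^ k * (x * (x * y) ^ (k * j))"
      using x y by (simp add: lattice_term_def abs_mult power_abs mult_ac)
    also have "\<dots> \<le> x ^ j * y ^ k * 1"
      using x y lattice_factor_bounds(4)[of "k * j"] by (intro mult_left_mono) auto
    finally have "\<bar>lattice_term x y k j\<bar> \<le> x ^ j * y ^ k" by simp
    then have "\<bar>c (k, j)\<bar> * \<bar>lattice_term x y k j\<bar> \<le> ((real k + 1) * (real j + 1)) * (x ^ j * y ^ k)"
      using assms by (intro mult_mono) auto
    then show "norm ((\<lambda>(k, j). c (k, j) * lattice_term x y k j) p) \<le> G p"
      by (simp add: p G_def abs_mult mult_ac)
  qed
  then show ?thesis unfolding UNIV_Times_UNIV by (rule summable_on_iff_abs_summable_on_real[THEN iffD2])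
qed

lemma lattice_by_rows:
  assumes "((\<lambda>(k, j). c j * lattice_term x y k j) has_sum S) UNIV"
  shows "((\<lambda>j. c j * ((-1) ^ j * x ^ (j + 1) / (1 + y * (x * y) ^ j))) has_sum S) UNIV"
proof -
  have "((\<lambda>(j, k). c j * lattice_term x y k j) has_sum S) (UNIV \<times> UNIV)"
    using has_sum_swap[where f = "\<lambda>(k, j). c j * lattice_term x y k j" and A = UNIV and B = UNIV] assms by simp
  then show ?thesis
    by (rule has_sum_SigmaD) (simp only: prod.case, rule has_sum_cmult_right[OF lattice_row])
qed

lemma lattice_by_columns:
  assumes "((\<lambda>(k, j). c k * lattice_term x y k j) has_sum S) UNIV"
  shows "((\<lambda>k. c k * ((-1) ^ k * y ^ k * x / (1 + x * (x * y) ^ k))) has_sum S) UNIV"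
proof -
  have "((\<lambda>(k, j). c k * lattice_term x y k j) has_sum S) (UNIV \<times> UNIV)"
    using assms by simp
  then show ?thesis
    by (rule has_sum_SigmaD) (simp only: prod.case, rule has_sum_cmult_right[OF lattice_column])
qed

text \<open>
  Along an arm the exponent of \<open>x * y\<close> is quadratic in \<open>K\<close> and linear in \<open>n\<close>, so the sum over \<open>n\<close> is
  an alternating geometric series with linear weights.
\<close>

lemma lattice_by_hooks:
  assumes "((\<lambda>(k, j). (real k + real j + 1) * lattice_term x y k j) has_sum S) UNIV"
  shows "(hook_sum x y has_sum S) UNIV"
proof -
  let ?F = "\<lambda>(k, j). (real k + real j + 1) * lattice_term x y k j"
  \<comment> \<open>from the number of the arm and the position on it to the lattice point, and back\<close>
  let ?to = "\<lambda>(K::int, n). if K \<ge> 0 then (nat K, nat K + n) else (nat (- K) + n, nat (- K) - 1)"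
  let ?from = "\<lambda>(k, j). if k \<le> j then (int k, j - k) else (- int j - 1, k - j - 1)"
  have "((\<lambda>p. ?F (?to p)) has_sum S) UNIV = (?F has_sum S) UNIV"
    by (rule has_sum_reindex_bij_witness[of _ ?from ?to]) (auto split: if_splits)
  with assms have 1: "((\<lambda>p. ?F (?to p)) has_sum S) (UNIV \<times> UNIV)" by simp
  show ?thesis
  proof (rule has_sum_SigmaD[OF 1])
    fix K :: int
    show "((\<lambda>n. ?F (?to (K, n))) has_sum hook_sum x y K) UNIV"
    proof (cases "K \<ge> 0")
      case True
      define m where "m = nat K"
      have eq: "?F (?to (K, n)) = (x * (x * y) ^ (m * (m + 1))) * ((2 * real m + 1 + real n) * (- (x * (x * y) ^ m)) ^ n)" for n
      proof -
        have "?F (?to (K, n)) = (2 * real m + 1 + real n) * lattice_term x y m (m + n)"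
          using True by (simp add: m_def algebra_simps)
        also have "lattice_term x y m (m + n) = (x * (x * y) ^ (m * (m + 1))) * (- (x * (x * y) ^ m)) ^ n"
        proof -
          have 1: "(-1::real) ^ (m + (m + n)) = (-1) ^ n" by (simp add: minus_one_power_iff)
          have 2: "x ^ (m + n + 1) * y ^ m = x * x ^ n * (x * y) ^ m"
            by (simp add: power_add power_mult_distrib)
          have 3: "q ^ m * q ^ (m * (m + n)) = q ^ (m * (m + 1)) * q ^ (n * m)" for q :: real
            by (simp add: power_add[symmetric] algebra_simps)
          have "lattice_term x y m (m + n) = (-1) ^ n * (x * x ^ n) * ((x * y) ^ m * (x * y) ^ (m * (m + n)))"
            unfolding lattice_term_def 1 mult.assoc[of _ "x ^ (m + n + 1)"] 2 by (simp only: mult.assoc)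
          then show ?thesis unfolding 3 power_minus_factor by (simp only: mult_ac)
        qed
        finally show ?thesis by (simp only: mult_ac)
      qed
      have "((\<lambda>n. (x * (x * y) ^ (m * (m + 1))) * ((2 * real m + 1 + real n) * (- (x * (x * y) ^ m)) ^ n)) has_sum
         (x * (x * y) ^ (m * (m + 1))) * ((2 * real m + 1 - 1) / (1 + x * (x * y) ^ m) + 1 / (1 + x * (x * y) ^ m)\<^sup>2)) UNIV"
        by (intro has_sum_cmult_right has_sum_alternating_geometric(2) lattice_factor_bounds)
      then show ?thesis unfolding eq using True by (simp add: hook_sum_def m_def)
    next
      case False
      define m where "m = nat (- K) - 1"
      have K: "nat (- K) = Suc m" "K = - int (Suc m)" using False by (auto simp: m_def)
      have eq: "?F (?to (K, n)) = (- ((x * y) ^ (Suc m * Suc m))) * ((2 * real (Suc m) + real n) * (- (y * (x * y) ^ m)) ^ n)" for n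
      proof -
        have "?F (?to (K, n)) = (2 * real (Suc m) + real n) * lattice_term x y (Suc m + n) m"
          using False K(1) by (simp add: algebra_simps)
        also have "lattice_term x y (Suc m + n) m = (- ((x * y) ^ (Suc m * Suc m))) * (- (y * (x * y) ^ m)) ^ n"
        proof -
          have 1: "(-1::real) ^ (Suc m + n + m) = - ((-1) ^ n)" by (simp add: minus_one_power_iff)
          have 2: "x ^ (m + 1) * y ^ (Suc m + n) = y ^ n * (x * y) ^ Suc m"
            by (simp add: power_add power_mult_distrib)
          have 3: "q ^ Suc m * q ^ ((Suc m + n) * m) = q ^ (Suc m * Suc m) * q ^ (n * m)" for q :: real
            by (simp add: power_add[symmetric] algebra_simps)
          have "lattice_term x y (Suc m + n) m = - ((-1) ^ n) * y ^ n * ((x * y) ^ Suc m * (x * y) ^ ((Suc m + n) * m))"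
            unfolding lattice_term_def 1 mult.assoc[of _ "x ^ (m + 1)"] 2 by (simp only: mult.assoc)
          then show ?thesis unfolding 3 power_minus_factor by (simp only: mult_minus_left mult_minus_right mult_ac)
        qed
        finally show ?thesis by (simp only: mult_ac)
      qed
      have "((\<lambda>n. (- ((x * y) ^ (Suc m * Suc m))) * ((2 * real (Suc m) + real n) * (- (y * (x * y) ^ m)) ^ n)) has_sum
         (- ((x * y) ^ (Suc m * Suc m))) * ((2 * real (Suc m) - 1) / (1 + y * (x * y) ^ m) + 1 / (1 + y * (x * y) ^ m)\<^sup>2)) UNIV"
        by (intro has_sum_cmult_right has_sum_alternating_geometric(2) lattice_factor_bounds)
      then show ?thesis unfolding eq using False K by (simp add: hook_sum_def)
    qed
  qed
qed

text \<open>
  The row \<open>j\<close> has index \<open>j + 1\<close> and sign -1, the column \<open>k\<close> has index \<open>- k\<close> and sign 1. Linear weights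
  \<open>a * index + b\<close> therefore give \<open>- a * (j + 1 + k)\<close> on every point of the lattice, while the contributions of
  \<open>b\<close> cancel because rows and columns sum the same series.
\<close>

lemma lattice_duality:
  "\<exists>S. (hook_sum x y has_sum S) UNIV \<and>
     (\<forall>a b. (\<lambda>N. (\<Sum>j<N. (a * (real j + 1) + b) * - ((-1) ^ j * x ^ (j + 1) / (1 + y * (x * y) ^ j)))
        + (\<Sum>k<Suc N. (- a * real k + b) * ((-1) ^ k * y ^ k * x / (1 + x * (x * y) ^ k)))) \<longlonglongrightarrow> - a * S)"
proof -
  have "(\<lambda>(k, j). 1 * lattice_term x y k j) summable_on UNIV" "(\<lambda>(k, j). (real j + 1) * lattice_term x y k j) summable_on UNIV"
    "(\<lambda>(k, j). real k * lattice_term x y k j) summable_on UNIV"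
    using lattice_summable[of "\<lambda>p. 1"] lattice_summable[of "\<lambda>(k, j). real j + 1"] lattice_summable[of "\<lambda>(k, j). real k"]
    by (auto simp: algebra_simps)
  then obtain H H\<^sub>1 H\<^sub>2 where H: "((\<lambda>(k, j). 1 * lattice_term x y k j) has_sum H) UNIV"
    and H1: "((\<lambda>(k, j). (real j + 1) * lattice_term x y k j) has_sum H\<^sub>1) UNIV"
    and H2: "((\<lambda>(k, j). real k * lattice_term x y k j) has_sum H\<^sub>2) UNIV"
    by (auto simp: summable_on_def)
  have "((\<lambda>(k, j). (real k + real j + 1) * lattice_term x y k j) has_sum (H\<^sub>1 + H\<^sub>2)) UNIV"
  proof -
    have "(\<lambda>p. (\<lambda>(k, j). (real j + 1) * lattice_term x y k j) p + (\<lambda>(k, j). real k * lattice_term x y k j) p)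
       = (\<lambda>(k, j). (real k + real j + 1) * lattice_term x y k j)"
      by (auto simp: fun_eq_iff algebra_simps)
    then show ?thesis using has_sum_add[OF H1 H2] by simp
  qed
  then have hook: "(hook_sum x y has_sum (H\<^sub>1 + H\<^sub>2)) UNIV" by (rule lattice_by_hooks)
  let ?r = "\<lambda>j. (-1) ^ j * x ^ (j + 1) / (1 + y * (x * y) ^ j)" and ?c = "\<lambda>k. (-1) ^ k * y ^ k * x / (1 + x * (x * y) ^ k)"
  have r: "?r sums H" "(\<lambda>j. (real j + 1) * ?r j) sums H\<^sub>1"
    using has_sum_imp_sums[OF lattice_by_rows[OF H1]] has_sum_imp_sums[OF lattice_by_rows[of "\<lambda>_. 1", OF H]] by simp_all
  have c: "?c sums H" "(\<lambda>k. real k * ?c k) sums H\<^sub>2"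
    using has_sum_imp_sums[OF lattice_by_columns[OF H2]] has_sum_imp_sums[OF lattice_by_columns[of "\<lambda>_. 1", OF H]] by simp_all
  have "(\<lambda>N. (\<Sum>j<N. (a * (real j + 1) + b) * - ?r j) + (\<Sum>k<Suc N. (- a * real k + b) * ?c k)) \<longlonglongrightarrow> - a * (H\<^sub>1 + H\<^sub>2)" for a b
  proof -
    have "(\<lambda>j. - a * ((real j + 1) * ?r j) + - b * ?r j) sums (- a * H\<^sub>1 + - b * H)"
      by (intro sums_add sums_mult r)
    moreover have "(\<lambda>j. - a * ((real j + 1) * ?r j) + - b * ?r j) = (\<lambda>j. (a * (real j + 1) + b) * - ?r j)"
      by (rule ext) (simp only: ring_distribs mult_minus_left mult_minus_right mult.assoc minus_add_distrib)
    ultimately have 1: "(\<lambda>N. \<Sum>j<N. (a * (real j + 1) + b) * - ?r j) \<longlonglongrightarrow> - a * H\<^sub>1 + - b * H"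
      by (simp only: sums_def)
    have "(\<lambda>k. - a * (real k * ?c k) + b * ?c k) sums (- a * H\<^sub>2 + b * H)"
      by (intro sums_add sums_mult c)
    moreover have "(\<lambda>k. - a * (real k * ?c k) + b * ?c k) = (\<lambda>k. (- a * real k + b) * ?c k)"
      by (rule ext) (simp only: ring_distribs mult_minus_left mult.assoc)
    ultimately have "(\<lambda>N. \<Sum>k<N. (- a * real k + b) * ?c k) \<longlonglongrightarrow> - a * H\<^sub>2 + b * H"
      by (simp only: sums_def)
    then have 2: "(\<lambda>N. \<Sum>k<Suc N. (- a * real k + b) * ?c k) \<longlonglongrightarrow> - a * H\<^sub>2 + b * H"
      by (rule LIMSEQ_Suc)
    have eq: "- a * H\<^sub>1 + - b * H + (- a * H\<^sub>2 + b * H) = - a * (H\<^sub>1 + H\<^sub>2)" by (simp add: algebra_simps)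
    show ?thesis using tendsto_add[OF 1 2] unfolding eq .
  qed
  with hook show ?thesis by blast
qed

end

section \<open>From the spectral series to the short-time series\<close>

lemma inverse_sinh_expansion:
  fixes w :: complex
  assumes "Re w > 0"
  shows "((\<lambda>j::nat. 2 * exp (- (of_nat (2 * j + 1) * w))) has_sum (1 / sinh w)) UNIV"
proof -
  have q: "norm (exp (- 2 * w)) < 1" using assms by simp
  have "((\<lambda>j. exp (- 2 * w) ^ j) has_sum (1 / (1 - exp (- 2 * w)))) UNIV"
    using geometric_sums[OF q] q by (intro norm_summable_imp_has_sum) (auto simp: norm_power intro: summable_geometric)
  then have "((\<lambda>j. (2 * exp (- w)) * exp (- 2 * w) ^ j) has_sum ((2 * exp (- w)) * (1 / (1 - exp (- 2 * w))))) UNIV"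
    by (rule has_sum_cmult_right)
  moreover have "(2 * exp (- w)) * exp (- 2 * w) ^ j = 2 * exp (- (of_nat (2 * j + 1) * w))" for j
  proof -
    have "exp (- 2 * w) ^ j = exp (of_nat j * (- 2 * w))" by (rule exp_of_nat_mult[symmetric])
    then have "exp (- w) * exp (- 2 * w) ^ j = exp (- w + of_nat j * (- 2 * w))" by (simp only: exp_add)
    also have "- w + of_nat j * (- 2 * w) = - (of_nat (2 * j + 1) * w)" by (simp add: algebra_simps)
    finally show ?thesis by (simp only: mult.assoc)
  qed
  moreover have "(2 * exp (- w)) * (1 / (1 - exp (- 2 * w))) = 1 / sinh w"
  proof -
    have e: "exp (- 2 * w) = exp (- w) * exp (- w)" by (simp add: exp_add[symmetric])
    have "exp (- 2 * w) \<noteq> 1"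
    proof
      assume "exp (- 2 * w) = 1"
      with q show False by (simp only: norm_one less_irrefl)
    qed
    then have nz: "1 - exp (- w) * exp (- w) \<noteq> 0" unfolding e by simp
    have "sinh w = (1 - exp (- w) * exp (- w)) / (2 * exp (- w))"
      unfolding sinh_field_def by (simp add: field_simps exp_minus)
    then show ?thesis unfolding e using nz by simp
  qed
  ultimately show ?thesis by (simp only:)
qed

text \<open>
  Expanding \<open>1 / sinh\<close> into exponentials gives the exponent \<open>(2 i + 1) * (2 j + 1) * t\<close>, which is
  \<open>(eigval i j + 1) * t\<close>.
\<close>

lemma odd_term_expansion:
  assumes "t > 0"
  shows "((\<lambda>j. (2 * real i + 1) * (exp (- real (eigval i j) * t) * cos ((real i - real j) * z)))
     has_sum (exp t / 2 * odd_term t z i)) UNIV"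
proof -
  define A where "A = 2 * real i + 1"
  define w where "w = of_real t * of_real A + \<i> * of_real (z / 2)"
  define e where "e = exp (\<i> * of_real (z / 2) * complex_of_real A)"
  have w: "Re w > 0" using assms by (simp add: w_def A_def add_pos_nonneg)
  have Re_scale: "Re (of_real r * u) = r * Re u" for r u by simp
  have "((\<lambda>j::nat. of_real (exp t / 2 * A) * e * (2 * exp (- (of_nat (2 * j + 1) * w)))) has_sum
      (of_real (exp t / 2 * A) * e * (1 / sinh w))) UNIV"
    by (intro has_sum_cmult_right inverse_sinh_expansion w)
  then have "((\<lambda>j::nat. Re (of_real (exp t / 2 * A) * e * (2 * exp (- (of_nat (2 * j + 1) * w))))) has_sum
      Re (of_real (exp t / 2 * A) * e * (1 / sinh w))) UNIV"
    by (rule has_sum_Re)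
  moreover have "Re (of_real (exp t / 2 * A) * e * (1 / sinh w)) = exp t / 2 * odd_term t z i"
  proof -
    have "of_real (exp t / 2 * A) * e * (1 / sinh w) = of_real (exp t / 2) * (of_real A * e / sinh w)" by simp
    then show ?thesis unfolding odd_term_def A_def[symmetric] w_def[symmetric] e_def[symmetric]
      by (simp only: Re_scale)
  qed
  moreover have "Re (of_real (exp t / 2 * A) * e * (2 * exp (- (of_nat (2 * j + 1) * w))))
     = (2 * real i + 1) * (exp (- real (eigval i j) * t) * cos ((real i - real j) * z))" for j :: nat
  proof -
    have "e * exp (- (of_nat (2 * j + 1) * w)) = exp (\<i> * of_real (z / 2) * complex_of_real A + - (of_nat (2 * j + 1) * w))"
      unfolding e_def by (simp only: exp_add)
    also have "\<i> * of_real (z / 2) * complex_of_real A + - (of_nat (2 * j + 1) * w)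
      = of_real (- real (eigval i j) * t - t) + \<i> * of_real ((real i - real j) * z)"
      by (simp add: complex_eq_iff w_def A_def eigval_def field_simps)
    also have "exp \<dots> = of_real (exp (- real (eigval i j) * t - t)) * cis ((real i - real j) * z)"
      by (simp only: exp_add exp_of_real cis_conv_exp)
    finally have "of_real (exp t / 2 * A) * e * (2 * exp (- (of_nat (2 * j + 1) * w)))
      = of_real (A * (exp t * exp (- real (eigval i j) * t - t))) * cis ((real i - real j) * z)"
      by simp
    moreover have "exp t * exp (- real (eigval i j) * t - t) = exp (- real (eigval i j) * t)"
      by (simp add: exp_add[symmetric])
    ultimately show ?thesis by (simp only: Re_scale cis.sel A_def mult.assoc)
  qed
  ultimately show ?thesis by (simp only:)
qed

text \<open>
  The terms without the factor \<open>i + j + 1\<close> are symmetric in \<open>i\<close> and \<open>j\<close>, so that factor may be replaced by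
  \<open>2 i + 1\<close>.
\<close>

lemma spectral_sum_odd_terms:
  assumes "t > 0"
  shows "(\<lambda>i. exp t / 2 * odd_term t z i) sums (\<Sum>\<^sub>\<infinity>x. spectral_term t z x)"
proof -
  define T where "T i j = exp (- real (eigval i j) * t) * cos ((real i - real j) * z)" for i j
  have T_sym: "T j i = T i j" for i j
  proof -
    have "(real j - real i) * z = - ((real i - real j) * z)" by (simp add: algebra_simps)
    moreover have "eigval j i = eigval i j" by (simp add: eigval_def)
    ultimately show ?thesis unfolding T_def by (simp only: cos_minus)
  qed
  have spec: "spectral_term t z = (\<lambda>(i, j). (real i + real j + 1) * T i j)"
    by (auto simp: spectral_term_def T_def fun_eq_iff)
  have "(\<lambda>x. 2 * spectral_term t 0 x) summable_on UNIV"
    by (intro summable_on_cmult_right spectral_term_summable assms)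
  then have "(\<lambda>x. norm ((\<lambda>(i, j). (2 * real i + 1) * T i j) x)) summable_on UNIV"
  proof (rule Infinite_Sum.abs_summable_on_comparison_test')
    fix x :: "nat \<times> nat"
    obtain i j where x: "x = (i, j)" by (cases x)
    have "\<bar>T i j\<bar> \<le> exp (- real (eigval i j) * t) * 1"
      unfolding T_def abs_mult by (intro mult_mono) auto
    then have "(2 * real i + 1) * \<bar>T i j\<bar> \<le> (2 * (real i + real j + 1)) * (exp (- real (eigval i j) * t) * 1)"
      by (intro mult_mono) auto
    moreover have "norm ((\<lambda>(i, j). (2 * real i + 1) * T i j) x) = (2 * real i + 1) * \<bar>T i j\<bar>"
      by (simp add: x abs_mult)
    moreover have "2 * spectral_term t 0 x = (2 * (real i + real j + 1)) * (exp (- real (eigval i j) * t) * 1)"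
      by (simp add: x spectral_term_def algebra_simps)
    ultimately show "norm ((\<lambda>(i, j). (2 * real i + 1) * T i j) x) \<le> 2 * spectral_term t 0 x"
      by (simp only:)
  qed
  then have "(\<lambda>(i, j). (2 * real i + 1) * T i j) summable_on UNIV"
    by (rule summable_on_iff_abs_summable_on_real[THEN iffD2])
  then obtain S where S: "((\<lambda>(i, j). (2 * real i + 1) * T i j) has_sum S) UNIV"
    by (auto simp: summable_on_def)
  have "((\<lambda>(i, j). (2 * real j + 1) * T i j) has_sum S) UNIV"
    using S has_sum_swap[where f = "\<lambda>(i, j). (2 * real i + 1) * T i j" and A = UNIV and B = UNIV]
    by (simp add: T_sym)
  from has_sum_add[OF S this]
  have "((\<lambda>x. (\<lambda>(i, j). (2 * real i + 1) * T i j) x + (\<lambda>(i, j). (2 * real j + 1) * T i j) x) has_sum (S + S)) UNIV" .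
  moreover have "(\<lambda>x. (\<lambda>(i, j). (2 * real i + 1) * T i j) x + (\<lambda>(i, j). (2 * real j + 1) * T i j) x) = (\<lambda>x. 2 * spectral_term t z x)"
    by (auto simp: fun_eq_iff spec algebra_simps)
  ultimately have "((\<lambda>x. 2 * spectral_term t z x) has_sum (2 * S)) UNIV" by simp
  then have "(spectral_term t z has_sum S) UNIV"
    using has_sum_cmult_right[where c = "1/2" and f = "\<lambda>x. 2 * spectral_term t z x"] by fastforce
  then have "(\<Sum>\<^sub>\<infinity>x. spectral_term t z x) = S" by (rule infsumI)
  moreover have "((\<lambda>i. exp t / 2 * odd_term t z i) has_sum S) UNIV"
  proof (rule has_sum_SigmaD)
    show "((\<lambda>(i, j). (2 * real i + 1) * T i j) has_sum S) (UNIV \<times> UNIV)" using S by simp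
    show "((\<lambda>j. (\<lambda>(i, j). (2 * real i + 1) * T i j) (i, j)) has_sum exp t / 2 * odd_term t z i) UNIV" for i
      using odd_term_expansion[OF assms, of i z] by (simp add: T_def)
  qed
  ultimately show ?thesis by (simp add: has_sum_imp_sums)
qed

lemma sum_symmetric_int: "(\<Sum>l\<in>{- int N..int N}. f l) = (\<Sum>j<N. f (int j + 1)) + (\<Sum>k<Suc N. f (- int k))"
  for f :: "int \<Rightarrow> real"
proof -
  have "{- int N..int N} = (\<lambda>j. int j + 1) ` {..<N} \<union> (\<lambda>k. - int k) ` {..<Suc N}" (is "_ = ?A \<union> ?B")
  proof (intro equalityI subsetI)
    fix l assume l: "l \<in> {- int N..int N}"
    show "l \<in> ?A \<union> ?B"
    proof (cases "l > 0")
      case True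
      with l show ?thesis by (intro UnI1 image_eqI[of _ _ "nat (l - 1)"]) auto
    next
      case False
      with l show ?thesis by (intro UnI2 image_eqI[of _ _ "nat (- l)"]) auto
    qed
  qed auto
  moreover have "?A \<inter> ?B = {}" by auto
  ultimately have "(\<Sum>l\<in>{- int N..int N}. f l) = sum f ?A + sum f ?B"
    by (simp add: sum.union_disjoint)
  also have "sum f ?A = (\<Sum>j<N. f (int j + 1))" by (subst sum.reindex) (auto simp: inj_on_def)
  also have "sum f ?B = (\<Sum>k<Suc N. f (- int k))" by (subst sum.reindex) (auto simp: inj_on_def)
  finally show ?thesis .
qed

text \<open>
  The general term of the short-time series.
\<close>

definition theta_term :: "real \<Rightarrow> real \<Rightarrow> int \<Rightarrow> real"
  where "theta_term t z = (\<lambda>k. exp (- (of_int k * (of_int k + 1) * pi^2) / t) *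
          ((2 * of_int k + 1) + 2 * of_int k * exp (- (pi / (2*t)) * (z + 2 * of_int k * pi))) /
          (1 + exp (- (pi / (2*t)) * (z + 2 * of_int k * pi)))^2)"

text \<open>
  The two variables of the double series. Their product is \<open>exp (- pi^2 / t)\<close>.
\<close>

definition nome_x :: "real \<Rightarrow> real \<Rightarrow> real" where "nome_x t z = exp (- (pi * z / (2 * t)))"
definition nome_y :: "real \<Rightarrow> real \<Rightarrow> real" where "nome_y t z = exp (- (pi\<^sup>2 / t - pi * z / (2 * t)))"

lemma nome_bounds:
  assumes "t > 0" "0 < z" "z < pi"
  shows "0 < nome_x t z" "nome_x t z < 1" "0 < nome_y t z" "nome_y t z < 1"
proof -
  show "0 < nome_x t z" "0 < nome_y t z" by (simp_all add: nome_x_def nome_y_def)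
  show "nome_x t z < 1" using assms by (simp add: nome_x_def)
  have "pi * z / (2 * t) < pi * (2 * pi) / (2 * t)"
    using assms by (intro divide_strict_right_mono mult_strict_left_mono) auto
  also have "\<dots> = pi\<^sup>2 / t" by (simp add: power2_eq_square)
  finally show "nome_y t z < 1" by (simp add: nome_y_def)
qed

lemma nome_product: "nome_x t z * nome_y t z = exp (- (pi\<^sup>2 / t))"
  by (simp add: nome_x_def nome_y_def exp_add[symmetric])

lemma nome_product_power: "(nome_x t z * nome_y t z) ^ n = exp (- (real n * (pi\<^sup>2 / t)))"
  unfolding nome_product by (simp add: exp_of_nat_mult[symmetric])

text \<open>
  The residues with positive index are the row sums of the double series.
\<close>

lemma dual_term_pos:
  assumes "t > 0"
  shows "dual_term t z (int j + 1) = exp (z\<^sup>2 / (4 * t)) / t\<^sup>2 * ((pi * (real j + 1) - z / 2) *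
     - ((-1) ^ j * nome_x t z ^ (j + 1) / (1 + nome_y t z * (nome_x t z * nome_y t z) ^ j)))"
proof -
  define b where "b = dual_pole t z (int j + 1)"
  have b: "b = (pi * (real j + 1) - z / 2) / t" by (simp add: b_def dual_pole_def)
  have e1: "exp (- (z / 2) * b) = exp (z\<^sup>2 / (4 * t)) * nome_x t z ^ (j + 1)"
  proof -
    have "nome_x t z ^ (j + 1) = exp (real (j + 1) * - (pi * z / (2 * t)))"
      unfolding nome_x_def by (rule exp_of_nat_mult[symmetric])
    moreover have "- (z / 2) * b = z\<^sup>2 / (4 * t) + real (j + 1) * - (pi * z / (2 * t))"
      using assms by (simp add: b field_simps power2_eq_square)
    ultimately show ?thesis by (simp only: exp_add)
  qed
  have e2: "exp (- pi * b) = nome_y t z * (nome_x t z * nome_y t z) ^ j"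
  proof -
    have "- pi * b = - (pi\<^sup>2 / t - pi * z / (2 * t)) + - (real j * (pi\<^sup>2 / t))"
      using assms by (simp add: b field_simps power2_eq_square)
    then show ?thesis unfolding nome_product_power unfolding nome_y_def by (simp only: exp_add)
  qed
  have s: "(-1::real) powi (int j + 1) = - ((-1) ^ j)"
    by (simp add: power_int_add)
  have k: "- a * (B / t) * (E * X) / (t * D) = E / t\<^sup>2 * (B * - (a * X / D))" for a B E X D :: real
    by (simp add: power2_eq_square mult_ac)
  show ?thesis unfolding dual_term_def b_def[symmetric] e1 e2 s unfolding b by (rule k)
qed

text \<open>
  The residues with index 0 or negative are its column sums. The fraction is expanded by \<open>u\<close> to make both
  exponentials decay.
\<close>

lemma dual_term_neg:
  assumes "t > 0"
  shows "dual_term t z (- int n) = exp (z\<^sup>2 / (4 * t)) / t\<^sup>2 * ((- pi * real n + - (z / 2)) *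
     ((-1) ^ n * nome_y t z ^ n * nome_x t z / (1 + nome_x t z * (nome_x t z * nome_y t z) ^ n)))"
proof -
  define b where "b = dual_pole t z (- int n)"
  define u where "u = nome_x t z * (nome_x t z * nome_y t z) ^ n"
  have u0: "u > 0" by (simp add: u_def nome_x_def nome_y_def)
  have b: "b = (- pi * real n + - (z / 2)) / t" by (simp add: b_def dual_pole_def)
  have u: "u = exp (- (pi * z / (2 * t)) + - (real n * (pi\<^sup>2 / t)))"
    unfolding u_def nome_product_power unfolding nome_x_def by (simp only: exp_add)
  have e1: "exp (- (z / 2) * b) * u = exp (z\<^sup>2 / (4 * t)) * (nome_y t z ^ n * nome_x t z)"
  proof -
    have "nome_y t z ^ n = exp (real n * - (pi\<^sup>2 / t - pi * z / (2 * t)))"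
      unfolding nome_y_def by (rule exp_of_nat_mult[symmetric])
    moreover have "- (z / 2) * b + (- (pi * z / (2 * t)) + - (real n * (pi\<^sup>2 / t)))
      = z\<^sup>2 / (4 * t) + (real n * - (pi\<^sup>2 / t - pi * z / (2 * t)) + - (pi * z / (2 * t)))"
      using assms by (simp add: b field_simps power2_eq_square)
    ultimately show ?thesis unfolding u nome_x_def by (simp only: exp_add[symmetric])
  qed
  have e2: "exp (- pi * b) = 1 / u"
  proof -
    have "- pi * b = - (- (pi * z / (2 * t)) + - (real n * (pi\<^sup>2 / t)))"
      using assms by (simp add: b field_simps power2_eq_square)
    then show ?thesis unfolding u by (simp only: exp_minus inverse_eq_divide)
  qed
  have s: "(-1::real) powi (- int n) = (-1) ^ n"
    by (simp add: power_int_minus_left)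
  have k: "a * (B / t) * c / (t * (1 + 1 / u)) = E / t\<^sup>2 * (B * (a * (P * X) / (1 + u)))"
    if "c * u = E * (P * X)" for a B c E P X :: real
  proof -
    have "c / (1 + 1 / u) = c * u / (1 + u)" using u0 by (simp add: field_simps)
    then have "c / (1 + 1 / u) = E * (P * X) / (1 + u)" using that by simp
    moreover have "a * (B / t) * c / (t * (1 + 1 / u)) = a * B / t\<^sup>2 * (c / (1 + 1 / u))"
      by (simp add: power2_eq_square)
    ultimately show ?thesis by (simp add: mult_ac)
  qed
  show ?thesis unfolding dual_term_def b_def[symmetric] e2 s u_def[symmetric] mult.assoc[of "(-1) ^ n" "nome_y t z ^ n"]
    unfolding b using k[OF e1[unfolded b]] by (simp only: mult.assoc)
qed

text \<open>
  For negative \<open>K\<close> the exponential \<open>E\<close> in the short-time series is large; the hook sum is written in terms of its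
  inverse \<open>W\<close>.
\<close>

lemma hook_sum_theta_term:
  assumes "t > 0"
  shows "hook_sum (nome_x t z) (nome_y t z) K = nome_x t z * theta_term t z K"
proof -
  define E where "E = exp (- (pi / (2*t)) * (z + 2 * of_int K * pi))"
  define D where "D = exp (- (of_int K * (of_int K + 1) * pi\<^sup>2) / t)"
  have E0: "E > 0" by (simp add: E_def)
  have th: "theta_term t z K = D * ((2 * of_int K + 1) + 2 * of_int K * E) / (1 + E)\<^sup>2"
    by (simp add: theta_term_def E_def D_def)
  show ?thesis
  proof (cases "K \<ge> 0")
    case True
    define m where "m = nat K"
    have m: "real_of_int K = real m" using True by (simp add: m_def)
    have E: "nome_x t z * (nome_x t z * nome_y t z) ^ m = E"
    proof -
      have "- (pi / (2*t)) * (z + 2 * real m * pi) = - (pi * z / (2 * t)) + - (real m * (pi\<^sup>2 / t))"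
        using assms by (simp add: field_simps power2_eq_square)
      then show ?thesis unfolding nome_product_power E_def m unfolding nome_x_def by (simp only: exp_add)
    qed
    have D: "(nome_x t z * nome_y t z) ^ (m * (m + 1)) = D"
    proof -
      have "- (real (m * (m + 1)) * (pi\<^sup>2 / t)) = - (real m * (real m + 1) * pi\<^sup>2) / t"
        using assms by (simp add: field_simps)
      then show ?thesis unfolding nome_product_power D_def m by (simp only:)
    qed
    have "2 * real m / (1 + E) + 1 / (1 + E)\<^sup>2 = ((2 * real m + 1) + 2 * real m * E) / (1 + E)\<^sup>2"
      using E0 by (simp add: divide_simps) (simp add: power2_eq_square algebra_simps)
    then show ?thesis
      using True unfolding hook_sum_def th m_def[symmetric] E D m by simp
  next
    case False
    define n where "n = nat (- K) - 1"
    have K: "nat (- K) = Suc n" "real_of_int (- K) = real (Suc n)" "real_of_int K = - real (Suc n)"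
      using False by (auto simp: n_def)
    define W where "W = nome_y t z * (nome_x t z * nome_y t z) ^ n"
    have W0: "W > 0" by (simp add: W_def nome_x_def nome_y_def)
    have Wexp: "W = exp (- (pi\<^sup>2 / t - pi * z / (2 * t)) + - (real n * (pi\<^sup>2 / t)))"
      unfolding W_def nome_product_power unfolding nome_y_def by (simp only: exp_add)
    have EW: "E = 1 / W"
    proof -
      have "- (pi / (2*t)) * (z + 2 * - real (Suc n) * pi) = - (- (pi\<^sup>2 / t - pi * z / (2 * t)) + - (real n * (pi\<^sup>2 / t)))"
        using assms by (simp add: field_simps power2_eq_square)
      then show ?thesis unfolding Wexp E_def K(3) by (simp only: exp_minus inverse_eq_divide)
    qed
    have xW: "nome_x t z * D * W = (nome_x t z * nome_y t z) ^ (Suc n * Suc n)"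
    proof -
      have "- (pi * z / (2 * t)) + - (- real (Suc n) * (- real (Suc n) + 1) * pi\<^sup>2) / t + (- (pi\<^sup>2 / t - pi * z / (2 * t)) + - (real n * (pi\<^sup>2 / t)))
        = - (real (Suc n * Suc n) * (pi\<^sup>2 / t))"
        using assms by (simp add: field_simps power2_eq_square)
      then show ?thesis unfolding nome_product_power unfolding Wexp D_def K(3) nome_x_def by (simp only: exp_add[symmetric])
    qed
    have "nome_x t z * theta_term t z K = nome_x t z * D * (((2 * - real (Suc n) + 1) + 2 * - real (Suc n) * (1 / W)) / (1 + 1 / W)\<^sup>2)"
      unfolding th EW K(3) by simp
    also have "((2 * - real (Suc n) + 1) + 2 * - real (Suc n) * (1 / W)) / (1 + 1 / W)\<^sup>2
      = - (W * ((2 * real (Suc n) - 1) / (1 + W) + 1 / (1 + W)\<^sup>2))"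
    proof -
      have "((2 * - c + 1) + 2 * - c * (1 / W)) / (1 + 1 / W)\<^sup>2 = - (W * ((2 * c - 1) / (1 + W) + 1 / (1 + W)\<^sup>2))" for c
      proof -
        have "1 + 1 / W = (1 + W) / W" using W0 by (simp add: field_simps)
        then have "((2 * - c + 1) + 2 * - c * (1 / W)) / (1 + 1 / W)\<^sup>2 = ((2 * - c + 1) + 2 * - c * (1 / W)) * W\<^sup>2 / (1 + W)\<^sup>2"
          by (simp add: power_divide)
        also have "((2 * - c + 1) + 2 * - c * (1 / W)) * W\<^sup>2 = - (W * ((2 * c - 1) * (1 + W) + 1))"
          using W0 by (simp add: field_simps power2_eq_square)
        also have "- (W * ((2 * c - 1) * (1 + W) + 1)) / (1 + W)\<^sup>2 = - (W * ((2 * c - 1) * (1 + W) / (1 + W)\<^sup>2 + 1 / (1 + W)\<^sup>2))"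
        proof -
          have "- (W * (u + 1)) / v = - (W * (u / v + 1 / v))" for u v
            by (simp add: add_divide_distrib diff_divide_distrib distrib_left)
          then show ?thesis .
        qed
        also have "(2 * c - 1) * (1 + W) / (1 + W)\<^sup>2 = (2 * c - 1) / (1 + W)"
          using W0 by (simp add: power2_eq_square)
        finally show ?thesis .
      qed
      then show ?thesis .
    qed
    also have "nome_x t z * D * - (W * ((2 * real (Suc n) - 1) / (1 + W) + 1 / (1 + W)\<^sup>2))
      = - (nome_x t z * D * W) * ((2 * real (Suc n) - 1) / (1 + W) + 1 / (1 + W)\<^sup>2)"
      by (simp only: mult_minus_left mult_minus_right mult.assoc)
    finally show ?thesis
      using False unfolding hook_sum_def xW K diff_Suc_1 W_def[symmetric] by simp
  qed
qed

text \<open>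
  The residue computation relates the sum over odd integers, which is the spectral series, to rows and columns of the
  double series, and \<open>lattice_duality\<close> passes from these to the hooks. The part of the residues proportional to
  \<open>z\<close> is the constant weight \<open>b = - z / 2\<close>, which drops out.
\<close>

lemma spectral_sum_eq_theta_sum:
  assumes t: "t > 0" and z: "0 < z" "z < pi"
  shows "(\<Sum>\<^sub>\<infinity>x. spectral_term t z x) = pi\<^sup>2 * exp t / (4 * t\<^sup>2) * exp (- (2 * pi * z - z\<^sup>2) / (4 * t)) * (\<Sum>\<^sub>\<infinity>k. theta_term t z k)"
proof -
  let ?x = "nome_x t z" and ?y = "nome_y t z"
  define C where "C = exp (z\<^sup>2 / (4 * t)) / t\<^sup>2"
  define Sp where "Sp = (\<Sum>\<^sub>\<infinity>x. spectral_term t z x)"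
  from lattice_duality[OF nome_bounds[OF assms]] obtain H where
    H: "(hook_sum ?x ?y has_sum H) UNIV"
    and lim: "\<And>a b. (\<lambda>N. (\<Sum>j<N. (a * (real j + 1) + b) * - ((-1) ^ j * ?x ^ (j + 1) / (1 + ?y * (?x * ?y) ^ j)))
        + (\<Sum>k<Suc N. (- a * real k + b) * ((-1) ^ k * ?y ^ k * ?x / (1 + ?x * (?x * ?y) ^ k)))) \<longlonglongrightarrow> - a * H"
    by blast
  have dual: "(\<Sum>l\<in>{- int N..int N}. dual_term t z l) = C *
      ((\<Sum>j<N. (pi * (real j + 1) + - (z / 2)) * - ((-1) ^ j * ?x ^ (j + 1) / (1 + ?y * (?x * ?y) ^ j)))
        + (\<Sum>k<Suc N. (- pi * real k + - (z / 2)) * ((-1) ^ k * ?y ^ k * ?x / (1 + ?x * (?x * ?y) ^ k))))" for N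
    unfolding sum_symmetric_int dual_term_pos[OF t] dual_term_neg[OF t] C_def distrib_left sum_distrib_left
    by (simp only: diff_conv_add_uminus)
  have "(\<lambda>N. \<Sum>l\<in>{- int N..int N}. dual_term t z l) \<longlonglongrightarrow> C * (- pi * H)"
    unfolding dual by (intro tendsto_mult_left lim)
  moreover have "(\<lambda>N. 2 / pi * (\<Sum>i<N. odd_term t z i)) \<longlonglongrightarrow> 4 / (pi * exp t) * Sp"
  proof -
    have "(\<lambda>N. \<Sum>i<N. exp t / 2 * odd_term t z i) \<longlonglongrightarrow> Sp"
      using spectral_sum_odd_terms[OF t, of z] by (simp add: sums_def Sp_def)
    then have "(\<lambda>N. 4 / (pi * exp t) * (\<Sum>i<N. exp t / 2 * odd_term t z i)) \<longlonglongrightarrow> 4 / (pi * exp t) * Sp"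
      by (rule tendsto_mult_left)
    moreover have "4 / (pi * exp t) * (\<Sum>i<N. exp t / 2 * odd_term t z i) = 2 / pi * (\<Sum>i<N. odd_term t z i)" for N
      unfolding sum_distrib_left[symmetric] by simp
    ultimately show ?thesis by simp
  qed
  ultimately have "(\<lambda>N. 2 / pi * (\<Sum>i<N. odd_term t z i) + (\<Sum>l\<in>{- int N..int N}. dual_term t z l)) \<longlonglongrightarrow> 4 / (pi * exp t) * Sp + C * (- pi * H)"
    by (intro tendsto_add)
  then have "4 / (pi * exp t) * Sp + C * (- pi * H) = 0"
    by (rule LIMSEQ_unique) (rule residue_sum_tendsto_0[OF assms, unfolded residue_sum_def[abs_def]])
  then have "Sp = pi\<^sup>2 * exp t / 4 * C * H"
    by (simp add: field_simps power2_eq_square)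
  moreover have "(\<Sum>\<^sub>\<infinity>k. theta_term t z k) = H / ?x"
  proof (rule infsumI)
    have "((\<lambda>k. 1 / ?x * hook_sum ?x ?y k) has_sum (1 / ?x * H)) UNIV"
      using H by (rule has_sum_cmult_right)
    then show "(theta_term t z has_sum (H / ?x)) UNIV"
      using nome_bounds(1)[OF assms] by (simp add: hook_sum_theta_term[OF t])
  qed
  moreover have "exp (- (2 * pi * z - z\<^sup>2) / (4 * t)) = exp (z\<^sup>2 / (4 * t)) * ?x"
  proof -
    have "- (2 * pi * z - z\<^sup>2) / (4 * t) = z\<^sup>2 / (4 * t) + - (pi * z / (2 * t))"
      using t by (simp add: field_simps)
    then show ?thesis unfolding nome_x_def by (simp only: exp_add)
  qed
  ultimately show ?thesis
    using nome_bounds(1)[OF assms] by (simp add: Sp_def C_def)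
qed

section \<open>The short-time series and its asymptotics\<close>

lemma summable_linear_geometric_int:
  fixes r :: real
  assumes "0 < r" "r < 1"
  shows "(\<lambda>k::int. (2 * \<bar>of_int k\<bar> + 1) * r ^ nat \<bar>k\<bar>) summable_on UNIV" (is "?f summable_on _")
proof -
  have 1: "(\<lambda>n::nat. (2 * real n + 1) * r ^ n) summable_on UNIV"
  proof -
    have "summable (\<lambda>n. 2 * (of_nat (Suc n) * r ^ n) - r ^ n)"
      using geometric_deriv_sums[of r] assms
      by (intro summable_diff summable_mult summable_geometric) (auto simp: sums_iff)
    then have "summable (\<lambda>n. (2 * real n + 1) * r ^ n)" by (simp add: algebra_simps)
    then show ?thesis using assms by (subst summable_on_UNIV_nonneg_real_iff) auto
  qed
  have "?f summable_on range int"
    using 1 by (subst summable_on_reindex) (auto simp: o_def)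
  moreover have "?f summable_on range (\<lambda>n. - int n)"
    using 1 by (subst summable_on_reindex) (auto simp: o_def inj_on_def)
  ultimately have "?f summable_on (range int \<union> range (\<lambda>n. - int n))"
    by (rule summable_on_union)
  moreover have "range int \<union> range (\<lambda>n. - int n) = UNIV"
  proof (intro equalityI subsetI)
    fix k :: int
    show "k \<in> range int \<union> range (\<lambda>n. - int n)"
      by (cases k rule: int_cases2) auto
  qed simp
  ultimately show ?thesis by simp
qed

lemma theta_term_eq:
  "theta_term t z k = exp (- (of_int k * (of_int k + 1) * pi\<^sup>2) / t) *
     (2 * of_int k / (1 + exp (- (pi / (2*t)) * (z + 2 * of_int k * pi)))
       + 1 / (1 + exp (- (pi / (2*t)) * (z + 2 * of_int k * pi)))\<^sup>2)"
proof -
  have "((2 * a + 1) + 2 * a * E) / (1 + E)\<^sup>2 = 2 * a / (1 + E) + 1 / (1 + E)\<^sup>2" if "E > 0" for a E :: real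
    using that by (simp add: divide_simps) (simp add: power2_eq_square algebra_simps)
  then show ?thesis unfolding theta_term_def by (simp only: exp_gt_zero times_divide_eq_right[symmetric])
qed

lemma theta_factor_bound: "\<bar>2 * a / (1 + E) + 1 / (1 + E)\<^sup>2\<bar> \<le> 2 * \<bar>a\<bar> + 1" if "E > 0" for a E :: real
proof -
  have "\<bar>2 * a / (1 + E)\<bar> \<le> 2 * \<bar>a\<bar>"
  proof -
    have "2 * \<bar>a\<bar> / (1 + E) \<le> 2 * \<bar>a\<bar> / 1" using that by (intro divide_left_mono) auto
    then show ?thesis using that by (simp add: abs_mult)
  qed
  moreover have "\<bar>1 / (1 + E)\<^sup>2\<bar> \<le> 1"
    using that by (simp add: divide_le_eq one_le_power)
  ultimately show ?thesis by linarith
qed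

text \<open>
  A majorant that does not depend on \<open>z\<close>, from \<open>k * (k + 1) \<ge> \<bar>k\<bar> - 1\<close>.
\<close>

lemma theta_term_bound:
  assumes "t > 0"
  shows "\<bar>theta_term t z k\<bar> \<le> exp (pi\<^sup>2 / t) * ((2 * \<bar>of_int k\<bar> + 1) * exp (- (pi\<^sup>2 / t)) ^ nat \<bar>k\<bar>)"
proof -
  have k: "\<bar>k\<bar> - 1 \<le> k * (k + 1)"
  proof (cases "k \<ge> 0")
    case True
    then have "0 \<le> k * k" by simp
    with True show ?thesis by (simp add: algebra_simps)
  next
    case False
    then have "0 \<le> (k + 1) * (k + 1)" "k \<le> -1" by auto
    then show ?thesis by (simp add: algebra_simps)
  qed
  have "real_of_int (\<bar>k\<bar> - 1) * (pi\<^sup>2 / t) \<le> real_of_int (k * (k + 1)) * (pi\<^sup>2 / t)"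
    using k assms by (intro mult_right_mono) (simp only: of_int_le_iff, simp)
  moreover have "- (of_int k * (of_int k + 1) * pi\<^sup>2) / t = - (real_of_int (k * (k + 1)) * (pi\<^sup>2 / t))"
    by simp
  moreover have "c + real (nat \<bar>k\<bar>) * (- c) = - (real_of_int (\<bar>k\<bar> - 1) * c)" for c :: real
    by (simp add: algebra_simps)
  ultimately have "- (of_int k * (of_int k + 1) * pi\<^sup>2) / t \<le> pi\<^sup>2 / t + real (nat \<bar>k\<bar>) * (- (pi\<^sup>2 / t))"
    by (simp only: neg_le_iff_le)
  then have "exp (- (of_int k * (of_int k + 1) * pi\<^sup>2) / t) \<le> exp (pi\<^sup>2 / t + real (nat \<bar>k\<bar>) * (- (pi\<^sup>2 / t)))"
    by simp
  also have "\<dots> = exp (pi\<^sup>2 / t) * exp (- (pi\<^sup>2 / t)) ^ nat \<bar>k\<bar>"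
    unfolding exp_add by (simp only: exp_of_nat_mult)
  finally have "exp (- (of_int k * (of_int k + 1) * pi\<^sup>2) / t) * \<bar>2 * of_int k / (1 + exp (- (pi / (2*t)) * (z + 2 * of_int k * pi)))
       + 1 / (1 + exp (- (pi / (2*t)) * (z + 2 * of_int k * pi)))\<^sup>2\<bar> \<le> (exp (pi\<^sup>2 / t) * exp (- (pi\<^sup>2 / t)) ^ nat \<bar>k\<bar>) * (2 * \<bar>of_int k\<bar> + 1)"
    by (intro mult_mono theta_factor_bound) auto
  then show ?thesis unfolding theta_term_eq abs_mult by (simp only: abs_exp_cancel mult_ac)
qed

lemma theta_bound_summable:
  assumes "t > 0"
  shows "(\<lambda>k::int. exp (pi\<^sup>2 / t) * ((2 * \<bar>of_int k\<bar> + 1) * exp (- (pi\<^sup>2 / t)) ^ nat \<bar>k\<bar>)) summable_on UNIV"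
  using assms by (intro summable_on_cmult_right summable_linear_geometric_int) auto

lemma theta_term_summable:
  assumes "t > 0"
  shows "theta_term t z summable_on UNIV"
  by (rule summable_on_iff_abs_summable_on_real[THEN iffD2],
      rule Infinite_Sum.abs_summable_on_comparison_test'[OF theta_bound_summable[OF assms]])
     (simp only: real_norm_def theta_term_bound[OF assms])

text \<open>
  For \<open>z = 0\<close> the residue computation breaks down, since the exponential no longer decays in the upper half plane.
  Both sides are continuous there: the kernel by assumption, the series by dominated convergence.
\<close>

lemma kernel_theta_formula:
  assumes P: "heat_semigroup P" and p: "smooth_kernel P p" and t: "t > 0" and z: "0 \<le> z" "z < pi"
  shows "p t (mat 1) (su2_mat (cis z) 0) =
    pi\<^sup>2 * exp t / (4 * t\<^sup>2) * exp (- (2 * pi * z - z\<^sup>2) / (4 * t)) * (\<Sum>\<^sub>\<infinity>k. theta_term t z k)"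
proof -
  let ?K = "\<lambda>z. p t (mat 1) (su2_mat (cis z) 0)"
  let ?R = "\<lambda>z. pi\<^sup>2 * exp t / (4 * t\<^sup>2) * exp (- (2 * pi * z - z\<^sup>2) / (4 * t)) * (\<Sum>\<^sub>\<infinity>k. theta_term t z k)"
  have pos: "?K z = ?R z" if "0 < z" "z < pi" for z
    using kernel_spectral_expansion[OF P p t, of z] spectral_sum_eq_theta_sum[OF t that] by simp
  show ?thesis
  proof (cases "z = 0")
    case False
    with z show ?thesis by (intro pos) auto
  next
    case True
    \<comment> \<open>any sequence of admissible \<open>z\<close> that tends to 0\<close>
    define s where "s n = 1 / real (Suc n)" for n
    have s: "0 < s n" "s n < pi" for n
    proof -
      show "0 < s n" by (simp add: s_def)
      have "s n \<le> 1" by (simp add: s_def)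
      then show "s n < pi" using pi_gt3 by linarith
    qed
    have s0: "s \<longlonglongrightarrow> 0"
      unfolding s_def using LIMSEQ_inverse_real_of_nat by (simp add: inverse_eq_divide)
    have "continuous_on UNIV ?K"
    proof -
      have "continuous_on UNIV (\<lambda>z. (\<lambda>(t, x, y). p t x y) (t, mat 1, su2_mat (cis z) 0))"
        using t mat_one_in_SU2
        by (intro continuous_on_compose2[OF kernel_continuous[OF p]])
           (auto simp: cis_conv_exp intro!: continuous_intros su2_mat_in_SU2)
      then show ?thesis by simp
    qed
    then have K: "(\<lambda>n. ?K (s n)) \<longlonglongrightarrow> ?K 0"
      using s0 by (rule continuous_on_tendsto_compose) auto
    have R: "(\<lambda>n. ?R (s n)) \<longlonglongrightarrow> ?R 0"
    proof (intro tendsto_mult tendsto_const tendsto_exp)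
      show "(\<lambda>n. - (2 * pi * s n - (s n)\<^sup>2) / (4 * t)) \<longlonglongrightarrow> - (2 * pi * 0 - 0\<^sup>2) / (4 * t)"
        using t by (intro tendsto_intros s0) auto
      show "(\<lambda>n. \<Sum>\<^sub>\<infinity>k. theta_term t (s n) k) \<longlonglongrightarrow> (\<Sum>\<^sub>\<infinity>k. theta_term t 0 k)"
      proof (rule infsum_dominated_convergence[OF theta_bound_summable[OF t]])
        show "\<bar>theta_term t (s n) k\<bar> \<le> exp (pi\<^sup>2 / t) * ((2 * \<bar>of_int k\<bar> + 1) * exp (- (pi\<^sup>2 / t)) ^ nat \<bar>k\<bar>)" for n k
          by (rule theta_term_bound[OF t])
        show "(\<lambda>n. theta_term t (s n) k) \<longlonglongrightarrow> theta_term t 0 k" for k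
        proof -
          have nz: "(1 + exp a)\<^sup>2 \<noteq> 0" for a :: real
            using exp_gt_zero[of a] by (simp add: add_eq_0_iff) (smt (verit) exp_gt_zero)
          show ?thesis unfolding theta_term_def by (intro tendsto_intros s0 nz)
        qed
      qed
    qed
    have "(\<lambda>n. ?K (s n)) = (\<lambda>n. ?R (s n))" by (rule ext) (rule pos[OF s])
    with R have "(\<lambda>n. ?K (s n)) \<longlonglongrightarrow> ?R 0" by (simp only:)
    with K have "?K 0 = ?R 0" by (rule LIMSEQ_unique)
    with True show ?thesis by simp
  qed
qed

text \<open>
  Since \<open>z < pi\<close>, the product \<open>x * y\<close> is at most \<open>x^2\<close>. Once \<open>x \<le> 1 / 2\<close>, this bounds the difference of each
  term from its limit by \<open>x\<close> times a summable sequence that depends on neither \<open>t\<close> nor \<open>z\<close>.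
\<close>

lemma theta_sum_asymptotics:
  assumes z: "0 < z" "z < pi"
  shows "(\<lambda>t. (\<Sum>\<^sub>\<infinity>k. theta_term t z k) - 1) \<in> O[at_right 0](\<lambda>t. exp (- (pi * z / 2) / t))"
proof -
  \<comment> \<open>the summable sequence; \<open>b 0 = 2\<close> is needed for the term \<open>k = 0\<close>\<close>
  define b where "b k = 2 * ((2 * \<bar>real_of_int k\<bar> + 1) * (1 / 2) ^ nat \<bar>k\<bar>)" for k :: int
  have b: "b summable_on UNIV"
    unfolding b_def by (intro summable_on_cmult_right summable_linear_geometric_int) auto
  have bound: "\<bar>theta_term t z k - (if k = 0 then 1 else 0)\<bar> \<le> nome_x t z * b k"
    if t: "t > 0" and small: "nome_x t z \<le> 1 / 2" for t k
  proof -
    let ?x = "nome_x t z"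
    note nb = nome_bounds[OF t z]
    have Q: "?x * nome_y t z \<le> ?x\<^sup>2"
    proof -
      have "pi * z / t \<le> pi * pi / t" using t z by (intro divide_right_mono mult_left_mono) auto
      then have "exp (- (pi\<^sup>2 / t)) \<le> exp (- (pi * z / t))" by (simp add: power2_eq_square)
      also have "\<dots> = ?x\<^sup>2"
        by (simp add: nome_x_def power2_eq_square exp_add[symmetric])
      finally show ?thesis unfolding nome_product .
    qed
    have Qn: "(?x * nome_y t z) ^ n \<le> ?x ^ (2 * n)" for n
      using power_mono[OF Q, of n] nb by (simp add: power_mult)
    have xn: "?x ^ Suc n \<le> ?x * (1 / 2) ^ n" for n
      using power_mono[OF small, of n] nb by simp
    consider "k = 0" | n where "k = int (Suc n)" | n where "k = - int (Suc n)"
      by (metis int_cases2 nat.exhaust of_nat_0 minus_zero)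
    then show ?thesis
    proof cases
      case 1
      have "\<bar>1 / (1 + ?x)\<^sup>2 - 1\<bar> \<le> 2 * ?x"
      proof -
        have "1 - 1 / (1 + ?x)\<^sup>2 = ((1 + ?x)\<^sup>2 - 1) / (1 + ?x)\<^sup>2" using nb by (simp add: field_simps)
        also have "\<dots> = ?x * (2 + ?x) / (1 + ?x)\<^sup>2" by (simp add: power2_eq_square algebra_simps)
        also have "\<dots> \<le> 2 * ?x"
        proof -
          have "2 + ?x \<le> 2 * (1 + ?x)\<^sup>2" using nb by (simp add: power2_eq_square algebra_simps)
          then have "?x * (2 + ?x) \<le> ?x * (2 * (1 + ?x)\<^sup>2)" using nb by (intro mult_left_mono) auto
          then show ?thesis using nb by (simp add: divide_le_eq mult_ac)
        qed
        finally have "1 - 1 / (1 + ?x)\<^sup>2 \<le> 2 * ?x" .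
        moreover have "1 / (1 + ?x)\<^sup>2 \<le> 1" using nb by (simp add: divide_le_eq one_le_power)
        ultimately show ?thesis by linarith
      qed
      moreover have "theta_term t z 0 = 1 / (1 + ?x)\<^sup>2"
        by (simp add: theta_term_eq nome_x_def)
      ultimately show ?thesis using 1 by (simp add: b_def)
    next
      case (2 n)
      have "?x * \<bar>theta_term t z k\<bar> = \<bar>hook_sum ?x (nome_y t z) k\<bar>"
        unfolding hook_sum_theta_term[OF t] abs_mult using nb by simp
      also have "\<dots> = ?x * ((?x * nome_y t z) ^ (Suc n * (Suc n + 1)) *
          \<bar>2 * of_int k / (1 + ?x * (?x * nome_y t z) ^ Suc n) + 1 / (1 + ?x * (?x * nome_y t z) ^ Suc n)\<^sup>2\<bar>)"
      proof -
        have "nat k = Suc n" "k \<ge> 0" using 2 by auto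
        then show ?thesis unfolding hook_sum_def using nb by (simp only: if_True abs_mult power_abs abs_of_pos mult.assoc)
      qed
      also have "\<dots> \<le> ?x * (?x ^ (2 * (Suc n * (Suc n + 1))) * (2 * \<bar>of_int k\<bar> + 1))"
        using nb by (intro mult_left_mono mult_mono Qn theta_factor_bound) (auto intro!: mult_pos_pos zero_less_power)
      finally have "\<bar>theta_term t z k\<bar> \<le> ?x ^ (2 * (Suc n * (Suc n + 1))) * (2 * \<bar>of_int k\<bar> + 1)"
        using nb by (simp only: mult_le_cancel_left_pos)
      also have "\<dots> \<le> (?x * (1 / 2) ^ Suc n) * (2 * \<bar>of_int k\<bar> + 1)"
      proof (intro mult_right_mono order.trans[OF _ xn])
        show "?x ^ (2 * (Suc n * (Suc n + 1))) \<le> ?x ^ Suc (Suc n)"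
          using nb by (intro power_decreasing) auto
      qed auto
      also have "\<dots> = ?x * (b k / 2)"
      proof -
        have "nat \<bar>k\<bar> = Suc n" using 2 by simp
        then show ?thesis by (simp add: b_def)
      qed
      also have "\<dots> \<le> ?x * b k"
        using nb by (intro mult_left_mono) (simp_all add: b_def)
      finally show ?thesis using 2 by simp
    next
      case (3 n)
      let ?W = "nome_y t z * (?x * nome_y t z) ^ n"
      have W: "?W > 0" using nb by (intro mult_pos_pos zero_less_power) auto
      have "?x * \<bar>theta_term t z k\<bar> = \<bar>hook_sum ?x (nome_y t z) k\<bar>"
        unfolding hook_sum_theta_term[OF t] abs_mult using nb by simp
      also have "\<dots> = (?x * nome_y t z) ^ (Suc n * Suc n) * \<bar>(2 * real (Suc n) - 1) / (1 + ?W) + 1 / (1 + ?W)\<^sup>2\<bar>"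
      proof -
        have "nat (- k) = Suc n" "\<not> k \<ge> 0" "real_of_int (- k) = real (Suc n)" using 3 by auto
        then show ?thesis unfolding hook_sum_def using nb
          by (simp only: if_False abs_mult power_abs abs_of_pos abs_minus_cancel diff_Suc_1)
      qed
      also have "\<dots> \<le> ?x ^ (2 * (Suc n * Suc n)) * (2 * \<bar>of_int k\<bar> + 1)"
      proof (intro mult_mono Qn)
        have "2 * real (Suc n) - 1 = 2 * (real n + 1 / 2)" by simp
        then have "\<bar>(2 * real (Suc n) - 1) / (1 + ?W) + 1 / (1 + ?W)\<^sup>2\<bar> \<le> 2 * \<bar>real n + 1 / 2\<bar> + 1"
          using theta_factor_bound[OF W] by (simp only:)
        also have "\<dots> \<le> 2 * \<bar>of_int k\<bar> + 1" using 3 by simp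
        finally show "\<bar>(2 * real (Suc n) - 1) / (1 + ?W) + 1 / (1 + ?W)\<^sup>2\<bar> \<le> 2 * \<bar>of_int k\<bar> + 1" .
      qed (use nb in auto)
      also have "?x ^ (2 * (Suc n * Suc n)) = ?x * ?x ^ (2 * (Suc n * Suc n) - 1)"
        by (simp flip: power_Suc)
      finally have "?x * \<bar>theta_term t z k\<bar> \<le> ?x * (?x ^ (2 * (Suc n * Suc n) - 1) * (2 * \<bar>of_int k\<bar> + 1))"
        by (simp only: mult.assoc)
      then have "\<bar>theta_term t z k\<bar> \<le> ?x ^ (2 * (Suc n * Suc n) - 1) * (2 * \<bar>of_int k\<bar> + 1)"
        using nb by (simp only: mult_le_cancel_left_pos)
      also have "\<dots> \<le> (?x * (1 / 2) ^ n) * (2 * \<bar>of_int k\<bar> + 1)"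
      proof (intro mult_right_mono order.trans[OF _ xn])
        show "?x ^ (2 * (Suc n * Suc n) - 1) \<le> ?x ^ Suc n"
          using nb by (intro power_decreasing) auto
      qed auto
      also have "\<dots> = ?x * b k"
      proof -
        have "nat \<bar>k\<bar> = Suc n" using 3 by simp
        then show ?thesis by (simp add: b_def)
      qed
      finally show ?thesis using 3 by simp
    qed
  qed
  have est: "\<bar>(\<Sum>\<^sub>\<infinity>k. theta_term t z k) - 1\<bar> \<le> infsum b UNIV * nome_x t z"
    if t: "t > 0" and small: "nome_x t z \<le> 1 / 2" for t
  proof -
    let ?d = "\<lambda>k::int. theta_term t z k - (if k = 0 then 1 else 0)"
    have delta: "((\<lambda>k::int. if k = 0 then 1 else 0 :: real) has_sum 1) UNIV"
      by (rule has_sum_finite_neutralI[of "{0}"]) auto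
    have "(?d has_sum ((\<Sum>\<^sub>\<infinity>k. theta_term t z k) - 1)) UNIV"
      using has_sum_add[OF has_sum_infsum[OF theta_term_summable[OF t, of z]] has_sum_cmult_right[OF delta, of "-1"]]
      by simp
    then have d: "infsum ?d UNIV = (\<Sum>\<^sub>\<infinity>k. theta_term t z k) - 1" by (rule infsumI)
    have xb: "(\<lambda>k. nome_x t z * b k) summable_on UNIV" using b by (rule summable_on_cmult_right)
    have "(\<lambda>k. norm (?d k)) summable_on UNIV"
      by (rule Infinite_Sum.abs_summable_on_comparison_test'[OF xb]) (use bound[OF that] in simp)
    then have "norm (infsum ?d UNIV) \<le> (\<Sum>\<^sub>\<infinity>k. norm (?d k))" by (rule norm_infsum_bound)
    also have "\<dots> \<le> (\<Sum>\<^sub>\<infinity>k. nome_x t z * b k)"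
      by (rule infsum_mono[OF \<open>(\<lambda>k. norm (?d k)) summable_on UNIV\<close> xb]) (use bound[OF that] in simp)
    also have "\<dots> = nome_x t z * infsum b UNIV" by (rule infsum_cmult_right')
    also have "\<dots> = infsum b UNIV * nome_x t z" by (rule mult.commute)
    finally show ?thesis unfolding d by simp
  qed
  have nome: "nome_x t z = exp (- (pi * z / 2) / t)" for t by (simp add: nome_x_def)
  have "((\<lambda>t. exp (- (pi * z / 2) / t)) \<longlongrightarrow> 0) (at_right 0)"
    using z by real_asymp
  then have "eventually (\<lambda>t. exp (- (pi * z / 2) / t) < 1 / 2) (at_right 0)"
    by (rule order_tendstoD) simp
  moreover have "eventually (\<lambda>t::real. t > 0) (at_right 0)" by (rule eventually_at_right_less)
  ultimately have "eventually (\<lambda>t. norm ((\<Sum>\<^sub>\<infinity>k. theta_term t z k) - 1) \<le> infsum b UNIV * norm (exp (- (pi * z / 2) / t))) (at_right 0)"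
  proof eventually_elim
    case (elim t)
    then show ?case using est[of t] by (simp add: nome)
  qed
  then show ?thesis by (rule bigoI)
qed

theorem proposition3p9:
  fixes P :: "real \<Rightarrow> (cmat2 \<Rightarrow> real) \<Rightarrow> cmat2 \<Rightarrow> real"
    and p :: "real \<Rightarrow> cmat2 \<Rightarrow> cmat2 \<Rightarrow> real"
  assumes "heat_semigroup P"
    and "smooth_kernel P p"
  shows "(\<forall>t>0. \<forall>z\<in>{0..<pi}. \<forall>\<theta>\<in>{0..2*pi}.
      ((\<lambda>k::int. exp (- (of_int k * (of_int k + 1) * pi^2) / t) *
          ((2 * of_int k + 1) + 2 * of_int k * exp (- (pi / (2*t)) * (z + 2 * of_int k * pi))) /
          (1 + exp (- (pi / (2*t)) * (z + 2 * of_int k * pi)))^2) summable_on UNIV) \<and>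
      p t (mat 1) (cyl (0, \<theta>, z)) =
        pi^2 * exp t / (4 * t^2) * exp (- (2 * pi * z - z^2) / (4 * t)) *
        (\<Sum>\<^sub>\<infinity>k::int. exp (- (of_int k * (of_int k + 1) * pi^2) / t) *
          ((2 * of_int k + 1) + 2 * of_int k * exp (- (pi / (2*t)) * (z + 2 * of_int k * pi))) /
          (1 + exp (- (pi / (2*t)) * (z + 2 * of_int k * pi)))^2)) \<and>
    (\<forall>z\<in>{0<..<pi}. \<forall>\<theta>\<in>{0..2*pi}. \<exists>C>0. \<exists>R :: real \<Rightarrow> real.
      R \<in> O[at_right 0](\<lambda>t. exp (- C / t)) \<and>
      (\<forall>t>0. p t (mat 1) (cyl (0, \<theta>, z)) =
        pi^2 * exp t / (4 * t^2) * exp (- (2 * pi * z - z^2) / (4 * t)) * (1 + R t)))"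
proof -
  have cyl0: "cyl (0, \<theta>, z) = su2_mat (cis z) 0" for \<theta> z by (simp add: cyl_eq)
  note formula = kernel_theta_formula[OF assms]
  show ?thesis
    unfolding cyl0 theta_term_def[symmetric]
  proof (intro conjI ballI allI impI)
    fix t z :: real assume "t > 0" "z \<in> {0..<pi}"
    then show "theta_term t z summable_on UNIV"
      and "p t (mat 1) (su2_mat (cis z) 0) =
        pi^2 * exp t / (4 * t^2) * exp (- (2 * pi * z - z^2) / (4 * t)) * (\<Sum>\<^sub>\<infinity>k. theta_term t z k)"
      by (intro theta_term_summable formula; simp)+
  next
    fix z :: real assume "z \<in> {0<..<pi}"
    then have z: "0 < z" "z < pi" by auto
    show "\<exists>C>0. \<exists>R. R \<in> O[at_right 0](\<lambda>t. exp (- C / t)) \<and>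
      (\<forall>t>0. p t (mat 1) (su2_mat (cis z) 0) =
        pi^2 * exp t / (4 * t^2) * exp (- (2 * pi * z - z^2) / (4 * t)) * (1 + R t))"
    proof (intro exI conjI allI impI)
      show "pi * z / 2 > 0" using z by simp
      show "(\<lambda>t. (\<Sum>\<^sub>\<infinity>k. theta_term t z k) - 1) \<in> O[at_right 0](\<lambda>t. exp (- (pi * z / 2) / t))"
        by (rule theta_sum_asymptotics[OF z])
      fix t :: real assume "t > 0"
      then show "p t (mat 1) (su2_mat (cis z) 0) = pi^2 * exp t / (4 * t^2) *
          exp (- (2 * pi * z - z^2) / (4 * t)) * (1 + ((\<Sum>\<^sub>\<infinity>k. theta_term t z k) - 1))"
        using formula[of t z] z by simp
    qed
  qed
qed

end
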